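(* Let $\alpha>0$ and consider Poisson percolation on $\mathbb{Z}^2$ (defined in the context). For every $\epsilon\in(0,1/2)$, $$\lim_{t\to\infty} P\big(\mathcal{C}_0(t) \subseteq R(0,n(p_c-\epsilon,t))\big) = 1,$$ where $p_c=1/2$.
   Context: Poisson percolation: each nearest-neighbour edge of $\mathbb{Z}^2$ with midpoint $x$ is assigned an independent Poisson process of rate $\|x\|^{-\alpha}$, where $\|x\|=\max\{|x_1|,|x_2|\}$ is the $L^\infty$ norm and $\alpha>0$ is fixed. The edge becomes open at the time of the first arrival of its Poisson process, so at time $t$ the edge with midpoint $x$ is open with probability $\rho(x,t)=1-\exp(-t\|x\|^{-\alpha})$, independently over edges. $\mathcal{C}_0(t)$ is the set of vertices that can be reached from the origin by a path of edges open at time $t$. For $p\in(0,1)$ let $c_{p,\alpha}=(-\log(1-p))^{-1/\alpha}$ and $n(p,t)=\max\{\|x\| : \rho(x,t)\ge p\}=c_{p,\alpha}t^{1/\alpha}$. $R(0,r)=\{x:\|x\|\le r\}$. $p_c=1/2$ is the critical value of bond percolation on $\mathbb{Z}^2$. *)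

theory Defs
  imports "HOL-Probability.Probability"
begin

type_synonym vertex = "int \<times> int"
type_synonym edge = "vertex set"

definition adjacent :: "vertex \<Rightarrow> vertex \<Rightarrow> bool" where
  "adjacent u v \<longleftrightarrow> \<bar>fst u - fst v\<bar> + \<bar>snd u - snd v\<bar> = 1"

definition edges :: "edge set" where
  "edges = {{u, v} | u v. adjacent u v}"

definition linf :: "real \<times> real \<Rightarrow> real" where
  "linf x = max \<bar>fst x\<bar> \<bar>snd x\<bar>"

definition midpoint_uv :: "vertex \<Rightarrow> vertex \<Rightarrow> real \<times> real" where
  "midpoint_uv u v = ((real_of_int (fst u) + real_of_int (fst v)) / 2,
                      (real_of_int (snd u) + real_of_int (snd v)) / 2)"

definition edge_midnorm :: "edge \<Rightarrow> real" where
  "edge_midnorm e = (THE r. \<exists>u v. e = {u, v} \<and> adjacent u v \<and> r = linf (midpoint_uv u v))"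

definition rate :: "real \<Rightarrow> edge \<Rightarrow> real" where
  "rate \<alpha> e = edge_midnorm e powr (- \<alpha>)"

text \<open>Probability space: for each edge an independent exponential clock
  (the first arrival of its Poisson process of rate ||x||^(-alpha)).\<close>
definition poisson_perc :: "real \<Rightarrow> (edge \<Rightarrow> real) measure" where
  "poisson_perc \<alpha> = (\<Pi>\<^sub>M e\<in>edges. density lborel (exponential_density (rate \<alpha> e)))"

definition open_rel :: "(edge \<Rightarrow> real) \<Rightarrow> real \<Rightarrow> vertex rel" where
  "open_rel \<omega> t = {(u, v). adjacent u v \<and> \<omega> {u, v} \<le> t}"

definition cluster0 :: "(edge \<Rightarrow> real) \<Rightarrow> real \<Rightarrow> vertex set" where
  "cluster0 \<omega> t = {v. ((0, 0), v) \<in> (open_rel \<omega> t)\<^sup>*}"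

definition box :: "real \<Rightarrow> vertex set" where
  "box r = {x. linf (real_of_int (fst x), real_of_int (snd x)) \<le> r}"

definition c_const :: "real \<Rightarrow> real \<Rightarrow> real" where
  "c_const p \<alpha> = (- ln (1 - p)) powr (- 1 / \<alpha>)"

definition n_rad :: "real \<Rightarrow> real \<Rightarrow> real \<Rightarrow> real" where
  "n_rad \<alpha> p t = c_const p \<alpha> * t powr (1 / \<alpha>)"

definition p_c :: real where "p_c = 1 / 2"

end

theory Submission
  imports Defs
begin

text \<open>
  At time \<open>t\<close> the edges of midpoint norm at least \<open>n(q, t)\<close> are open with probability at most \<open>q\<close>. For
  \<open>p\<^sub>c - \<epsilon> < q < 1/2\<close> the annulus between the radii \<open>n(q, t)\<close> and \<open>n(p\<^sub>c - \<epsilon>, t)\<close> has width of order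
  \<open>t\<^bsup>1/\<alpha>\<^esup>\<close>, so a union bound over its middle circle reduces the theorem to exponential decay of the
  one-arm probability \<open>\<theta>\<^sub>n(q)\<close> for \<open>q < 1/2\<close>.

  For this we use the quantity \<open>\<phi>\<^sub>q(S)\<close> of Duminil-Copin and Tassion: if it is less than \<open>1\<close> for some
  finite \<open>S\<close>, then \<open>\<theta>\<^sub>n(q)\<close> decays exponentially; otherwise \<open>\<theta>\<^sub>n(p)\<close> is bounded below, uniformly in
  \<open>n\<close>, for every \<open>p \<in> (q, 1/2]\<close>. The latter is impossible. By the square-root trick a fixed box is joined
  with high probability to the left and to the right side of a large rectangle, whereas by duality the
  rectangle is crossed with probability at most \<open>1/2\<close>. Hence two distinct boundary clusters meet
  the fixed box with probability bounded below, and a local modification yields a positive density of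
  edges whose opening merges two boundary clusters. By Russo's formula the integral over \<open>p\<close> of the
  expected number of such edges is at most the size of the boundary, which is only linear in \<open>n\<close>.
\<close>

section \<open>Product measures on finite configurations\<close>

text \<open>What the overview calls impossible would classically be excluded by uniqueness of the
  infinite cluster together with duality. Here no infinite cluster is ever formed: percolation is
  expressed by bounds that are uniform in the size of a finite box, and every event at constant
  density depends on finitely many edges. The price is that the count of merging edges is controlled
  only after integration over the density, so it yields a contradiction at some density that cannot
  be prescribed. This is harmless because the lower bound on arms holds throughout
  \<open>(p, 1/2]\<close>.

  The self-dual rectangle has one more column than rows and is therefore the union of a square and
  its translate by one unit.

  The weights allow a different density on every edge, since the Poisson model is compared with a
  constant density separately in each small box of the annulus.\<close>

definition config_weight :: "'a set \<Rightarrow> ('a \<Rightarrow> real) \<Rightarrow> 'a set \<Rightarrow> real" where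
  "config_weight E p \<omega> = (\<Prod>e\<in>E. if e \<in> \<omega> then p e else 1 - p e)"

definition expect :: "'a set \<Rightarrow> ('a \<Rightarrow> real) \<Rightarrow> ('a set \<Rightarrow> real) \<Rightarrow> real" where
  "expect E p f = (\<Sum>\<omega>\<in>Pow E. config_weight E p \<omega> * f \<omega>)"

definition pr :: "'a set \<Rightarrow> ('a \<Rightarrow> real) \<Rightarrow> ('a set \<Rightarrow> bool) \<Rightarrow> real" where
  "pr E p A = expect E p (\<lambda>\<omega>. of_bool (A \<omega>))"

lemma expect_empty [simp]: "expect {} p f = f {}"
  by (simp add: expect_def config_weight_def)

text \<open>Conditioning on the state of a single edge. With induction over the edge set, this
  recursion yields marginals, independence, the Harris inequality and Russo's formula.\<close>

lemma expect_insert: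
  assumes "finite E" "e \<notin> E"
  shows "expect (insert e E) p f =
    p e * expect E p (\<lambda>\<omega>. f (insert e \<omega>)) + (1 - p e) * expect E p f"
proof -
  have w0: "config_weight (insert e E) p \<omega> = (1 - p e) * config_weight E p \<omega>" if "\<omega> \<in> Pow E" for \<omega>
  proof -
    have "e \<notin> \<omega>" using that assms by auto
    then show ?thesis using assms by (simp add: config_weight_def)
  qed
  have w1: "config_weight (insert e E) p (insert e \<omega>) = p e * config_weight E p \<omega>" for \<omega>
  proof -
    have "(\<Prod>x\<in>E. if x \<in> insert e \<omega> then p x else 1 - p x) = (\<Prod>x\<in>E. if x \<in> \<omega> then p x else 1 - p x)"
      using assms by (intro prod.cong) auto
    then show ?thesis using assms by (simp add: config_weight_def)
  qed
  have inj: "inj_on (insert e) (Pow E)" using assms by (auto simp: inj_on_def)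
  have "expect (insert e E) p f = (\<Sum>\<omega>\<in>Pow E. config_weight (insert e E) p \<omega> * f \<omega>)
     + (\<Sum>\<omega>\<in>insert e ` Pow E. config_weight (insert e E) p \<omega> * f \<omega>)"
    unfolding expect_def Pow_insert using assms by (intro sum.union_disjoint) auto
  also have "(\<Sum>\<omega>\<in>insert e ` Pow E. config_weight (insert e E) p \<omega> * f \<omega>)
     = (\<Sum>\<omega>\<in>Pow E. config_weight (insert e E) p (insert e \<omega>) * f (insert e \<omega>))"
    by (subst sum.reindex[OF inj]) simp
  finally show ?thesis
    by (simp add: expect_def w0 w1 sum_distrib_left mult.assoc)
qed

lemma expect_cong:
  assumes "\<And>\<omega>. \<omega> \<subseteq> E \<Longrightarrow> f \<omega> = g \<omega>"
  shows "expect E p f = expect E p g"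
  unfolding expect_def using assms by (intro sum.cong) auto

lemma pr_cong:
  assumes "\<And>\<omega>. \<omega> \<subseteq> E \<Longrightarrow> A \<omega> \<longleftrightarrow> B \<omega>"
  shows "pr E p A = pr E p B"
  unfolding pr_def using assms by (intro expect_cong) auto

lemma expect_add: "expect E p (\<lambda>\<omega>. f \<omega> + g \<omega>) = expect E p f + expect E p g"
  by (simp add: expect_def algebra_simps sum.distrib)

lemma expect_diff: "expect E p (\<lambda>\<omega>. f \<omega> - g \<omega>) = expect E p f - expect E p g"
  by (simp add: expect_def algebra_simps sum_subtractf)

lemma expect_uminus: "expect E p (\<lambda>\<omega>. - f \<omega>) = - expect E p f"
  by (simp add: expect_def sum_negf)

lemma expect_sum: "expect E p (\<lambda>\<omega>. \<Sum>i\<in>I. f i \<omega>) = (\<Sum>i\<in>I. expect E p (f i))"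
  unfolding expect_def sum_distrib_left by (rule sum.swap)

lemma expect_const:
  assumes "finite E" shows "expect E p (\<lambda>_. c) = c"
  using assms by (induction E) (simp_all add: expect_insert algebra_simps)

lemma expect_mono:
  assumes "\<And>e. e \<in> E \<Longrightarrow> 0 \<le> p e \<and> p e \<le> 1" "\<And>\<omega>. \<omega> \<subseteq> E \<Longrightarrow> f \<omega> \<le> g \<omega>"
  shows "expect E p f \<le> expect E p g"
  unfolding expect_def config_weight_def using assms
  by (intro sum_mono mult_left_mono prod_nonneg) auto

lemma pr_mono:
  assumes "\<And>e. e \<in> E \<Longrightarrow> 0 \<le> p e \<and> p e \<le> 1" "\<And>\<omega>. \<omega> \<subseteq> E \<Longrightarrow> A \<omega> \<Longrightarrow> B \<omega>"
  shows "pr E p A \<le> pr E p B"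
  unfolding pr_def using assms by (intro expect_mono) auto

lemma pr_nonneg:
  assumes "\<And>e. e \<in> E \<Longrightarrow> 0 \<le> p e \<and> p e \<le> 1"
  shows "0 \<le> pr E p A"
  unfolding pr_def expect_def config_weight_def using assms
  by (intro sum_nonneg mult_nonneg_nonneg prod_nonneg) auto

lemma pr_le_1:
  assumes "finite E" "\<And>e. e \<in> E \<Longrightarrow> 0 \<le> p e \<and> p e \<le> 1"
  shows "pr E p A \<le> 1"
proof -
  have "pr E p A \<le> expect E p (\<lambda>_. 1)"
    unfolding pr_def using assms by (intro expect_mono) auto
  then show ?thesis by (simp add: expect_const assms)
qed

lemma pr_not:
  assumes "finite E" shows "pr E p (\<lambda>\<omega>. \<not> A \<omega>) = 1 - pr E p A"
  using expect_diff[of E p "\<lambda>_. 1" "\<lambda>\<omega>. of_bool (A \<omega>)"]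
  by (simp add: pr_def expect_const assms of_bool_not_iff)

lemma pr_Ex_le_sum:
  assumes "\<And>e. e \<in> E \<Longrightarrow> 0 \<le> p e \<and> p e \<le> 1" "finite I"
  shows "pr E p (\<lambda>\<omega>. \<exists>i\<in>I. A i \<omega>) \<le> (\<Sum>i\<in>I. pr E p (A i))"
proof -
  have "of_bool (\<exists>i\<in>I. A i \<omega>) \<le> (\<Sum>i\<in>I. of_bool (A i \<omega>) :: real)" for \<omega>
  proof (cases "\<exists>i\<in>I. A i \<omega>")
    case True
    then obtain i where "i \<in> I" "A i \<omega>" by auto
    then show ?thesis using assms(2) member_le_sum[of i I "\<lambda>i. of_bool (A i \<omega>) :: real"] by simp
  qed (simp add: sum_nonneg)
  then show ?thesis
    unfolding pr_def expect_sum[symmetric] using assms by (intro expect_mono) auto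
qed

lemma pr_disj_le:
  assumes "\<And>e. e \<in> E \<Longrightarrow> 0 \<le> p e \<and> p e \<le> 1"
  shows "pr E p (\<lambda>\<omega>. A \<omega> \<or> B \<omega>) \<le> pr E p A + pr E p B"
  unfolding pr_def expect_add[symmetric] using assms by (intro expect_mono) auto

section \<open>Marginals and independence\<close>

lemma expect_restrict:
  assumes "finite E"
  shows "expect E p (\<lambda>\<omega>. f (\<omega> \<inter> E')) = expect (E \<inter> E') p f"
  using assms
proof (induction E arbitrary: f)
  case (insert e E)
  show ?case
  proof (cases "e \<in> E'")
    case True
    then show ?thesis using insert.hyps insert.IH[of f] insert.IH[of "\<lambda>\<omega>. f (insert e \<omega>)"]
      by (simp add: expect_insert Int_insert_left)
  next
    case False
    then show ?thesis using insert.hyps insert.IH[of f]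
      by (simp add: expect_insert Int_insert_left algebra_simps)
  qed
qed simp

lemma pr_restrict:
  assumes "finite E" "E' \<subseteq> E" "\<And>\<omega>. \<omega> \<subseteq> E \<Longrightarrow> A \<omega> \<longleftrightarrow> B (\<omega> \<inter> E')"
  shows "pr E p A = pr E' p B"
proof -
  have "pr E p A = expect E p (\<lambda>\<omega>. of_bool (B (\<omega> \<inter> E')))"
    unfolding pr_def using assms by (intro expect_cong) auto
  also have "\<dots> = expect (E \<inter> E') p (\<lambda>\<omega>. of_bool (B \<omega>))"
    using assms(1) by (rule expect_restrict)
  finally show ?thesis using assms(2) by (simp add: pr_def Int_absorb1)
qed

lemma expect_indep:
  assumes "finite E" "E1 \<inter> E2 = {}"
  shows "expect E p (\<lambda>\<omega>. f (\<omega> \<inter> E1) * g (\<omega> \<inter> E2))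
    = expect E p (\<lambda>\<omega>. f (\<omega> \<inter> E1)) * expect E p (\<lambda>\<omega>. g (\<omega> \<inter> E2))"
  using assms(1)
proof (induction E arbitrary: f g)
  case (insert e E)
  consider "e \<in> E1" "e \<notin> E2" | "e \<notin> E1" "e \<in> E2" | "e \<notin> E1" "e \<notin> E2" using assms(2) by auto
  then show ?case
  proof cases
    case 1
    then show ?thesis using insert.hyps insert.IH[of f g] insert.IH[of "\<lambda>\<omega>. f (insert e \<omega>)" g]
      by (simp add: expect_insert Int_insert_left algebra_simps)
  next
    case 2
    then show ?thesis using insert.hyps insert.IH[of f g] insert.IH[of f "\<lambda>\<omega>. g (insert e \<omega>)"]
      by (simp add: expect_insert Int_insert_left algebra_simps)
  next
    case 3
    then show ?thesis using insert.hyps insert.IH[of f g]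
      by (simp add: expect_insert Int_insert_left algebra_simps)
  qed
qed simp

lemma pr_indep:
  assumes "finite E" "E1 \<inter> E2 = {}"
    "\<And>\<omega>. \<omega> \<subseteq> E \<Longrightarrow> A \<omega> \<longleftrightarrow> A (\<omega> \<inter> E1)" "\<And>\<omega>. \<omega> \<subseteq> E \<Longrightarrow> B \<omega> \<longleftrightarrow> B (\<omega> \<inter> E2)"
  shows "pr E p (\<lambda>\<omega>. A \<omega> \<and> B \<omega>) = pr E p A * pr E p B"
proof -
  have "pr E p (\<lambda>\<omega>. A \<omega> \<and> B \<omega>) = expect E p (\<lambda>\<omega>. of_bool (A (\<omega> \<inter> E1)) * of_bool (B (\<omega> \<inter> E2)))"
    unfolding pr_def using assms(3,4) by (intro expect_cong) auto
  also have "\<dots> = expect E p (\<lambda>\<omega>. of_bool (A (\<omega> \<inter> E1))) * expect E p (\<lambda>\<omega>. of_bool (B (\<omega> \<inter> E2)))"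
    using assms(1,2) by (rule expect_indep)
  also have "expect E p (\<lambda>\<omega>. of_bool (A (\<omega> \<inter> E1))) = pr E p A"
    unfolding pr_def using assms(3) by (intro expect_cong) auto
  also have "expect E p (\<lambda>\<omega>. of_bool (B (\<omega> \<inter> E2))) = pr E p B"
    unfolding pr_def using assms(4) by (intro expect_cong) auto
  finally show ?thesis .
qed

text \<open>Given the state of one edge, both conditional expectations increase when that edge is
  opened, so Chebyshev's inequality on two points closes the induction.\<close>

theorem harris_inequality:
  assumes "finite E" "\<And>e. e \<in> E \<Longrightarrow> 0 \<le> p e \<and> p e \<le> 1"
    and "\<And>\<omega> \<eta>. \<omega> \<subseteq> \<eta> \<Longrightarrow> f \<omega> \<le> f \<eta>" "\<And>\<omega> \<eta>. \<omega> \<subseteq> \<eta> \<Longrightarrow> g \<omega> \<le> g \<eta>"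
  shows "expect E p f * expect E p g \<le> expect E p (\<lambda>\<omega>. f \<omega> * g \<omega>)"
  using assms
proof (induction E arbitrary: f g)
  case (insert e E)
  define F0 F1 G0 G1 where "F0 = expect E p f" and "F1 = expect E p (\<lambda>\<omega>. f (insert e \<omega>))"
    and "G0 = expect E p g" and "G1 = expect E p (\<lambda>\<omega>. g (insert e \<omega>))"
  note F_defs = F0_def F1_def G0_def G1_def
  have pe: "0 \<le> p e" "p e \<le> 1" using insert.prems by auto
  have le: "F0 \<le> F1" "G0 \<le> G1"
    unfolding F_defs
    by (intro expect_mono; use insert.prems(1) insert.prems(2,3)[OF subset_insertI] in blast)+
  have IH0: "F0 * G0 \<le> expect E p (\<lambda>\<omega>. f \<omega> * g \<omega>)"
    unfolding F_defs using insert.prems by (intro insert.IH) auto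
  have IH1: "F1 * G1 \<le> expect E p (\<lambda>\<omega>. f (insert e \<omega>) * g (insert e \<omega>))"
    unfolding F_defs using insert.prems(1) by (intro insert.IH insert.prems(2,3) insert_mono) auto
  \<comment> \<open>The covariance of the two conditional expectations, seen as functions of the
    state of \<open>e\<close>.\<close>
  have "0 \<le> (p e * (1 - p e)) * ((F1 - F0) * (G1 - G0))"
    using pe le by (intro mult_nonneg_nonneg) auto
  then have "(p e * F1 + (1 - p e) * F0) * (p e * G1 + (1 - p e) * G0)
    \<le> p e * (F1 * G1) + (1 - p e) * (F0 * G0)"
    by (simp add: algebra_simps)
  also have "\<dots> \<le> p e * expect E p (\<lambda>\<omega>. f (insert e \<omega>) * g (insert e \<omega>))
      + (1 - p e) * expect E p (\<lambda>\<omega>. f \<omega> * g \<omega>)"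
    using IH0 IH1 pe by (intro add_mono mult_left_mono) auto
  finally show ?case using insert.hyps by (simp add: expect_insert F_defs)
qed simp

text \<open>Takes the place of a coupling: raising \<open>p e\<close> to \<open>q e\<close> on one
  edge favours an increasing function, and the induction hypothesis handles the other edges.\<close>

lemma expect_mono_param:
  assumes "finite E" "\<And>e. e \<in> E \<Longrightarrow> 0 \<le> p e \<and> p e \<le> q e \<and> q e \<le> 1"
    and "\<And>\<omega> \<eta>. \<omega> \<subseteq> \<eta> \<Longrightarrow> f \<omega> \<le> f \<eta>"
  shows "expect E p f \<le> expect E q f"
  using assms
proof (induction E arbitrary: f)
  case (insert e E)
  have pe: "0 \<le> p e" "p e \<le> q e" "q e \<le> 1" using insert.prems by auto
  have le: "expect E p f \<le> expect E p (\<lambda>\<omega>. f (insert e \<omega>))"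
    by (intro expect_mono insert.prems(2) subset_insertI)
       (meson insert.prems(1) insertCI order_trans)
  have 1: "expect E p f \<le> expect E q f"
    using insert.prems by (intro insert.IH) auto
  have 2: "expect E p (\<lambda>\<omega>. f (insert e \<omega>)) \<le> expect E q (\<lambda>\<omega>. f (insert e \<omega>))"
    using insert.prems(1) by (intro insert.IH insert.prems(2) insert_mono) auto
  have "p e * expect E p (\<lambda>\<omega>. f (insert e \<omega>)) + (1 - p e) * expect E p f
      \<le> q e * expect E p (\<lambda>\<omega>. f (insert e \<omega>)) + (1 - q e) * expect E p f"
    using mult_nonneg_nonneg[of "q e - p e" "expect E p (\<lambda>\<omega>. f (insert e \<omega>)) - expect E p f"] pe le
    by (simp add: algebra_simps)
  also have "\<dots> \<le> q e * expect E q (\<lambda>\<omega>. f (insert e \<omega>)) + (1 - q e) * expect E q f"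
    using 1 2 pe by (intro add_mono mult_left_mono) auto
  finally show ?case using insert.hyps by (simp add: expect_insert)
qed simp

lemma pr_mono_param:
  assumes "finite E" "\<And>e. e \<in> E \<Longrightarrow> 0 \<le> p e \<and> p e \<le> q e \<and> q e \<le> 1"
    and "\<And>\<omega> \<eta>. \<omega> \<subseteq> \<eta> \<Longrightarrow> A \<omega> \<Longrightarrow> A \<eta>"
  shows "pr E p A \<le> pr E q A"
  unfolding pr_def using assms by (intro expect_mono_param) auto

text \<open>The product rule for the split over one edge gives the term of that edge plus the
  derivatives of the two restrictions. The function is arbitrary because the formula is applied both
  to an increasing indicator and to the decreasing number of boundary clusters.\<close>

theorem russo_formula:
  assumes "finite E"
  shows "((\<lambda>x. expect E (\<lambda>_. x) f) has_real_derivative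
    (\<Sum>e\<in>E. expect E (\<lambda>_. x) (\<lambda>\<omega>. f (insert e \<omega>) - f (\<omega> - {e})))) (at x)"
  using assms
proof (induction E arbitrary: f)
  case (insert a E)
  let ?E = "\<lambda>x. expect E (\<lambda>_. x)"
  let ?D = "\<lambda>f. \<Sum>e\<in>E. ?E x (\<lambda>\<omega>. f (insert e \<omega>) - f (\<omega> - {e}))"
  have 1: "((\<lambda>x. x * ?E x (\<lambda>\<omega>. f (insert a \<omega>)) + (1 - x) * ?E x f) has_real_derivative
    (1 * ?E x (\<lambda>\<omega>. f (insert a \<omega>)) + ?D (\<lambda>\<omega>. f (insert a \<omega>)) * x + ((0 - 1) * ?E x f + ?D f * (1 - x)))) (at x)"
    by (intro DERIV_add DERIV_mult insert.IH DERIV_ident DERIV_diff DERIV_const)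
  have 2: "(\<lambda>x. expect (insert a E) (\<lambda>_. x) f) =
     (\<lambda>x. x * ?E x (\<lambda>\<omega>. f (insert a \<omega>)) + (1 - x) * ?E x f)"
    using insert.hyps by (simp add: expect_insert)
  have 3: "expect (insert a E) (\<lambda>_. x) (\<lambda>\<omega>. f (insert a \<omega>) - f (\<omega> - {a}))
     = ?E x (\<lambda>\<omega>. f (insert a \<omega>)) - ?E x f"
  proof -
    have "?E x (\<lambda>\<omega>. f (insert a (insert a \<omega>)) - f (insert a \<omega> - {a})) = ?E x (\<lambda>\<omega>. f (insert a \<omega>) - f \<omega>)"
      using insert.hyps by (intro expect_cong arg_cong2[where f="(-)"] arg_cong[where f=f]) auto
    moreover have "?E x (\<lambda>\<omega>. f (insert a \<omega>) - f (\<omega> - {a})) = ?E x (\<lambda>\<omega>. f (insert a \<omega>) - f \<omega>)"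
      using insert.hyps by (intro expect_cong arg_cong2[where f="(-)"] arg_cong[where f=f]) auto
    ultimately show ?thesis using insert.hyps
      by (simp add: expect_insert expect_diff algebra_simps)
  qed
  have 4: "(\<Sum>e\<in>E. expect (insert a E) (\<lambda>_. x) (\<lambda>\<omega>. f (insert e \<omega>) - f (\<omega> - {e})))
     = x * ?D (\<lambda>\<omega>. f (insert a \<omega>)) + (1 - x) * ?D f"
    unfolding sum_distrib_left sum.distrib[symmetric]
  proof (rule sum.cong[OF refl])
    fix e assume e: "e \<in> E"
    have "?E x (\<lambda>\<omega>. f (insert e (insert a \<omega>)) - f (insert a \<omega> - {e}))
       = ?E x (\<lambda>\<omega>. f (insert a (insert e \<omega>)) - f (insert a (\<omega> - {e})))"
      using insert.hyps e by (intro expect_cong arg_cong2[where f="(-)"] arg_cong[where f=f]) auto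
    then show "expect (insert a E) (\<lambda>_. x) (\<lambda>\<omega>. f (insert e \<omega>) - f (\<omega> - {e})) =
         x * ?E x (\<lambda>\<omega>. f (insert a (insert e \<omega>)) - f (insert a (\<omega> - {e}))) +
         (1 - x) * ?E x (\<lambda>\<omega>. f (insert e \<omega>) - f (\<omega> - {e}))"
      using insert.hyps by (simp add: expect_insert)
  qed
  have "(\<Sum>e\<in>insert a E. expect (insert a E) (\<lambda>_. x) (\<lambda>\<omega>. f (insert e \<omega>) - f (\<omega> - {e})))
    = 1 * ?E x (\<lambda>\<omega>. f (insert a \<omega>)) + ?D (\<lambda>\<omega>. f (insert a \<omega>)) * x + ((0 - 1) * ?E x f + ?D f * (1 - x))"
    unfolding sum.insert[OF insert.hyps] 3 4 by (simp add: algebra_simps)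
  then show ?case using 1 unfolding 2 by simp
qed simp

lemma expect_image:
  assumes "finite E" "inj_on g E"
  shows "expect (g ` E) p f = expect E (\<lambda>e. p (g e)) (\<lambda>\<omega>. f (g ` \<omega>))"
  using assms
proof (induction E arbitrary: f)
  case (insert e E)
  have "g e \<notin> g ` E" using insert by (auto simp: inj_on_def)
  then show ?case using insert by (simp add: expect_insert)
qed simp

text \<open>The closed edges form a configuration of density \<open>1 - p\<close>; at density 1/2
  the law is invariant, which is what duality exploits.\<close>

lemma expect_complement:
  assumes "finite E"
  shows "expect E p f = expect E (\<lambda>e. 1 - p e) (\<lambda>\<omega>. f (E - \<omega>))"
  using assms
proof (induction E arbitrary: f)
  case (insert e E)
  let ?E = "expect E (\<lambda>e. 1 - p e)"
  have 1: "?E (\<lambda>\<omega>. f (insert e E - insert e \<omega>)) = ?E (\<lambda>\<omega>. f (E - \<omega>))"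
    using insert.hyps by (intro expect_cong arg_cong[where f=f]) auto
  have 2: "?E (\<lambda>\<omega>. f (insert e E - \<omega>)) = ?E (\<lambda>\<omega>. f (insert e (E - \<omega>)))"
    using insert.hyps by (intro expect_cong arg_cong[where f=f]) auto
  show ?case
    using insert.hyps insert.IH[of f] insert.IH[of "\<lambda>\<omega>. f (insert e \<omega>)"]
    by (simp add: expect_insert 1 2)
qed simp

text \<open>The event on the left ignores the state of \<open>a\<close>. Given the other edges,
  \<open>a\<close> takes a state that realises \<open>B\<close> with probability at least
  \<open>c\<close>.\<close>

lemma pr_flip:
  assumes "finite E" "0 \<le> c" "\<And>e. e \<in> E \<Longrightarrow> c \<le> p e \<and> c \<le> 1 - p e" "a \<in> E"
  shows "c * pr E p (\<lambda>\<omega>. B (insert a \<omega>) \<or> B (\<omega> - {a})) \<le> pr E p B"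
proof -
  obtain E' where E: "E = insert a E'" "a \<notin> E'" using assms(4) by (meson mk_disjoint_insert)
  have fin: "finite E'" using assms E by auto
  have p01: "0 \<le> p e \<and> p e \<le> 1" if "e \<in> E'" for e using assms(2) assms(3)[of e] that E by auto
  define P where "P = pr E' p B"
  define P' where "P' = pr E' p (\<lambda>\<omega>. B (insert a \<omega>))"
  have nn: "0 \<le> P" "0 \<le> P'" unfolding P_def P'_def using p01 by (auto intro!: pr_nonneg)
  have 1: "pr E' p (\<lambda>\<omega>. B (insert a (insert a \<omega>)) \<or> B (insert a \<omega> - {a}))
      = pr E' p (\<lambda>\<omega>. B (insert a \<omega>) \<or> B \<omega>)"
    and 2: "pr E' p (\<lambda>\<omega>. B (insert a \<omega>) \<or> B (\<omega> - {a})) = pr E' p (\<lambda>\<omega>. B (insert a \<omega>) \<or> B \<omega>)"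
  proof -
    have "insert a \<omega> - {a} = \<omega> \<and> \<omega> - {a} = \<omega>" if "\<omega> \<subseteq> E'" for \<omega> using that E by auto
    then show "pr E' p (\<lambda>\<omega>. B (insert a (insert a \<omega>)) \<or> B (insert a \<omega> - {a}))
      = pr E' p (\<lambda>\<omega>. B (insert a \<omega>) \<or> B \<omega>)"
     "pr E' p (\<lambda>\<omega>. B (insert a \<omega>) \<or> B (\<omega> - {a})) = pr E' p (\<lambda>\<omega>. B (insert a \<omega>) \<or> B \<omega>)"
      by (auto intro!: pr_cong simp del: insert_Diff_single)
  qed
  have "pr E p (\<lambda>\<omega>. B (insert a \<omega>) \<or> B (\<omega> - {a})) = pr E' p (\<lambda>\<omega>. B (insert a \<omega>) \<or> B \<omega>)"
    using 1 2 E fin unfolding pr_def by (simp add: expect_insert algebra_simps)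
  also have "\<dots> \<le> P' + P"
    unfolding P_def P'_def using p01 by (intro pr_disj_le) auto
  finally have "c * pr E p (\<lambda>\<omega>. B (insert a \<omega>) \<or> B (\<omega> - {a})) \<le> c * P' + c * P"
    using assms(2) by (metis distrib_left mult_left_mono)
  also have "\<dots> \<le> p a * P' + (1 - p a) * P"
    using nn assms(3)[of a] E by (intro add_mono mult_right_mono) auto
  also have "\<dots> = pr E p B"
    using E fin unfolding P_def P'_def pr_def by (simp add: expect_insert)
  finally show ?thesis .
qed

text \<open>Finite energy: rewriting the configuration on \<open>F\<close> costs a factor
  \<open>c\<close> per edge. The choice of \<eta> may depend on \<omega>, because the bound is
  proved for the event that some rewriting of \<open>F\<close> produces \<open>B\<close>.\<close>

lemma pr_surgery:
  assumes "finite E" "0 \<le> c" "\<And>e. e \<in> E \<Longrightarrow> c \<le> p e \<and> c \<le> 1 - p e" "F \<subseteq> E"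
    and "\<And>\<omega>. \<omega> \<subseteq> E \<Longrightarrow> A \<omega> \<Longrightarrow> \<exists>\<eta>\<subseteq>F. B (\<omega> - F \<union> \<eta>)"
  shows "c ^ card F * pr E p A \<le> pr E p B"
proof -
  have p01: "0 \<le> p e \<and> p e \<le> 1" if "e \<in> E" for e using assms(2) assms(3)[of e] that by auto
  have "finite F" using assms(1,4) finite_subset by auto
  then have "c ^ card F * pr E p (\<lambda>\<omega>. \<exists>\<eta>\<subseteq>F. B (\<omega> - F \<union> \<eta>)) \<le> pr E p B" using assms(4)
  proof (induction F arbitrary: B)
    case (insert a F)
    let ?B = "\<lambda>\<omega>. B (insert a \<omega>) \<or> B (\<omega> - {a})"
    have sub: "\<exists>\<eta>\<subseteq>F. ?B (\<omega> - F \<union> \<eta>)"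
      if "\<exists>\<eta>\<subseteq>insert a F. B (\<omega> - insert a F \<union> \<eta>)" for \<omega>
    proof -
      obtain \<eta> where \<eta>: "\<eta> \<subseteq> insert a F" "B (\<omega> - insert a F \<union> \<eta>)" using \<open>\<exists>\<eta>\<subseteq>insert a F. _ \<eta>\<close> by auto
      show ?thesis
      proof (cases "a \<in> \<eta>")
        case True
        then have "\<omega> - insert a F \<union> \<eta> = insert a (\<omega> - F \<union> (\<eta> - {a}))" by auto
        then show ?thesis using \<eta> by (intro exI[of _ "\<eta> - {a}"]) auto
      next
        case False
        then have "\<omega> - insert a F \<union> \<eta> = (\<omega> - F \<union> \<eta>) - {a}" by auto
        then have "B ((\<omega> - F \<union> \<eta>) - {a})" using \<eta>(2) by simp
        moreover have "\<eta> \<subseteq> F" using \<eta>(1) False by auto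
        ultimately show ?thesis by blast
      qed
    qed
    have "c ^ card (insert a F) * pr E p (\<lambda>\<omega>. \<exists>\<eta>\<subseteq>insert a F. B (\<omega> - insert a F \<union> \<eta>))
       \<le> c * (c ^ card F * pr E p (\<lambda>\<omega>. \<exists>\<eta>\<subseteq>F. ?B (\<omega> - F \<union> \<eta>)))"
      unfolding card_insert_disjoint[OF insert.hyps] power_Suc mult.assoc
      using assms(2) p01 sub by (intro mult_left_mono pr_mono) auto
    also have "\<dots> \<le> c * pr E p ?B"
      using insert.prems insert.IH[of ?B] assms(2) by (intro mult_left_mono) auto
    also have "\<dots> \<le> pr E p B"
      using insert.prems assms(1-3) by (intro pr_flip) auto
    finally show ?case .
  qed simp
  moreover have "c ^ card F * pr E p A \<le> c ^ card F * pr E p (\<lambda>\<omega>. \<exists>\<eta>\<subseteq>F. B (\<omega> - F \<union> \<eta>))"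
    using assms p01 by (intro mult_left_mono pr_mono) auto
  ultimately show ?thesis by linarith
qed

section \<open>Connections and arms in the square lattice\<close>

declare split_paired_All [simp del] split_paired_Ex [simp del]

lemma pr_sum_partition:
  assumes "finite I"
  shows "(\<Sum>i\<in>I. pr E p (\<lambda>\<omega>. X \<omega> = i \<and> A i \<omega>)) = pr E p (\<lambda>\<omega>. X \<omega> \<in> I \<and> A (X \<omega>) \<omega>)"
proof -
  have "(\<Sum>i\<in>I. of_bool (X \<omega> = i \<and> A i \<omega>)) = (of_bool (X \<omega> \<in> I \<and> A (X \<omega>) \<omega>) :: real)" for \<omega>
  proof -
    have "(\<Sum>i\<in>I. of_bool (X \<omega> = i \<and> A i \<omega>)) = (\<Sum>i\<in>I. if X \<omega> = i then of_bool (A i \<omega>) else (0 :: real))"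
      by (intro sum.cong) auto
    then show ?thesis using assms by (simp add: sum.delta')
  qed
  then show ?thesis unfolding pr_def expect_sum[symmetric] by simp
qed

lemma pr_mem:
  assumes "finite E" "e \<in> E"
  shows "pr E p (\<lambda>\<omega>. e \<in> \<omega>) = p e"
proof -
  have "pr E p (\<lambda>\<omega>. e \<in> \<omega>) = pr {e} p (\<lambda>\<omega>. e \<in> \<omega>)"
    using assms by (intro pr_restrict) auto
  then show ?thesis by (simp add: pr_def expect_insert)
qed

text \<open>Any unordered pair in \<omega> counts as a step; adjacency enters only through sets such
  as \<open>edges_in V\<close> to which configurations are restricted.\<close>

definition conn :: "'a set set \<Rightarrow> 'a \<Rightarrow> 'a \<Rightarrow> bool" where
  "conn \<omega> u v \<longleftrightarrow> (u, v) \<in> {(a, b). {a, b} \<in> \<omega>}\<^sup>*"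

lemma conn_refl [simp, intro]: "conn \<omega> u u"
  by (simp add: conn_def)

lemma conn_trans [trans]: "conn \<omega> u v \<Longrightarrow> conn \<omega> v w \<Longrightarrow> conn \<omega> u w"
  by (simp add: conn_def)

lemma conn_edge: "{u, v} \<in> \<omega> \<Longrightarrow> conn \<omega> u v"
  by (auto simp: conn_def)

lemma conn_sym: "conn \<omega> u v \<Longrightarrow> conn \<omega> v u"
  unfolding conn_def by (rule symD[OF sym_rtrancl]) (auto intro: symI simp: insert_commute)

lemma conn_mono:
  assumes "conn \<omega> u v" "\<omega> \<subseteq> \<eta>"
  shows "conn \<eta> u v"
  using assms rtrancl_mono[of "{(a, b). {a, b} \<in> \<omega>}" "{(a, b). {a, b} \<in> \<eta>}"]
  unfolding conn_def by blast

lemma conn_induct [consumes 1, case_names refl step]: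
  assumes "conn \<omega> u v" "P u" "\<And>y z. conn \<omega> u y \<Longrightarrow> P y \<Longrightarrow> {y, z} \<in> \<omega> \<Longrightarrow> P z"
  shows "P v"
proof -
  have "(u, v) \<in> {(a, b). {a, b} \<in> \<omega>}\<^sup>*" using assms(1) by (simp add: conn_def)
  then show ?thesis
  proof (induction rule: rtrancl_induct)
    case (step y z)
    show ?case by (rule assms(3)[of y]) (use step in \<open>simp_all add: conn_def\<close>)
  qed (rule assms(2))
qed

lemma conn_step: "conn \<omega> u v \<Longrightarrow> {v, w} \<in> \<omega> \<Longrightarrow> conn \<omega> u w"
  by (meson conn_edge conn_trans)

lemma conn_image:
  assumes "conn \<omega> u v"
  shows "conn ((`) g ` \<omega>) (g u) (g v)"
  using assms
proof (induction rule: conn_induct)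
  case (step y z)
  then have "g ` {y, z} \<in> (`) g ` \<omega>" by blast
  then show ?case using step.IH by (auto intro: conn_step)
qed auto

lemma conn_image_iff:
  assumes "inj g"
  shows "conn ((`) g ` \<omega>) (g u) (g v) \<longleftrightarrow> conn \<omega> u v"
proof
  assume "conn ((`) g ` \<omega>) (g u) (g v)"
  then have "conn ((`) (inv g) ` (`) g ` \<omega>) (inv g (g u)) (inv g (g v))"
    by (rule conn_image)
  then show "conn \<omega> u v"
    using assms by (simp add: image_image image_inv_f_f)
qed (rule conn_image)

text \<open>Induction along the path remembers the most recent edge leaving \<open>C\<close>: a step
  from \<open>C\<close> to its complement resets it, a step outside \<open>C\<close> extends the
  tail, and at vertices of \<open>C\<close> the claim is vacuous.\<close>

lemma conn_last_exit:
  assumes "conn \<omega> a d" "a \<in> C" "d \<notin> C"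
  shows "\<exists>x\<in>C. \<exists>y. y \<notin> C \<and> {x, y} \<in> \<omega> \<and> conn (\<omega> \<inter> {e. e \<inter> C = {}}) y d"
proof -
  have "d \<notin> C \<longrightarrow> (\<exists>x\<in>C. \<exists>y. y \<notin> C \<and> {x, y} \<in> \<omega> \<and> conn (\<omega> \<inter> {e. e \<inter> C = {}}) y d)"
    using assms(1)
  proof (induction rule: conn_induct)
    case (step y z)
    show ?case
    proof (intro impI)
      assume z: "z \<notin> C"
      show "\<exists>x\<in>C. \<exists>y. y \<notin> C \<and> {x, y} \<in> \<omega> \<and> conn (\<omega> \<inter> {e. e \<inter> C = {}}) y z"
      proof (cases "y \<in> C")
        case True
        then show ?thesis using z step by blast
      next
        case False
        then have "{y, z} \<in> \<omega> \<inter> {e. e \<inter> C = {}}" using z step by auto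
        then show ?thesis using False step.IH conn_step by meson
      qed
    qed
  qed (use assms in auto)
  then show ?thesis using assms by blast
qed

lemma adjacent_sym: "adjacent u v \<longleftrightarrow> adjacent v u"
  by (auto simp: adjacent_def)

lemma adjacent_irrefl [simp]: "\<not> adjacent u u"
  by (auto simp: adjacent_def)

lemma edges_iff: "{u, v} \<in> edges \<longleftrightarrow> adjacent u v"
  unfolding edges_def using adjacent_sym by (fastforce simp: doubleton_eq_iff simp del: split_paired_Ex)

section \<open>Arms inside a vertex set\<close>

definition edges_in :: "vertex set \<Rightarrow> edge set" where
  "edges_in V = {e \<in> edges. e \<subseteq> V}"

definition bdry :: "vertex set \<Rightarrow> vertex set" where
  "bdry V = {v \<in> V. \<exists>w. w \<notin> V \<and> adjacent v w}"

text \<open>\<open>bdry V\<close> is the inner boundary and only edges inside \<open>V\<close> are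
  used, so the event is local to \<open>V\<close>, and a vertex of \<open>bdry V\<close> has an arm
  in every configuration.\<close>

definition arm :: "vertex set \<Rightarrow> vertex \<Rightarrow> edge set \<Rightarrow> bool" where
  "arm V v \<omega> \<longleftrightarrow> (\<exists>d\<in>bdry V. conn (\<omega> \<inter> edges_in V) v d)"

lemma edges_in_iff: "{u, v} \<in> edges_in V \<longleftrightarrow> adjacent u v \<and> u \<in> V \<and> v \<in> V"
  by (auto simp: edges_in_def edges_iff)

lemma edges_in_mono: "V \<subseteq> W \<Longrightarrow> edges_in V \<subseteq> edges_in W"
  by (auto simp: edges_in_def)

lemma finite_edges_in: "finite V \<Longrightarrow> finite (edges_in V)"
  by (rule finite_subset[of _ "Pow V"]) (auto simp: edges_in_def)

lemma bdry_subset: "bdry V \<subseteq> V"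
  by (auto simp: bdry_def)

lemma conn_edges_in:
  assumes "conn (\<omega> \<inter> edges_in V) u v" "u \<in> V"
  shows "v \<in> V"
  using assms by (induction rule: conn_induct) (auto simp: edges_in_def)

lemma arm_mono: "arm V v \<omega> \<Longrightarrow> \<omega> \<subseteq> \<eta> \<Longrightarrow> arm V v \<eta>"
  unfolding arm_def by (meson Int_mono conn_mono order_refl)

lemma arm_Int: "edges_in V \<subseteq> E \<Longrightarrow> arm V v (\<omega> \<inter> E) \<longleftrightarrow> arm V v \<omega>"
  unfolding arm_def by (simp add: Int_assoc Int_absorb1)

lemma arm_step:
  assumes "arm V y \<omega>" "{x, y} \<in> \<omega> \<inter> edges_in V"
  shows "arm V x \<omega>"
  using assms unfolding arm_def by (meson conn_edge conn_trans)

text \<open>A path can leave \<open>V\<close> only through \<open>bdry V\<close>, and up to its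
  first exit it uses only edges inside \<open>V\<close>.\<close>

lemma conn_exit:
  assumes "conn \<omega> v z" "\<omega> \<subseteq> edges" "v \<in> V"
  shows "arm V v \<omega> \<or> (z \<in> V \<and> conn (\<omega> \<inter> edges_in V) v z)"
  using assms(1)
proof (induction rule: conn_induct)
  case (step y z)
  show ?case
  proof (cases "arm V v \<omega>")
    case False
    then have y: "y \<in> V" "conn (\<omega> \<inter> edges_in V) v y" using step by auto
    have adj: "adjacent y z" using step.hyps assms(2) by (auto simp: edges_iff[symmetric])
    show ?thesis
    proof (cases "z \<in> V")
      case True
      then have "{y, z} \<in> \<omega> \<inter> edges_in V" using y adj step.hyps by (auto simp: edges_in_iff)
      then have "conn (\<omega> \<inter> edges_in V) v z" by (rule conn_step[OF y(2)])
      then show ?thesis using True by simp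
    next
      case z: False
      then have "y \<in> bdry V" using y adj by (auto simp: bdry_def)
      then show ?thesis using y(2) unfolding arm_def by blast
    qed
  qed auto
qed (use assms in auto)

text \<open>Arms get easier in smaller sets: an arm in \<open>W\<close> either meets
  \<open>bdry V\<close> on its way or ends inside \<open>V\<close>, and an end in
  \<open>bdry W\<close> that lies in \<open>V\<close> also belongs to \<open>bdry V\<close>.\<close>

lemma arm_subset:
  assumes "arm W v \<omega>" "V \<subseteq> W" "v \<in> V"
  shows "arm V v \<omega>"
proof -
  obtain d where d: "d \<in> bdry W" "conn (\<omega> \<inter> edges_in W) v d" using assms(1) by (auto simp: arm_def)
  have "arm V v (\<omega> \<inter> edges_in W) \<or> (d \<in> V \<and> conn (\<omega> \<inter> edges_in W \<inter> edges_in V) v d)"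
    using d assms by (intro conn_exit) (auto simp: edges_in_def)
  then show ?thesis
  proof
    assume "arm V v (\<omega> \<inter> edges_in W)"
    then show ?thesis by (rule arm_mono) auto
  next
    assume *: "d \<in> V \<and> conn (\<omega> \<inter> edges_in W \<inter> edges_in V) v d"
    then have "d \<in> bdry V" using d(1) assms(2) by (auto simp: bdry_def)
    moreover have "conn (\<omega> \<inter> edges_in V) v d" using * by (auto elim: conn_mono)
    ultimately show ?thesis by (auto simp: arm_def)
  qed
qed

section \<open>Invariance under lattice automorphisms\<close>

definition lattice_aut :: "(vertex \<Rightarrow> vertex) \<Rightarrow> bool" where
  "lattice_aut g \<longleftrightarrow> bij g \<and> (\<forall>u v. adjacent (g u) (g v) \<longleftrightarrow> adjacent u v)"

lemma edges_in_image:
  assumes "lattice_aut g"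
  shows "edges_in (g ` V) = (`) g ` edges_in V"
proof -
  have inj: "inj g" using assms by (auto simp: lattice_aut_def bij_def)
  show ?thesis
  proof (intro equalityI subsetI)
    fix e assume e: "e \<in> edges_in (g ` V)"
    then obtain u v where uv: "e = {u, v}" "adjacent u v" by (auto simp: edges_in_def edges_def)
    then obtain u' v' where "u = g u'" "v = g v'" "u' \<in> V" "v' \<in> V" using e by (auto simp: edges_in_def)
    then show "e \<in> (`) g ` edges_in V" using uv assms
      by (intro image_eqI[of _ _ "{u', v'}"]) (auto simp: edges_in_iff lattice_aut_def)
  next
    fix e assume "e \<in> (`) g ` edges_in V"
    then obtain e' where e': "e = g ` e'" "e' \<in> edges_in V" by auto
    then obtain u v where "e' = {u, v}" "adjacent u v" by (auto simp: edges_in_def edges_def)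
    then show "e \<in> edges_in (g ` V)" using e' assms by (auto simp: edges_in_iff lattice_aut_def)
  qed
qed

lemma bdry_image:
  assumes "lattice_aut g"
  shows "bdry (g ` V) = g ` bdry V"
proof -
  have inj: "inj g" and surj: "surj g" using assms by (auto simp: lattice_aut_def bij_def)
  have ex: "(\<exists>w. w \<notin> g ` V \<and> adjacent (g v) w) \<longleftrightarrow> (\<exists>w. w \<notin> V \<and> adjacent v w)" for v
  proof -
    have "(\<exists>w. w \<notin> g ` V \<and> adjacent (g v) w) \<longleftrightarrow> (\<exists>w. g w \<notin> g ` V \<and> adjacent (g v) (g w))"
      using surj by (metis surjD)
    then show ?thesis using assms inj by (simp add: lattice_aut_def inj_image_mem_iff)
  qed
  have "bdry (g ` V) = {g u |u. u \<in> V \<and> (\<exists>w. w \<notin> g ` V \<and> adjacent (g u) w)}"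
    unfolding bdry_def by blast
  also have "\<dots> = g ` bdry V" unfolding ex bdry_def by blast
  finally show ?thesis .
qed

lemma inj_image_sets: "inj g \<Longrightarrow> inj_on ((`) g) A"
  by (meson inj_image_eq_iff inj_onI)

lemma arm_image:
  assumes "lattice_aut g"
  shows "arm (g ` V) (g v) ((`) g ` \<omega>) \<longleftrightarrow> arm V v \<omega>"
proof -
  have inj: "inj g" using assms by (auto simp: lattice_aut_def bij_def)
  have "(`) g ` \<omega> \<inter> (`) g ` edges_in V = (`) g ` (\<omega> \<inter> edges_in V)"
    using inj_image_sets[OF inj] by (metis image_Int)
  then show ?thesis
    by (simp add: arm_def bdry_image[OF assms] edges_in_image[OF assms] conn_image_iff[OF inj])
qed

lemma pr_lattice_aut:
  assumes "lattice_aut g" "finite V"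
  shows "pr (edges_in (g ` V)) (\<lambda>_. p) A = pr (edges_in V) (\<lambda>_. p) (\<lambda>\<omega>. A ((`) g ` \<omega>))"
proof -
  have inj: "inj g" using assms by (auto simp: lattice_aut_def bij_def)
  show ?thesis unfolding edges_in_image[OF assms(1)] pr_def
    using assms inj by (intro expect_image finite_edges_in inj_image_sets)
qed

lemma lattice_aut_shift: "lattice_aut ((+) x)"
  by (simp add: lattice_aut_def adjacent_def)

section \<open>The Simon-Lieb inequality\<close>

definition edge_bdry :: "vertex set \<Rightarrow> (vertex \<times> vertex) set" where
  "edge_bdry S = {(x, y). x \<in> S \<and> y \<notin> S \<and> adjacent x y}"

lemma adjacent_neighbours:
  "adjacent x y \<longleftrightarrow> y \<in> {(fst x + 1, snd x), (fst x - 1, snd x), (fst x, snd x + 1), (fst x, snd x - 1)}"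
  by (cases x; cases y) (auto simp: adjacent_def)

lemma finite_edge_bdry:
  assumes "finite S" shows "finite (edge_bdry S)"
proof (rule finite_subset)
  show "edge_bdry S \<subseteq> Sigma S (\<lambda>x. {y. adjacent x y})" by (auto simp: edge_bdry_def)
  show "finite (Sigma S (\<lambda>x. {y. adjacent x y}))"
    using assms by (intro finite_SigmaI) (auto simp: adjacent_neighbours)
qed

text \<open>The quantity \<open>\<phi>\<^sub>p(S)\<close> of Duminil-Copin and Tassion.\<close>
definition phi :: "real \<Rightarrow> vertex set \<Rightarrow> real" where
  "phi p S = (\<Sum>(x, y)\<in>edge_bdry S. p * pr (edges_in S) (\<lambda>_. p) (\<lambda>\<omega>. conn \<omega> 0 x))"

text \<open>Exploring the cluster of \<open>a\<close> inspects only edges of \<open>S\<close> that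
  meet it, so whether it equals \<open>C\<close> is decided by \<open>T\<close>.\<close>

lemma cluster_Int_eq:
  assumes "T = {e \<in> edges_in S. e \<inter> C \<noteq> {}}"
  shows "{v. conn (\<omega> \<inter> edges_in S) a v} = C \<longleftrightarrow> {v. conn (\<omega> \<inter> T \<inter> edges_in S) a v} = C"
proof
  assume C: "{v. conn (\<omega> \<inter> edges_in S) a v} = C"
  have "conn (\<omega> \<inter> T \<inter> edges_in S) a v" if "conn (\<omega> \<inter> edges_in S) a v" for v
    using that
  proof (induction rule: conn_induct)
    case (step y z)
    then have "{y, z} \<in> \<omega> \<inter> T \<inter> edges_in S" using C by (auto simp: assms)
    then show ?case by (rule conn_step[OF step.IH])
  qed auto
  moreover have "conn (\<omega> \<inter> edges_in S) a v" if "conn (\<omega> \<inter> T \<inter> edges_in S) a v" for v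
    using that by (rule conn_mono) auto
  ultimately show "{v. conn (\<omega> \<inter> T \<inter> edges_in S) a v} = C" using C by blast
next
  assume C: "{v. conn (\<omega> \<inter> T \<inter> edges_in S) a v} = C"
  have "conn (\<omega> \<inter> T \<inter> edges_in S) a v" if "conn (\<omega> \<inter> edges_in S) a v" for v
    using that
  proof (induction rule: conn_induct)
    case (step y z)
    then have "{y, z} \<in> \<omega> \<inter> T \<inter> edges_in S" using C by (auto simp: assms)
    then show ?case by (rule conn_step[OF step.IH])
  qed auto
  moreover have "conn (\<omega> \<inter> edges_in S) a v" if "conn (\<omega> \<inter> T \<inter> edges_in S) a v" for v
    using that by (rule conn_mono) auto
  ultimately show "{v. conn (\<omega> \<inter> edges_in S) a v} = C" using C by blast
qed

text \<open>Fix the cluster \<open>C\<close> of the origin inside \<open>S\<close>. An arm leaves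
  \<open>C\<close> for the last time along an edge \<open>(x, y)\<close> of
  \<open>edge_bdry S\<close> and avoids \<open>C\<close> afterwards. The cluster event, the state of
  \<open>{x, y}\<close> and the connection from \<open>y\<close> off \<open>C\<close> live on
  disjoint edge sets, so plain independence does the work of the BK inequality.\<close>

theorem simon_lieb:
  assumes "finite V" "S \<subseteq> V" "S \<inter> bdry V = {}" "0 \<in> S" "0 \<le> p" "p \<le> 1" "0 \<le> b"
    and b: "\<And>x y. (x, y) \<in> edge_bdry S \<Longrightarrow> pr (edges_in V) (\<lambda>_. p) (arm V y) \<le> b"
  shows "pr (edges_in V) (\<lambda>_. p) (arm V 0) \<le> phi p S * b"
proof -
  let ?E = "edges_in V" and ?P = "pr (edges_in V) (\<lambda>_. p)"
  let ?I = "\<lambda>x. {C \<in> Pow S. x \<in> C}"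
  define cl where "cl \<omega> = {v. conn (\<omega> \<inter> edges_in S) 0 v}" for \<omega>
  define far where "far C y \<omega> \<longleftrightarrow> (\<exists>d\<in>bdry V. conn (\<omega> \<inter> {e \<in> ?E. e \<inter> C = {}}) y d)" for C y \<omega>
  have finS: "finite S" using assms finite_subset by auto
  have finE: "finite ?E" using assms by (simp add: finite_edges_in)
  have cl_S: "cl \<omega> \<subseteq> S" for \<omega> using conn_edges_in[OF _ assms(4)] by (auto simp: cl_def)
  have "?P (arm V 0) \<le> ?P (\<lambda>\<omega>. \<exists>xy\<in>edge_bdry S. \<exists>C\<in>?I (fst xy). cl \<omega> = C \<and> ({fst xy, snd xy} \<in> \<omega> \<and> far C (snd xy) \<omega>))"
  proof (rule pr_mono)
    fix \<omega> assume \<omega>: "\<omega> \<subseteq> ?E" and "arm V 0 \<omega>"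
    then obtain d where d: "d \<in> bdry V" "conn (\<omega> \<inter> ?E) 0 d" by (auto simp: arm_def)
    have "d \<notin> cl \<omega>" using d cl_S assms(3) by auto
    moreover have "0 \<in> cl \<omega>" by (simp add: cl_def)
    ultimately obtain x y where xy: "x \<in> cl \<omega>" "y \<notin> cl \<omega>" "{x, y} \<in> \<omega> \<inter> ?E"
      "conn (\<omega> \<inter> ?E \<inter> {e. e \<inter> cl \<omega> = {}}) y d"
      using conn_last_exit[OF d(2)] by blast
    have "y \<notin> S"
    proof
      assume "y \<in> S"
      then have "{x, y} \<in> \<omega> \<inter> edges_in S" using xy cl_S by (auto simp: edges_in_iff)
      moreover have "conn (\<omega> \<inter> edges_in S) 0 x" using xy(1) by (simp add: cl_def)
      ultimately have "conn (\<omega> \<inter> edges_in S) 0 y" by (rule conn_step[rotated])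
      then show False using xy(2) by (simp add: cl_def)
    qed
    then have "(x, y) \<in> edge_bdry S" using xy cl_S by (auto simp: edge_bdry_def edges_in_iff)
    moreover have "far (cl \<omega>) y \<omega>"
      unfolding far_def using d(1) xy(4) by (intro bexI[of _ d]) (simp_all add: Int_assoc Int_def)
    ultimately show "\<exists>xy\<in>edge_bdry S. \<exists>C\<in>?I (fst xy). cl \<omega> = C \<and> ({fst xy, snd xy} \<in> \<omega> \<and> far C (snd xy) \<omega>)"
      using xy cl_S by (intro bexI[of _ "(x, y)"]) auto
  qed (use assms in auto)
  also have "\<dots> \<le> (\<Sum>xy\<in>edge_bdry S. ?P (\<lambda>\<omega>. \<exists>C\<in>?I (fst xy). cl \<omega> = C \<and> ({fst xy, snd xy} \<in> \<omega> \<and> far C (snd xy) \<omega>)))"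
    using assms finS by (intro pr_Ex_le_sum) (auto intro: finite_edge_bdry)
  also have "\<dots> \<le> (\<Sum>xy\<in>edge_bdry S. \<Sum>C\<in>?I (fst xy). ?P (\<lambda>\<omega>. cl \<omega> = C \<and> ({fst xy, snd xy} \<in> \<omega> \<and> far C (snd xy) \<omega>)))"
    using assms finS by (intro sum_mono pr_Ex_le_sum) auto
  also have "\<dots> \<le> (\<Sum>xy\<in>edge_bdry S. \<Sum>C\<in>?I (fst xy). ?P (\<lambda>\<omega>. cl \<omega> = C) * (p * b))"
  proof (intro sum_mono)
    fix xy C assume xyS: "xy \<in> edge_bdry S" and C: "C \<in> ?I (fst xy)"
    obtain x y where xy: "xy = (x, y)" by fastforce
    have x: "x \<in> S" "y \<notin> S" "adjacent x y" "x \<in> C" "C \<subseteq> S" using xyS xy C by (auto simp: edge_bdry_def)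
    then have yV: "y \<in> V" using assms by (auto simp: bdry_def)
    let ?T = "{e \<in> edges_in S. e \<inter> C \<noteq> {}}" and ?D = "{e \<in> ?E. e \<inter> C = {}}"
    have e: "{x, y} \<in> ?E" using x yV assms by (auto simp: edges_in_iff)
    have "?P (\<lambda>\<omega>. cl \<omega> = C \<and> ({x, y} \<in> \<omega> \<and> far C y \<omega>)) = ?P (\<lambda>\<omega>. cl \<omega> = C) * ?P (\<lambda>\<omega>. {x, y} \<in> \<omega> \<and> far C y \<omega>)"
    proof (rule pr_indep[OF finE])
      show "?T \<inter> (insert {x, y} ?D) = {}" using x by (auto simp: edges_in_def)
      show "cl \<omega> = C \<longleftrightarrow> cl (\<omega> \<inter> ?T) = C" for \<omega>
        unfolding cl_def by (rule cluster_Int_eq) simp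
      show "({x, y} \<in> \<omega> \<and> far C y \<omega>) \<longleftrightarrow> ({x, y} \<in> \<omega> \<inter> insert {x, y} ?D \<and> far C y (\<omega> \<inter> insert {x, y} ?D))" for \<omega>
      proof -
        have "\<omega> \<inter> insert {x, y} ?D \<inter> ?D = \<omega> \<inter> ?D" by auto
        then show ?thesis by (simp add: far_def)
      qed
    qed
    also have "?P (\<lambda>\<omega>. {x, y} \<in> \<omega> \<and> far C y \<omega>) = ?P (\<lambda>\<omega>. {x, y} \<in> \<omega>) * ?P (far C y)"
    proof (rule pr_indep[OF finE])
      show "{{x, y}} \<inter> ?D = {}" using x by auto
      show "far C y \<omega> \<longleftrightarrow> far C y (\<omega> \<inter> ?D)" for \<omega>
        by (simp add: far_def Int_assoc)
    qed auto
    also have "?P (\<lambda>\<omega>. {x, y} \<in> \<omega>) = p" using e finE by (simp add: pr_mem)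
    also have "?P (\<lambda>\<omega>. cl \<omega> = C) * (p * ?P (far C y)) \<le> ?P (\<lambda>\<omega>. cl \<omega> = C) * (p * b)"
    proof (intro mult_left_mono)
      have "?P (far C y) \<le> ?P (arm V y)"
      proof (rule pr_mono)
        fix \<omega> assume "far C y \<omega>"
        then obtain d where "d \<in> bdry V" "conn (\<omega> \<inter> ?D) y d" by (auto simp: far_def)
        moreover have "conn (\<omega> \<inter> ?E) y d" using calculation(2) by (rule conn_mono) auto
        ultimately show "arm V y \<omega>" by (auto simp: arm_def)
      qed (use assms in auto)
      moreover have "?P (arm V y) \<le> b" using b xyS xy by blast
      ultimately show "?P (far C y) \<le> b" by linarith
    next
      show "0 \<le> ?P (\<lambda>\<omega>. cl \<omega> = C)" using assms(5,6) by (intro pr_nonneg) simp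
    qed (use assms(5) in simp)
    finally show "?P (\<lambda>\<omega>. cl \<omega> = C \<and> ({fst xy, snd xy} \<in> \<omega> \<and> far C (snd xy) \<omega>)) \<le> ?P (\<lambda>\<omega>. cl \<omega> = C) * (p * b)"
      by (simp add: xy)
  qed
  also have "\<dots> = (\<Sum>xy\<in>edge_bdry S. pr (edges_in S) (\<lambda>_. p) (\<lambda>\<omega>. conn \<omega> 0 (fst xy)) * (p * b))"
  proof (intro sum.cong refl)
    fix xy
    have "(\<Sum>C\<in>?I (fst xy). ?P (\<lambda>\<omega>. cl \<omega> = C)) = ?P (\<lambda>\<omega>. cl \<omega> \<in> ?I (fst xy))"
      using pr_sum_partition[of "?I (fst xy)" ?E "\<lambda>_. p" cl "\<lambda>_ _. True"] finS by simp
    also have "\<dots> = pr (edges_in S) (\<lambda>_. p) (\<lambda>\<omega>. conn \<omega> 0 (fst xy))"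
      using cl_S finE assms(2) by (intro pr_restrict) (auto simp: cl_def edges_in_mono)
    finally show "(\<Sum>C\<in>?I (fst xy). ?P (\<lambda>\<omega>. cl \<omega> = C) * (p * b)) =
      pr (edges_in S) (\<lambda>_. p) (\<lambda>\<omega>. conn \<omega> 0 (fst xy)) * (p * b)"
      by (simp add: sum_distrib_right[symmetric])
  qed
  also have "\<dots> = phi p S * b"
    by (simp add: phi_def sum_distrib_right sum_distrib_left case_prod_beta algebra_simps)
  finally show ?thesis .
qed

section \<open>The Duminil-Copin--Tassion dichotomy\<close>

definition unarmed :: "vertex set \<Rightarrow> edge set \<Rightarrow> vertex set" where
  "unarmed V \<omega> = {v \<in> V. \<not> arm V v \<omega>}"

lemma arm_bdry: "d \<in> bdry V \<Longrightarrow> arm V d \<omega>"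
  unfolding arm_def by blast

text \<open>An exploration from \<open>bdry V\<close> never follows an edge with both ends unarmed,
  so the event \<open>unarmed V \<omega> = S\<close> is independent of the edges inside
  \<open>S\<close>. Both directions trace an arm backwards from its boundary vertex.\<close>

lemma unarmed_Diff:
  "unarmed V \<omega> = S \<longleftrightarrow> unarmed V (\<omega> - edges_in S) = S"
proof
  assume S: "unarmed V \<omega> = S"
  have "arm V v (\<omega> - edges_in S)" if v: "arm V v \<omega>" for v
  proof -
    obtain d where d: "d \<in> bdry V" "conn (\<omega> \<inter> edges_in V) v d" using v by (auto simp: arm_def)
    from conn_sym[OF d(2)] show ?thesis
    proof (induction rule: conn_induct)
      case refl
      then show ?case using d(1) by (rule arm_bdry)
    next
      case (step y z)
      have zy: "{z, y} \<in> \<omega> \<inter> edges_in V" using step.hyps by (simp add: insert_commute)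
      have "arm V y \<omega>" using step.IH by (rule arm_mono) auto
      then have "arm V z \<omega>" using zy by (rule arm_step)
      then have "z \<notin> S" using S by (auto simp: unarmed_def)
      then have "{z, y} \<in> (\<omega> - edges_in S) \<inter> edges_in V" using zy by (auto simp: edges_in_iff)
      with step.IH show ?case by (rule arm_step)
    qed
  qed
  moreover have "arm V v \<omega>" if "arm V v (\<omega> - edges_in S)" for v
    using that by (rule arm_mono) auto
  ultimately show "unarmed V (\<omega> - edges_in S) = S" using S unfolding unarmed_def by blast
next
  assume S: "unarmed V (\<omega> - edges_in S) = S"
  have "v \<notin> S" if v: "arm V v \<omega>" for v
  proof -
    obtain d where d: "d \<in> bdry V" "conn (\<omega> \<inter> edges_in V) v d" using v by (auto simp: arm_def)
    from conn_sym[OF d(2)] show ?thesis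
    proof (induction rule: conn_induct)
      case refl
      have "arm V d (\<omega> - edges_in S)" using d(1) by (rule arm_bdry)
      then show ?case using S unfolding unarmed_def by blast
    next
      case (step y z)
      have zy: "{z, y} \<in> \<omega> \<inter> edges_in V" using step.hyps by (simp add: insert_commute)
      then have "y \<in> V" by (simp add: edges_in_iff)
      then have "arm V y (\<omega> - edges_in S)" using step.IH S unfolding unarmed_def by blast
      moreover have "{z, y} \<in> (\<omega> - edges_in S) \<inter> edges_in V"
        using zy step.IH by (simp add: edges_in_iff)
      ultimately have "arm V z (\<omega> - edges_in S)" by (rule arm_step)
      then show ?case using S unfolding unarmed_def by blast
    qed
  qed
  moreover have "arm V v \<omega>" if "arm V v (\<omega> - edges_in S)" for v
    using that by (rule arm_mono) auto
  ultimately show "unarmed V \<omega> = S" using S unfolding unarmed_def by blast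
qed

text \<open>Only \<open>S = unarmed V \<omega>\<close> contributes. If an unarmed \<open>x\<close>
  is joined to the origin inside this set and its neighbour \<open>y\<close> is armed, then opening
  \<open>{x, y}\<close> gives the origin the arm it lacks. Different pairs give different edges,
  because exactly one end is unarmed.\<close>

lemma unarmed_pivotal_count:
  assumes "finite V" "0 \<in> V" "\<omega> \<subseteq> edges_in V"
  shows "(\<Sum>S | S \<subseteq> V \<and> 0 \<in> S. \<Sum>xy\<in>edge_bdry S. of_bool (unarmed V \<omega> = S \<and> conn (\<omega> \<inter> edges_in S) 0 (fst xy)))
    \<le> (\<Sum>e\<in>edges_in V. of_bool (arm V 0 (insert e \<omega>)) - of_bool (arm V 0 (\<omega> - {e})) :: real)"
    (is "?L \<le> ?R")
proof -
  have nonneg: "0 \<le> of_bool (arm V 0 (insert e \<omega>)) - (of_bool (arm V 0 (\<omega> - {e})) :: real)" for e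
    using arm_mono[of V 0 "\<omega> - {e}" "insert e \<omega>"] by auto
  define U where "U = unarmed V \<omega>"
  define A where "A = {xy \<in> edge_bdry U. conn (\<omega> \<inter> edges_in U) 0 (fst xy)}"
  have UV: "U \<subseteq> V" by (auto simp: U_def unarmed_def)
  then have finU: "finite U" using assms finite_subset by auto
  show ?thesis
  proof (cases "0 \<in> U")
    case False
    then have "?L = 0" by (intro sum.neutral ballI) (auto simp: U_def)
    moreover have "0 \<le> ?R" using nonneg by (rule sum_nonneg)
    ultimately show ?thesis by simp
  next
    case True
    have "?L = (\<Sum>S | S \<subseteq> V \<and> 0 \<in> S. if U = S then (\<Sum>xy\<in>edge_bdry S. of_bool (conn (\<omega> \<inter> edges_in S) 0 (fst xy))) else 0)"
      by (intro sum.cong refl) (auto simp: U_def)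
    also have "\<dots> = (\<Sum>xy\<in>edge_bdry U. of_bool (conn (\<omega> \<inter> edges_in U) 0 (fst xy)))"
      using UV True assms by (subst sum.delta') auto
    also have "\<dots> = real (card A)"
      using finite_edge_bdry[OF finU] by (simp add: A_def sum.If_cases of_bool_def Int_def)
    also have "\<dots> = real (card ((\<lambda>(x, y). {x, y}) ` A))"
    proof -
      have "inj_on (\<lambda>(x, y). {x, y}) A"
        by (auto simp: inj_on_def A_def edge_bdry_def doubleton_eq_iff)
      then show ?thesis by (simp add: card_image)
    qed
    also have "\<dots> = (\<Sum>e\<in>(\<lambda>(x, y). {x, y}) ` A. 1)" by simp
    also have "\<dots> \<le> ?R"
    proof (rule sum_le_included[where i = "\<lambda>e. e"])
      show "finite ((\<lambda>(x, y). {x, y}) ` A)" using finite_edge_bdry[OF finU] by (simp add: A_def)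
      show "finite (edges_in V)" using assms by (simp add: finite_edges_in)
      show "\<forall>e\<in>(\<lambda>(x, y). {x, y}) ` A. \<exists>e'\<in>edges_in V. e' = e \<and> (1 :: real) \<le>
          of_bool (arm V 0 (insert e' \<omega>)) - of_bool (arm V 0 (\<omega> - {e'}))"
      proof
        fix e assume "e \<in> (\<lambda>(x, y). {x, y}) ` A"
        then obtain x y where e: "e = {x, y}" and x: "x \<in> U" "y \<notin> U" "adjacent x y"
          "conn (\<omega> \<inter> edges_in U) 0 x"
          by (auto simp: A_def edge_bdry_def)
        have "x \<notin> bdry V" using x(1) arm_bdry[of x V \<omega>] by (auto simp: U_def unarmed_def)
        then have yV: "y \<in> V" using x UV by (auto simp: bdry_def)
        then have eV: "{x, y} \<in> edges_in V" using x UV by (auto simp: edges_in_iff)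
        have "arm V y \<omega>" using yV x(2) by (auto simp: U_def unarmed_def)
        then have "arm V y (insert e \<omega>)" by (rule arm_mono) auto
        then have "arm V x (insert e \<omega>)" by (rule arm_step) (use eV e in auto)
        then obtain d where d: "d \<in> bdry V" "conn (insert e \<omega> \<inter> edges_in V) x d" by (auto simp: arm_def)
        have "conn (insert e \<omega> \<inter> edges_in V) 0 x"
          using x(4) by (rule conn_mono) (use edges_in_mono[OF UV] in auto)
        then have "conn (insert e \<omega> \<inter> edges_in V) 0 d" using d(2) by (rule conn_trans)
        then have "arm V 0 (insert e \<omega>)" using d(1) by (auto simp: arm_def)
        moreover have "\<not> arm V 0 (\<omega> - {e})"
          using True arm_mono[of V 0 "\<omega> - {e}" \<omega>] by (auto simp: U_def unarmed_def)
        ultimately show "\<exists>e'\<in>edges_in V. e' = e \<and> (1 :: real) \<le>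
          of_bool (arm V 0 (insert e' \<omega>)) - of_bool (arm V 0 (\<omega> - {e'}))"
          using eV e by auto
      qed
    qed (use nonneg in auto)
    finally show ?thesis .
  qed
qed

text \<open>The event without an arm is split by the value \<open>S\<close> of the unarmed set. Each
  piece is multiplied by \<open>phi p S\<close>, which is at least 1, and independence of the edges
  inside \<open>S\<close> turns the product into probabilities of pivotal edges on the boundary of
  \<open>S\<close>.\<close>

theorem duminil_copin_tassion:
  assumes "finite V" "0 \<in> V" "0 \<le> p" "p \<le> 1"
    and phi: "\<And>S. finite S \<Longrightarrow> 0 \<in> S \<Longrightarrow> 1 \<le> phi p S"
  shows "1 - pr (edges_in V) (\<lambda>_. p) (arm V 0) \<le>
    (\<Sum>e\<in>edges_in V. expect (edges_in V) (\<lambda>_. p)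
       (\<lambda>\<omega>. of_bool (arm V 0 (insert e \<omega>)) - of_bool (arm V 0 (\<omega> - {e}))))"
proof -
  let ?E = "edges_in V" and ?P = "pr (edges_in V) (\<lambda>_. p)" and ?I = "{S. S \<subseteq> V \<and> 0 \<in> S}"
  let ?U = "unarmed V"
  have finE: "finite ?E" using assms by (simp add: finite_edges_in)
  have finI: "finite ?I" using assms by simp
  have "1 - ?P (arm V 0) = ?P (\<lambda>\<omega>. \<not> arm V 0 \<omega>)" using finE by (simp add: pr_not)
  also have "\<dots> = ?P (\<lambda>\<omega>. ?U \<omega> \<in> ?I)"
    using assms(2) by (intro pr_cong) (auto simp: unarmed_def)
  also have "\<dots> = (\<Sum>S\<in>?I. ?P (\<lambda>\<omega>. ?U \<omega> = S))"
    using pr_sum_partition[of ?I ?E "\<lambda>_. p" ?U "\<lambda>_ _. True", OF finI] by simp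
  also have "\<dots> \<le> (\<Sum>S\<in>?I. \<Sum>xy\<in>edge_bdry S. ?P (\<lambda>\<omega>. ?U \<omega> = S \<and> conn (\<omega> \<inter> edges_in S) 0 (fst xy)))"
  proof (rule sum_mono)
    fix S assume S: "S \<in> ?I"
    then have finS: "finite S" using assms finite_subset by auto
    let ?Q = "\<lambda>xy. pr (edges_in S) (\<lambda>_. p) (\<lambda>\<omega>. conn \<omega> 0 (fst xy))"
    have "1 \<le> phi p S" using phi finS S by simp
    also have "phi p S = (\<Sum>xy\<in>edge_bdry S. p * ?Q xy)"
      by (simp add: phi_def case_prod_beta)
    \<comment> \<open>Bounding the factor \<open>p\<close> of \<open>phi\<close> by 1 gives the
      constant 1 in the differential inequality; any positive constant would serve later.\<close>
    also have "\<dots> \<le> (\<Sum>xy\<in>edge_bdry S. 1 * ?Q xy)"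
      using assms by (intro sum_mono mult_right_mono pr_nonneg) auto
    finally have "?P (\<lambda>\<omega>. ?U \<omega> = S) * 1 \<le> ?P (\<lambda>\<omega>. ?U \<omega> = S) * (\<Sum>xy\<in>edge_bdry S. ?Q xy)"
      using assms by (intro mult_left_mono pr_nonneg) auto
    also have "\<dots> = (\<Sum>xy\<in>edge_bdry S. ?P (\<lambda>\<omega>. ?U \<omega> = S \<and> conn (\<omega> \<inter> edges_in S) 0 (fst xy)))"
      unfolding sum_distrib_left
    proof (rule sum.cong[OF refl])
      fix xy
      have "?P (\<lambda>\<omega>. ?U \<omega> = S \<and> conn (\<omega> \<inter> edges_in S) 0 (fst xy)) =
        ?P (\<lambda>\<omega>. ?U \<omega> = S) * ?P (\<lambda>\<omega>. conn (\<omega> \<inter> edges_in S) 0 (fst xy))"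
      proof (rule pr_indep[OF finE])
        show "(- edges_in S) \<inter> edges_in S = {}" by auto
        show "?U \<omega> = S \<longleftrightarrow> ?U (\<omega> \<inter> - edges_in S) = S" for \<omega>
          using unarmed_Diff[of V \<omega> S] by (simp add: Diff_eq)
      qed (simp add: Int_assoc)
      also have "?P (\<lambda>\<omega>. conn (\<omega> \<inter> edges_in S) 0 (fst xy)) = ?Q xy"
        using finE S by (intro pr_restrict edges_in_mono) auto
      finally show "?P (\<lambda>\<omega>. ?U \<omega> = S) * ?Q xy = ?P (\<lambda>\<omega>. ?U \<omega> = S \<and> conn (\<omega> \<inter> edges_in S) 0 (fst xy))"
        by simp
    qed
    finally show "?P (\<lambda>\<omega>. ?U \<omega> = S) \<le> (\<Sum>xy\<in>edge_bdry S. ?P (\<lambda>\<omega>. ?U \<omega> = S \<and> conn (\<omega> \<inter> edges_in S) 0 (fst xy)))"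
      by simp
  qed
  also have "\<dots> = expect ?E (\<lambda>_. p) (\<lambda>\<omega>. \<Sum>S\<in>?I. \<Sum>xy\<in>edge_bdry S. of_bool (?U \<omega> = S \<and> conn (\<omega> \<inter> edges_in S) 0 (fst xy)))"
    unfolding expect_sum pr_def ..
  also have "\<dots> \<le> expect ?E (\<lambda>_. p) (\<lambda>\<omega>. \<Sum>e\<in>?E. of_bool (arm V 0 (insert e \<omega>)) - of_bool (arm V 0 (\<omega> - {e})))"
    using assms by (intro expect_mono unarmed_pivotal_count) auto
  finally show ?thesis unfolding expect_sum .
qed

lemma phi_mono:
  assumes "finite S" "0 \<le> p" "p \<le> q" "q \<le> 1"
  shows "phi p S \<le> phi q S"
  unfolding phi_def case_prod_beta
  using assms
  by (intro sum_mono mult_mono pr_mono_param finite_edges_in) (auto intro: conn_mono pr_nonneg)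

text \<open>The differential inequality makes \<open>(1 - ?f x) * exp x\<close> nonincreasing on
  \<open>[p, q]\<close>; \<open>phi_mono\<close> carries the hypothesis from \<open>p\<close> to the
  whole interval.\<close>

theorem arm_lower_bound:
  assumes "finite V" "0 \<in> V" "0 \<le> p" "p \<le> q" "q \<le> 1"
    and phi: "\<And>S. finite S \<Longrightarrow> 0 \<in> S \<Longrightarrow> 1 \<le> phi p S"
  shows "1 - exp (p - q) \<le> pr (edges_in V) (\<lambda>_. q) (arm V 0)"
proof -
  let ?f = "\<lambda>x. pr (edges_in V) (\<lambda>_. x) (arm V 0)"
  let ?D = "\<lambda>x. \<Sum>e\<in>edges_in V. expect (edges_in V) (\<lambda>_. x)
       (\<lambda>\<omega>. of_bool (arm V 0 (insert e \<omega>)) - of_bool (arm V 0 (\<omega> - {e})))"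
  have D: "(?f has_real_derivative ?D x) (at x)" for x
    unfolding pr_def using assms(1) by (intro russo_formula finite_edges_in)
  have "(1 - ?f q) * exp q \<le> (1 - ?f p) * exp p"
  proof (rule DERIV_nonpos_imp_nonincreasing[OF assms(4)])
    fix x assume x: "p \<le> x" "x \<le> q"
    have "1 - ?f x \<le> ?D x"
      using assms x phi phi_mono[of _ p x]
      by (intro duminil_copin_tassion) (auto intro: order_trans)
    then have "(1 - ?f x - ?D x) * exp x \<le> 0" by (simp add: mult_nonpos_nonneg)
    then have "(0 - ?D x) * exp x + exp x * (1 - ?f x) \<le> 0" by (simp add: algebra_simps)
    moreover have "((\<lambda>x. (1 - ?f x) * exp x) has_real_derivative ((0 - ?D x) * exp x + exp x * (1 - ?f x))) (at x)"
      by (intro DERIV_mult DERIV_diff DERIV_const D DERIV_exp)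
    ultimately show "\<exists>y. ((\<lambda>x. (1 - ?f x) * exp x) has_real_derivative y) (at x) \<and> y \<le> 0"
      by blast
  qed
  also have "\<dots> \<le> 1 * exp p"
    using assms by (intro mult_right_mono) (auto intro: pr_nonneg)
  finally have "1 - ?f q \<le> exp p / exp q" by (simp add: field_simps)
  then show ?thesis by (simp add: exp_diff)
qed

section \<open>One-arm probabilities of squares and their decay\<close>

definition sq :: "int \<Rightarrow> vertex set" where
  "sq n = {v. \<bar>fst v\<bar> \<le> n \<and> \<bar>snd v\<bar> \<le> n}"

lemma finite_sq: "finite (sq n)"
proof (rule finite_subset)
  show "sq n \<subseteq> {-n..n} \<times> {-n..n}" by (auto simp: sq_def)
qed simp

lemma zero_in_sq [simp]: "0 \<le> n \<Longrightarrow> 0 \<in> sq n"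
  by (simp add: sq_def)

lemma bdry_sq: "bdry (sq n) = {v \<in> sq n. \<bar>fst v\<bar> = n \<or> \<bar>snd v\<bar> = n}"
proof -
  have "(\<exists>w. w \<notin> sq n \<and> adjacent v w) \<longleftrightarrow> \<bar>fst v\<bar> = n \<or> \<bar>snd v\<bar> = n" if "v \<in> sq n" for v
    using that by (cases v) (simp add: sq_def adjacent_neighbours conj_disj_distribL ex_disj_distrib, arith)
  then show ?thesis unfolding bdry_def by blast
qed

definition theta :: "int \<Rightarrow> real \<Rightarrow> real" where
  "theta n p = pr (edges_in (sq n)) (\<lambda>_. p) (arm (sq n) 0)"

lemma theta_bounds:
  assumes "0 \<le> p" "p \<le> 1" shows "0 \<le> theta n p" "theta n p \<le> 1"
  unfolding theta_def using assms by (auto intro!: pr_nonneg pr_le_1 finite_edges_in finite_sq)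

lemma pr_arm_shift:
  assumes "finite V" "(+) y ` sq n \<subseteq> V"
  shows "pr (edges_in V) (\<lambda>_. p) (arm ((+) y ` sq n) y) = theta n p"
proof -
  let ?W = "(+) y ` sq n"
  have "pr (edges_in V) (\<lambda>_. p) (arm ?W y) = pr (edges_in ?W) (\<lambda>_. p) (arm ?W y)"
    using assms by (intro pr_restrict) (auto simp: finite_edges_in edges_in_mono arm_Int)
  also have "\<dots> = theta n p"
    using arm_image[OF lattice_aut_shift, of y "sq n" 0]
    by (simp add: pr_lattice_aut[OF lattice_aut_shift finite_sq] theta_def)
  finally show ?thesis .
qed

lemma pr_arm_le_theta:
  assumes "finite V" "(+) y ` sq n \<subseteq> V" "0 \<le> n" "0 \<le> p" "p \<le> 1"
  shows "pr (edges_in V) (\<lambda>_. p) (arm V y) \<le> theta n p"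
proof -
  have "y + 0 \<in> (+) y ` sq n" using assms(3) by (intro imageI) simp
  then have "pr (edges_in V) (\<lambda>_. p) (arm V y) \<le> pr (edges_in V) (\<lambda>_. p) (arm ((+) y ` sq n) y)"
    using assms by (intro pr_mono) (auto intro: arm_subset)
  then show ?thesis using pr_arm_shift assms by simp
qed

lemma shift_sq_subset: "y \<in> sq m \<Longrightarrow> m + n \<le> k \<Longrightarrow> (+) y ` sq n \<subseteq> sq k"
  by (auto simp: sq_def)

text \<open>Each application of the Simon-Lieb inequality to \<open>S\<close> gains a factor
  \<open>phi p S\<close> and uses up a distance \<open>L\<close>.\<close>

theorem subcritical_decay:
  assumes "finite S" "0 \<in> S" "phi p S < 1" "0 \<le> p" "p \<le> 1"
  shows "\<exists>L>0. \<forall>k. theta (int k * L) p \<le> phi p S ^ k"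
proof -
  obtain L0 where L0: "S \<subseteq> sq L0" "0 \<le> L0"
  proof
    define L where "L = (\<Sum>v\<in>S. \<bar>fst v\<bar> + \<bar>snd v\<bar>)"
    have "\<bar>fst v\<bar> + \<bar>snd v\<bar> \<le> L" if "v \<in> S" for v
      unfolding L_def using assms(1) that by (intro member_le_sum) auto
    then show "S \<subseteq> sq L" by (fastforce simp: sq_def)
    show "0 \<le> L" unfolding L_def by (intro sum_nonneg) auto
  qed
  \<comment> \<open>The outer end of an edge leaving \<open>S\<close> may lie one step beyond
    \<open>sq L0\<close>; the square of radius \<open>int k * ?L\<close> around it must still
    fit.\<close>
  let ?L = "L0 + 1"
  have "theta (int k * ?L) p \<le> phi p S ^ k" for k
  proof (induction k)
    case 0
    show ?case using theta_bounds assms by simp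
  next
    case (Suc k)
    let ?n = "int (Suc k) * ?L"
    have n: "?n = int k * ?L + ?L" by (simp add: algebra_simps)
    have nonneg: "0 \<le> int k * ?L" using L0 by simp
    then have lt: "L0 < ?n" unfolding n by linarith
    have "theta ?n p \<le> phi p S * theta (int k * ?L) p"
      unfolding theta_def[of ?n]
    proof (rule simon_lieb)
      have "sq L0 \<subseteq> sq ?n" using lt by (auto simp: sq_def simp del: of_nat_Suc)
      then show "S \<subseteq> sq ?n" using L0 by blast
      have "sq L0 \<inter> bdry (sq ?n) = {}" using lt unfolding bdry_sq by (auto simp: sq_def simp del: of_nat_Suc)
      then show "S \<inter> bdry (sq ?n) = {}" using L0 by blast
      fix x y assume "(x, y) \<in> edge_bdry S"
      then have "x \<in> sq L0" "adjacent x y" using L0 by (auto simp: edge_bdry_def)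
      then have "y \<in> sq ?L" by (auto simp: sq_def adjacent_def)
      then show "pr (edges_in (sq ?n)) (\<lambda>_. p) (arm (sq ?n) y) \<le> theta (int k * ?L) p"
        using assms nonneg n by (intro pr_arm_le_theta finite_sq shift_sq_subset) auto
    qed (use assms theta_bounds finite_sq in auto)
    also have "\<dots> \<le> phi p S * phi p S ^ k"
    proof (rule mult_left_mono[OF Suc.IH])
      show "0 \<le> phi p S" unfolding phi_def
        using assms by (intro sum_nonneg) (auto intro!: mult_nonneg_nonneg pr_nonneg)
    qed
    finally show ?case by simp
  qed
  then show ?thesis using L0 by (intro exI[of _ ?L]) auto
qed

section \<open>Boundary clusters and merging edges\<close>

definition bdry_clusters :: "vertex set \<Rightarrow> edge set \<Rightarrow> nat" where
  "bdry_clusters V \<omega> = card ((\<lambda>d. {v. conn (\<omega> \<inter> edges_in V) d v}) ` bdry V)"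

text \<open>All conditions are evaluated with \<open>e\<close> removed, so the event does not depend
  on the state of \<open>e\<close>, just like the differences in Russo's formula.\<close>

definition merging :: "vertex set \<Rightarrow> edge \<Rightarrow> edge set \<Rightarrow> bool" where
  "merging V e \<omega> \<longleftrightarrow> (\<exists>x y. e = {x, y} \<and> arm V x (\<omega> - {e}) \<and> arm V y (\<omega> - {e}) \<and>
     \<not> conn ((\<omega> - {e}) \<inter> edges_in V) x y)"

definition merging_count :: "vertex set \<Rightarrow> real \<Rightarrow> real" where
  "merging_count V p = (\<Sum>e\<in>edges_in V. pr (edges_in V) (\<lambda>_. p) (merging V e))"

lemma conn_class_eq:
  "conn \<omega> x y \<Longrightarrow> {v. conn \<omega> x v} = {v. conn \<omega> y v}"
  by (auto dest: conn_trans conn_sym)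

text \<open>Opening \<open>e\<close> acts on boundary clusters by the map \<open>h\<close>, which
  enlarges each to the new cluster containing it. Their number cannot grow, and it drops when
  \<open>h\<close> identifies the two clusters joined by \<open>e\<close>.\<close>

lemma bdry_clusters_drop:
  assumes "finite V" "e \<in> edges_in V"
  shows "of_bool (merging V e \<omega>) \<le> real (bdry_clusters V (\<omega> - {e})) - real (bdry_clusters V (insert e \<omega>))"
proof -
  let ?\<omega>0 = "(\<omega> - {e}) \<inter> edges_in V" and ?\<omega>1 = "insert e \<omega> \<inter> edges_in V"
  define f where "f d = {v. conn ?\<omega>0 d v}" for d
  define g where "g d = {v. conn ?\<omega>1 d v}" for d
  define h where "h A = {v. \<exists>u\<in>A. conn ?\<omega>1 u v}" for A
  have finb: "finite (f ` bdry V)" using assms bdry_subset finite_subset by blast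
  have sub: "?\<omega>0 \<subseteq> ?\<omega>1" by auto
  have g: "g d = h (f d)" for d
  proof (intro equalityI subsetI)
    fix v assume "v \<in> g d"
    then show "v \<in> h (f d)" unfolding f_def g_def h_def using conn_refl[of ?\<omega>0 d] by blast
  next
    fix v assume "v \<in> h (f d)"
    then obtain u where u: "conn ?\<omega>0 d u" "conn ?\<omega>1 u v" unfolding f_def h_def by blast
    have "conn ?\<omega>1 d u" using u(1) sub by (rule conn_mono)
    then show "v \<in> g d" using u(2) conn_trans by (auto simp: g_def)
  qed
  have gh: "g ` bdry V = h ` (f ` bdry V)" using g by (simp add: image_image)
  have b0: "bdry_clusters V (\<omega> - {e}) = card (f ` bdry V)"
    and b1: "bdry_clusters V (insert e \<omega>) = card (g ` bdry V)"
    unfolding bdry_clusters_def f_def g_def by auto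
  have le: "card (g ` bdry V) \<le> card (f ` bdry V)"
    unfolding gh using finb by (rule card_image_le)
  show ?thesis
  proof (cases "merging V e \<omega>")
    case False
    then show ?thesis using le b0 b1 by simp
  next
    case True
    then obtain x y where e: "e = {x, y}" "arm V x (\<omega> - {e})" "arm V y (\<omega> - {e})" "\<not> conn ?\<omega>0 x y"
      by (auto simp: merging_def)
    obtain d1 where d1: "d1 \<in> bdry V" "conn ?\<omega>0 x d1" using e(2) by (auto simp: arm_def)
    obtain d2 where d2: "d2 \<in> bdry V" "conn ?\<omega>0 y d2" using e(3) by (auto simp: arm_def)
    have "f d1 \<noteq> f d2"
    proof
      assume "f d1 = f d2"
      then have "conn ?\<omega>0 d1 d2" unfolding f_def using conn_refl[of ?\<omega>0 d2] by blast
      then have "conn ?\<omega>0 x d2" by (rule conn_trans[OF d1(2)])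
      then have "conn ?\<omega>0 x y" by (rule conn_trans[OF _ conn_sym[OF d2(2)]])
      then show False using e(4) by simp
    qed
    moreover have "h (f d1) = h (f d2)"
    proof -
      have "{x, y} \<in> ?\<omega>1" using assms(2) e(1) by auto
      then have xy: "conn ?\<omega>1 x y" by (rule conn_edge)
      have "conn ?\<omega>1 x d1" "conn ?\<omega>1 y d2" using conn_mono[OF d1(2) sub] conn_mono[OF d2(2) sub] by auto
      then have "conn ?\<omega>1 d1 d2" using xy by (meson conn_sym conn_trans)
      then have "g d1 = g d2" unfolding g_def by (rule conn_class_eq)
      then show ?thesis by (simp add: g)
    qed
    ultimately have "\<not> inj_on h (f ` bdry V)" using d1(1) d2(1) by (auto simp: inj_on_def)
    then have "card (g ` bdry V) \<noteq> card (f ` bdry V)"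
      unfolding gh using eq_card_imp_inj_on[OF finb] by metis
    then show ?thesis using le b0 b1 True by simp
  qed
qed

lemma expect_continuous: "finite E \<Longrightarrow> continuous_on A (\<lambda>x. expect E (\<lambda>_. x) f)"
  using russo_formula[of E f] by (intro DERIV_continuous_on) (auto intro: has_field_derivative_at_within)

lemma expect_measurable [measurable]:
  assumes "finite E" shows "(\<lambda>x. expect E (\<lambda>_. x) f) \<in> borel_measurable borel"
  using expect_continuous[OF assms] by (intro borel_measurable_continuous_onI)

lemma merging_count_measurable:
  assumes "finite V" shows "merging_count V \<in> borel_measurable borel"
  unfolding merging_count_def[abs_def] pr_def using assms finite_edges_in by measurable

text \<open>Opening an edge lowers the number of boundary clusters by one exactly when it merges two of
  them, so Russo's formula bounds the integrated number of such edges by the size of the boundary.\<close>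

theorem merging_count_integral:
  assumes "finite V" "0 \<le> a" "a \<le> b" "b \<le> 1"
  shows "(\<integral>\<^sup>+ x. ennreal (merging_count V x) * indicator {a..b} x \<partial>lborel) \<le> ennreal (card (bdry V))"
proof -
  let ?E = "edges_in V"
  let ?N = "\<lambda>x. expect ?E (\<lambda>_. x) (\<lambda>\<omega>. real (bdry_clusters V \<omega>))"
  let ?D = "\<lambda>x. \<Sum>e\<in>?E. expect ?E (\<lambda>_. x) (\<lambda>\<omega>. real (bdry_clusters V (insert e \<omega>)) - real (bdry_clusters V (\<omega> - {e})))"
  have finE: "finite ?E" using assms finite_edges_in by auto
  have finb: "finite (bdry V)" using assms bdry_subset finite_subset by blast
  have G: "merging_count V x \<le> - ?D x" if "x \<in> {a..b}" for x
    unfolding merging_count_def sum_negf[symmetric] pr_def expect_uminus[symmetric]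
    using that assms bdry_clusters_drop[OF assms(1)] by (intro sum_mono expect_mono) auto
  have Gn: "0 \<le> merging_count V x" if "x \<in> {a..b}" for x
    unfolding merging_count_def using that assms by (intro sum_nonneg pr_nonneg) auto
  have N: "?N x \<le> card (bdry V)" if "x \<in> {a..b}" for x
  proof -
    have "?N x \<le> expect ?E (\<lambda>_. x) (\<lambda>_. card (bdry V))"
      using that assms finb by (intro expect_mono) (auto simp: bdry_clusters_def intro: card_image_le)
    then show ?thesis using finE by (simp add: expect_const)
  qed
  have Nn: "0 \<le> ?N x" if "x \<in> {a..b}" for x
  proof -
    have "expect ?E (\<lambda>_. x) (\<lambda>_. 0) \<le> ?N x" using that assms by (intro expect_mono) auto
    then show ?thesis using finE by (simp add: expect_const)
  qed
  have "(\<integral>\<^sup>+ x. ennreal (merging_count V x) * indicator {a..b} x \<partial>lborel)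
     \<le> (\<integral>\<^sup>+ x. ennreal (- ?D x) * indicator {a..b} x \<partial>lborel)"
    using G by (intro nn_integral_mono) (auto simp: indicator_def intro: ennreal_leI)
  also have "\<dots> = ennreal (- ?N b - (- ?N a))"
  \<comment> \<open>The integrand \<open>- ?D\<close> dominates the nonnegative merging count, which
    supplies the sign condition of this form of the fundamental theorem.\<close>
  proof (rule nn_integral_FTC_Icc[OF _ _ _ assms(3)])
    show "(\<lambda>x. - ?D x) \<in> borel_measurable borel"
      using finE by measurable
  next
    fix x assume x: "x \<in> {a..b}"
    show "((\<lambda>x. - ?N x) has_real_derivative - ?D x) (at x)"
      by (rule DERIV_minus[OF russo_formula[OF finE]])
    show "0 \<le> - ?D x" using G[OF x] Gn[OF x] by linarith
  qed
  also have "\<dots> \<le> ennreal (card (bdry V))"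
    using N[of a] Nn[of b] assms by (intro ennreal_leI) auto
  finally show ?thesis .
qed

section \<open>Linear against quadratic growth of the merging count\<close>

lemma card_sq: "0 \<le> n \<Longrightarrow> card (sq n) = nat (2 * n + 1) ^ 2"
proof -
  have "sq n = {-n..n} \<times> {-n..n}" by (auto simp: sq_def)
  then show "0 \<le> n \<Longrightarrow> card (sq n) = nat (2 * n + 1) ^ 2"
    by (simp add: card_cartesian_product power2_eq_square algebra_simps)
qed

lemma card_bdry_sq:
  assumes "0 \<le> n" shows "card (bdry (sq n)) \<le> 4 * nat (2 * n + 1)"
proof -
  have "bdry (sq n) \<subseteq> ({n} \<times> {-n..n} \<union> {-n} \<times> {-n..n}) \<union> ({-n..n} \<times> {n} \<union> {-n..n} \<times> {-n})"
    unfolding bdry_sq by (auto simp: sq_def)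
  then have "card (bdry (sq n)) \<le> card (({n} \<times> {-n..n} \<union> {-n} \<times> {-n..n}) \<union> ({-n..n} \<times> {n} \<union> {-n..n} \<times> {-n}))"
    by (intro card_mono) auto
  also have "\<dots> \<le> (card ({n} \<times> {-n..n}) + card ({-n} \<times> {-n..n})) + (card ({-n..n} \<times> {n}) + card ({-n..n} \<times> {-n}))"
    by (intro order_trans[OF card_Un_le] add_mono card_Un_le)
  also have "\<dots> = 4 * nat (2 * n + 1)" by (simp add: card_cartesian_product algebra_simps)
  finally show ?thesis .
qed

text \<open>The constants \<open>c\<close> and \<open>k0\<close> may depend on the density, so there
  is no uniform bound to integrate. Instead the counts divided by \<open>k\<close> would tend to
  infinity pointwise while their integrals stay bounded, against Fatou's lemma.\<close>

theorem merging_count_not_quadratic: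
  assumes "0 \<le> a" "a < b" "b \<le> 1"
  shows "\<exists>p. a < p \<and> p \<le> b \<and> \<not> (\<exists>c>0. \<exists>k0. \<forall>k\<ge>k0. c * real k ^ 2 \<le> merging_count (sq (int k)) p)"
proof (rule ccontr)
  assume neg: "\<not> ?thesis"
  then have neg': "\<exists>c>0. \<exists>k0. \<forall>k\<ge>k0. c * real k ^ 2 \<le> merging_count (sq (int k)) p"
    if "a < p" "p \<le> b" for p using that by blast
  define u where "u k x = ennreal (inverse (real k)) * (ennreal (merging_count (sq (int k)) x) * indicator {a..b} x)" for k :: nat and x
  note [measurable] = merging_count_measurable[OF finite_sq]
  have u_meas: "u k \<in> borel_measurable lborel" for k
    unfolding u_def by measurable
  \<comment> \<open>The 12 comes from \<open>4 * (2 * k + 1) \<le> 12 * k\<close> for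
    \<open>k \<ge> 1\<close>.\<close>
  have int_u: "integral\<^sup>N lborel (u k) \<le> 12" if "k \<ge> 1" for k
  proof -
    have "integral\<^sup>N lborel (u k) = ennreal (inverse (real k)) * (\<integral>\<^sup>+ x. ennreal (merging_count (sq (int k)) x) * indicator {a..b} x \<partial>lborel)"
      unfolding u_def by (rule nn_integral_cmult) measurable
    also have "\<dots> \<le> ennreal (inverse (real k)) * ennreal (12 * real k)"
    proof (intro mult_left_mono order_trans[OF merging_count_integral] ennreal_leI)
      have "card (bdry (sq (int k))) \<le> 4 * nat (2 * int k + 1)" by (intro card_bdry_sq) simp
      also have "\<dots> \<le> 12 * k" using that by auto
      finally show "real (card (bdry (sq (int k)))) \<le> 12 * real k" by (metis of_nat_le_iff of_nat_mult of_nat_numeral)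
    qed (use assms finite_sq in auto)
    also have "\<dots> = ennreal (inverse (real k) * (12 * real k))" by (simp add: ennreal_mult')
    also have "inverse (real k) * (12 * real k) = 12" using that by (simp add: field_simps)
    finally show ?thesis by simp
  qed
  have lim_u: "liminf (\<lambda>k. u k x) = \<infinity>" if x: "x \<in> {a<..b}" for x
  proof -
    obtain c k0 where c: "c > 0" "\<And>k. k \<ge> k0 \<Longrightarrow> c * real k ^ 2 \<le> merging_count (sq (int k)) x"
      using neg'[of x] x by auto
    have "eventually (\<lambda>k. ennreal C < u k x) sequentially" if "C \<ge> 0" for C
    proof -
      obtain k1 where k1: "C / c < real k1" using reals_Archimedean2 by blast
      show ?thesis unfolding eventually_sequentially
      proof (intro exI[of _ "max 1 (max k0 k1)"] allI impI)
        fix k assume k: "max 1 (max k0 k1) \<le> k"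
        then have "C / c < real k" using k1 by auto
        then have "C < c * real k" using c by (simp add: field_simps)
        also have "c * real k = inverse (real k) * (c * real k ^ 2)" using k by (simp add: power2_eq_square field_simps)
        also have "\<dots> \<le> inverse (real k) * merging_count (sq (int k)) x"
          using k c by (intro mult_left_mono) auto
        finally have "ennreal C < ennreal (inverse (real k) * merging_count (sq (int k)) x)"
          using that by (intro ennreal_lessI) auto
        then show "ennreal C < u k x" using x by (simp add: u_def ennreal_mult')
      qed
    qed
    then have "(\<lambda>k. u k x) \<longlonglongrightarrow> \<infinity>" by (simp add: tendsto_top_iff_ennreal infinity_ennreal_def)
    then show ?thesis by (intro lim_imp_Liminf) auto
  qed
  have "\<infinity> = (\<infinity> :: ennreal) * emeasure lborel {a<..b}" using assms by (simp add: ennreal_top_mult)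
  also have "\<dots> = (\<integral>\<^sup>+ x. \<infinity> * indicator {a<..b} x \<partial>lborel)" by (simp add: nn_integral_cmult_indicator)
  also have "\<dots> \<le> (\<integral>\<^sup>+ x. liminf (\<lambda>k. u k x) \<partial>lborel)"
    using lim_u by (intro nn_integral_mono) (auto simp: indicator_def)
  also have "\<dots> \<le> liminf (\<lambda>k. integral\<^sup>N lborel (u k))"
    using u_meas by (intro nn_integral_liminf)
  also have "\<dots> \<le> liminf (\<lambda>k::nat. 12)"
    using int_u by (intro Liminf_mono) (auto simp: eventually_sequentially)
  also have "\<dots> = 12" by (simp add: Liminf_const)
  finally show False by (simp add: top_unique)
qed

text \<open>Arms persist in the smaller set and so does the absence of a connection, so merging in a
  large domain implies merging in every subdomain containing the edge.\<close>

lemma merging_subset: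
  assumes "merging W e \<omega>" "V \<subseteq> W" "e \<in> edges_in V"
  shows "merging V e \<omega>"
proof -
  obtain x y where e: "e = {x, y}" "arm W x (\<omega> - {e})" "arm W y (\<omega> - {e})"
     "\<not> conn ((\<omega> - {e}) \<inter> edges_in W) x y" using assms(1) by (auto simp: merging_def)
  have V: "x \<in> V" "y \<in> V" using assms(3) e(1) by (auto simp: edges_in_def)
  have "\<not> conn ((\<omega> - {e}) \<inter> edges_in V) x y"
    using e(4) conn_mono[of "(\<omega> - {e}) \<inter> edges_in V" x y "(\<omega> - {e}) \<inter> edges_in W"] edges_in_mono[OF assms(2)]
    by blast
  then show ?thesis unfolding merging_def
    using arm_subset[OF e(2) assms(2) V(1)] arm_subset[OF e(3) assms(2) V(2)] e(1) by blast
qed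

lemma merging_image:
  assumes "lattice_aut g" "merging V e \<omega>"
  shows "merging (g ` V) (g ` e) ((`) g ` \<omega>)"
proof -
  have inj: "inj g" using assms by (auto simp: lattice_aut_def bij_def)
  obtain x y where e: "e = {x, y}" "arm V x (\<omega> - {e})" "arm V y (\<omega> - {e})"
     "\<not> conn ((\<omega> - {e}) \<inter> edges_in V) x y" using assms(2) by (auto simp: merging_def)
  have 1: "(`) g ` \<omega> - {g ` e} = (`) g ` (\<omega> - {e})"
    using inj_image_sets[OF inj, of UNIV] by (simp add: image_set_diff)
  have 2: "(`) g ` (\<omega> - {e}) \<inter> edges_in (g ` V) = (`) g ` ((\<omega> - {e}) \<inter> edges_in V)"
    using inj_image_sets[OF inj, of UNIV] by (simp add: edges_in_image[OF assms(1)] image_Int)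
  show ?thesis unfolding merging_def 1 2
    using e by (intro exI[of _ "g x"] exI[of _ "g y"])
      (simp add: arm_image[OF assms(1)] conn_image_iff[OF inj])
qed

text \<open>Every translate of \<open>sq m\<close> inside \<open>sq k\<close> contains at least
  \<open>c\<close> merging edges in expectation. There are of order \<open>k ^ 2\<close> translates,
  and an edge of \<open>sq k\<close> is counted at most once for each edge of \<open>sq m\<close>.
  The domains \<open>W n\<close> are left free because the bound is obtained in rectangles.\<close>

theorem merging_count_quadratic:
  assumes p: "0 \<le> p" "p \<le> 1" and c: "c > 0"
    and W: "\<And>n. n \<ge> n0 \<Longrightarrow> finite (W n) \<and> sq (int n) \<subseteq> W n \<and>
      c \<le> (\<Sum>e\<in>edges_in (sq (int m)). pr (edges_in (W n)) (\<lambda>_. p) (merging (W n) e))"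
  shows "\<exists>c>0. \<exists>k0. \<forall>k\<ge>k0. c * real k ^ 2 \<le> merging_count (sq (int k)) p"
proof -
  let ?F = "edges_in (sq (int m))"
  have finF: "finite ?F" by (intro finite_edges_in finite_sq)
  have F0: "card ?F > 0"
  proof (rule ccontr)
    assume "\<not> ?thesis"
    then have "?F = {}" using finF by auto
    then show False using W[of n0] c by auto
  qed
  have main: "c / card ?F * real k ^ 2 \<le> merging_count (sq (int k)) p" if k: "k \<ge> max n0 (2 * m)" for k
  proof -
    \<comment> \<open>The doubled index ensures that \<open>?W\<close>, translated by any
      \<open>x\<close> in \<open>?X\<close>, still covers \<open>?V\<close>; the radius of
      \<open>?X\<close> keeps the translated small boxes inside \<open>?V\<close>.\<close>
    let ?V = "sq (int k)" and ?W = "W (2 * k)" and ?X = "sq (int k - int m)"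
    let ?g = "\<lambda>e. pr (edges_in ?V) (\<lambda>_. p) (merging ?V e)"
    have finV: "finite (edges_in ?V)" by (intro finite_edges_in finite_sq)
    have WW: "finite ?W" "sq (int (2 * k)) \<subseteq> ?W"
       "c \<le> (\<Sum>e\<in>?F. pr (edges_in ?W) (\<lambda>_. p) (merging ?W e))" using W[of "2 * k"] k by auto
    have gn: "0 \<le> ?g e" for e using p by (intro pr_nonneg) auto
    have le: "pr (edges_in ?W) (\<lambda>_. p) (merging ?W e) \<le> ?g ((+) x ` e)"
      and mem: "(+) x ` e \<in> edges_in ?V"
      if x: "x \<in> ?X" and e: "e \<in> ?F" for x e
    proof -
      have sub1: "(+) x ` sq (int m) \<subseteq> ?V" using x by (rule shift_sq_subset) simp
      have "(+) x ` e \<in> edges_in ((+) x ` sq (int m))"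
        unfolding edges_in_image[OF lattice_aut_shift] using e by blast
      then show mem: "(+) x ` e \<in> edges_in ?V" using edges_in_mono[OF sub1] by blast
      have "?V \<subseteq> (+) x ` sq (int (2 * k))"
      proof
        fix v assume v: "v \<in> ?V"
        have "v = x + (v - x)" by simp
        moreover have "v - x \<in> sq (int (2 * k))" using v x by (auto simp: sq_def)
        ultimately show "v \<in> (+) x ` sq (int (2 * k))" by (rule image_eqI)
      qed
      also have "\<dots> \<subseteq> (+) x ` ?W" using WW(2) by (rule image_mono)
      finally have sub2: "?V \<subseteq> (+) x ` ?W" .
      have fin2: "finite ((+) x ` ?W)" using WW(1) by simp
      have "pr (edges_in ?W) (\<lambda>_. p) (merging ?W e)
         \<le> pr (edges_in ?W) (\<lambda>_. p) (\<lambda>\<omega>. merging ((+) x ` ?W) ((+) x ` e) ((`) ((+) x) ` \<omega>))"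
        using p merging_image[OF lattice_aut_shift] by (intro pr_mono) auto
      also have "\<dots> = pr (edges_in ((+) x ` ?W)) (\<lambda>_. p) (merging ((+) x ` ?W) ((+) x ` e))"
        by (rule pr_lattice_aut[OF lattice_aut_shift WW(1), symmetric])
      also have "\<dots> \<le> pr (edges_in ((+) x ` ?W)) (\<lambda>_. p) (merging ?V ((+) x ` e))"
        using p sub2 mem by (intro pr_mono) (auto intro: merging_subset)
      also have "\<dots> = ?g ((+) x ` e)"
      proof (rule pr_restrict)
        show "finite (edges_in ((+) x ` ?W))" using fin2 by (rule finite_edges_in)
        show "edges_in ?V \<subseteq> edges_in ((+) x ` ?W)" using sub2 by (rule edges_in_mono)
        show "merging ?V ((+) x ` e) \<omega> \<longleftrightarrow> merging ?V ((+) x ` e) (\<omega> \<inter> edges_in ?V)" for \<omega>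
        proof -
          have "\<omega> \<inter> edges_in ?V - {(+) x ` e} = (\<omega> - {(+) x ` e}) \<inter> edges_in ?V" by auto
          then show ?thesis by (simp add: merging_def arm_Int Int_assoc)
        qed
      qed
      finally show "pr (edges_in ?W) (\<lambda>_. p) (merging ?W e) \<le> ?g ((+) x ` e)" .
    qed
    have "real k ^ 2 * c \<le> real (card ?X) * c"
    proof (intro mult_right_mono)
      have "k \<le> nat (2 * (int k - int m) + 1)" using k by auto
      then have "k ^ 2 \<le> card ?X" using k by (subst card_sq) (auto intro: power_mono)
      then show "real k ^ 2 \<le> real (card ?X)" by (metis of_nat_le_iff of_nat_power)
    qed (use c in simp)
    also have "\<dots> = (\<Sum>x\<in>?X. c)" by simp
    also have "\<dots> \<le> (\<Sum>x\<in>?X. \<Sum>e\<in>?F. ?g ((+) x ` e))"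
      using WW(3) le by (intro sum_mono order_trans[OF WW(3)]) auto
    also have "\<dots> = (\<Sum>e\<in>?F. \<Sum>x\<in>?X. ?g ((+) x ` e))" by (rule sum.swap)
    also have "\<dots> \<le> (\<Sum>e\<in>?F. merging_count ?V p)"
    proof (rule sum_mono)
      fix e assume e: "e \<in> ?F"
      then obtain u v where "e = {u, v}" "adjacent u v" by (auto simp: edges_in_def edges_def)
      then have uv: "e = {u, v}" "u \<noteq> v" by auto
      \<comment> \<open>Equal translates could also match with swapped ends, but then
        \<open>x - x'\<close> equals both \<open>v - u\<close> and \<open>u - v\<close>, which
        forces \<open>u = v\<close>.\<close>
      have inj: "inj_on (\<lambda>x. (+) x ` e) ?X"
      proof (rule inj_onI)
        fix x x' assume "(+) x ` e = (+) x' ` e"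
        then consider "x + u = x' + u" | "x + u = x' + v" "x + v = x' + u"
          using uv by (auto simp: doubleton_eq_iff)
        then show "x = x'"
          using uv(2) by cases (auto simp: prod_eq_iff)
      qed
      have "(\<Sum>x\<in>?X. ?g ((+) x ` e)) = (\<Sum>e'\<in>(\<lambda>x. (+) x ` e) ` ?X. ?g e')"
        by (subst sum.reindex[OF inj]) simp
      also have "\<dots> \<le> (\<Sum>e'\<in>edges_in ?V. ?g e')"
        using mem[OF _ e] gn finV by (intro sum_mono2) auto
      finally show "(\<Sum>x\<in>?X. ?g ((+) x ` e)) \<le> merging_count ?V p" by (simp add: merging_count_def)
    qed
    also have "\<dots> = real (card ?F) * merging_count ?V p" by simp
    finally show ?thesis using F0 by (simp add: field_simps)
  qed
  then show ?thesis using c F0 by (intro exI[of _ "c / card ?F"] conjI exI[of _ "max n0 (2 * m)"]) auto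
qed

section \<open>Crossings of rectangles and duality\<close>

text \<open>The extra column makes the rectangle self-dual: its dual, after swapping the
  coordinates, has the same shape.\<close>

definition rect :: "int \<Rightarrow> vertex set" where
  "rect n = {v. - n \<le> fst v \<and> fst v \<le> n + 1 \<and> \<bar>snd v\<bar> \<le> n}"

definition crossing :: "int \<Rightarrow> edge set \<Rightarrow> bool" where
  "crossing n \<omega> \<longleftrightarrow> (\<exists>l\<in>rect n. \<exists>r\<in>rect n. fst l = - n \<and> fst r = n + 1 \<and> conn \<omega> l r)"

lemma finite_rect: "finite (rect n)"
proof (rule finite_subset)
  show "rect n \<subseteq> {-n..n+1} \<times> {-n..n}" by (auto simp: rect_def)
qed simp

text \<open>Lattice paths become continuous curves, to which planar topology applies. The
  alternative \<open>u = v\<close> is there because a path without steps covers no segment.\<close>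

lemma conn_polygonal_path:
  fixes emb :: "'a \<Rightarrow> 'b::real_normed_vector"
  assumes "conn \<omega> u v"
  shows "u = v \<or> (\<exists>f. path f \<and> pathstart f = emb u \<and> pathfinish f = emb v \<and>
    path_image f \<subseteq> (\<Union>(a, b)\<in>{(a, b). {a, b} \<in> \<omega>}. closed_segment (emb a) (emb b)))"
    (is "_ \<or> (\<exists>f. ?P f v)")
  using assms
proof (induction rule: conn_induct)
  case (step y z)
  let ?l = "linepath (emb y) (emb z)"
  have l: "path_image ?l \<subseteq> (\<Union>(a, b)\<in>{(a, b). {a, b} \<in> \<omega>}. closed_segment (emb a) (emb b))"
    using step.hyps by auto
  from step.IH show ?case
  proof
    assume "u = y"
    then have "?P ?l z" using l by simp
    then show ?case by blast
  next
    assume "\<exists>f. ?P f y"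
    then obtain f where f: "?P f y" by blast
    have "?P (f +++ ?l) z" using f l by (simp add: path_image_join)
    then show ?case by blast
  qed
qed simp

definition lattice_edge :: "bool \<times> int \<times> int \<Rightarrow> edge" where
  "lattice_edge = (\<lambda>(horiz, x, y). if horiz then {(x, y), (x + 1, y)} else {(x, y), (x, y + 1)})"

text \<open>The edges of \<open>rect n\<close> without the vertical edges of its left and right sides, and the
  bijection sending an edge to the one that crosses it in the dual rectangle, when the dual vertex
  \<open>(y + 1/2, x - 1/2)\<close> is called \<open>(x, y)\<close>.\<close>
definition rect_index :: "int \<Rightarrow> (bool \<times> int \<times> int) set" where
  "rect_index n = {True} \<times> {-n..n} \<times> {-n..n} \<union> {False} \<times> {-n+1..n} \<times> {-n..n-1}"

definition dual_index :: "bool \<times> int \<times> int \<Rightarrow> bool \<times> int \<times> int" where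
  "dual_index = (\<lambda>(horiz, x, y). if horiz then (True, y, x) else (False, y + 1, x - 1))"

lemma inj_lattice_edge: "inj lattice_edge"
  unfolding inj_def lattice_edge_def by (auto simp: doubleton_eq_iff split: if_splits)

lemma dual_index_bij: "dual_index ` rect_index n = rect_index n" "inj_on dual_index A"
proof -
  have inv: "dual_index (dual_index i) = i" for i
    by (cases i) (auto simp: dual_index_def)
  show "inj_on dual_index A" using inv by (metis inj_onI)
  have "dual_index i \<in> rect_index n" if "i \<in> rect_index n" for i
    using that by (auto simp: dual_index_def rect_index_def)
  then show "dual_index ` rect_index n = rect_index n" using inv by (metis image_eqI image_subsetI subsetI subset_antisym)
qed

lemma int_eq_of_real: "\<bar>real_of_int a - real_of_int b\<bar> < 1 \<Longrightarrow> a = b"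
  by linarith

lemma int_half: "real_of_int a \<noteq> real_of_int b - 1 / 2" "real_of_int a \<noteq> real_of_int b + 1 / 2"
proof -
  have "real_of_int (2 * b - 2 * a) \<noteq> real_of_int 1" by (subst of_int_eq_iff) presburger
  then show "real_of_int a \<noteq> real_of_int b - 1 / 2" by auto
  have "real_of_int (2 * a - 2 * b) \<noteq> real_of_int 1" by (subst of_int_eq_iff) presburger
  then show "real_of_int a \<noteq> real_of_int b + 1 / 2" by auto
qed

lemma closed_segment_real2:
  fixes a b z :: "real^2"
  assumes "z \<in> closed_segment a b"
  shows "min (a$1) (b$1) \<le> z$1" "z$1 \<le> max (a$1) (b$1)" "min (a$2) (b$2) \<le> z$2" "z$2 \<le> max (a$2) (b$2)"
proof -
  have "z $ i \<in> closed_segment (a $ i) (b $ i)" for i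
  proof -
    obtain u where "0 \<le> u" "u \<le> 1" "z = (1 - u) *\<^sub>R a + u *\<^sub>R b" using assms by (auto simp: in_segment)
    then show ?thesis by (auto simp: in_segment)
  qed
  from this[of 1] this[of 2]
  show "min (a$1) (b$1) \<le> z$1" "z$1 \<le> max (a$1) (b$1)" "min (a$2) (b$2) \<le> z$2" "z$2 \<le> max (a$2) (b$2)"
    by (auto simp: closed_segment_eq_real_ivl split: if_splits)
qed

text \<open>The embedding \<open>e2\<close> swaps the coordinates and shifts by half units, so the
  dual crossing runs from the bottom to the top of a box which the primal one traverses from left to
  right. By \<open>fashoda\<close> the curves meet, and a common point forces the two edges through
  it to be dual to each other, whereas the second configuration contains only duals of edges outside
  \<eta>.\<close>

theorem crossing_dual_disjoint:
  assumes "0 \<le> n" "\<eta> \<subseteq> rect_index n"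
    and c1: "crossing n (lattice_edge ` \<eta>)" and c2: "crossing n (lattice_edge ` (rect_index n - dual_index ` \<eta>))"
  shows False
proof -
  define e1 :: "vertex \<Rightarrow> real^2" where "e1 v = vector [real_of_int (fst v), real_of_int (snd v)]" for v
  define e2 :: "vertex \<Rightarrow> real^2" where "e2 v = vector [real_of_int (snd v) + 1/2, real_of_int (fst v) - 1/2]" for v
  define a b :: "real^2" where "a = vector [- real_of_int n, - real_of_int n - 1/2]"
    and "b = vector [real_of_int n + 1, real_of_int n + 1/2]"
  define \<eta>' where "\<eta>' = rect_index n - dual_index ` \<eta>"
  have seg1: "\<exists>k x y. (k, x, y) \<in> \<eta> \<and> (if k then x \<le> z$1 \<and> z$1 \<le> real_of_int x + 1 \<and> z$2 = y else z$1 = x \<and> y \<le> z$2 \<and> z$2 \<le> real_of_int y + 1)"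
    if "z \<in> (\<Union>(a, b)\<in>{(a, b). {a, b} \<in> lattice_edge ` \<eta>}. closed_segment (e1 a) (e1 b))" for z
  proof -
    from that obtain u v i where uv: "z \<in> closed_segment (e1 u) (e1 v)" "{u, v} = lattice_edge i" "i \<in> \<eta>" by auto
    obtain k x y where i: "i = (k, x, y)" by (cases i) auto
    have "u = (x, y) \<and> v = (if k then (x + 1, y) else (x, y + 1)) \<or> v = (x, y) \<and> u = (if k then (x + 1, y) else (x, y + 1))"
      using uv(2) unfolding i lattice_edge_def by (auto simp: doubleton_eq_iff split: if_splits)
    then have "if k then x \<le> z$1 \<and> z$1 \<le> real_of_int x + 1 \<and> z$2 = y else z$1 = x \<and> y \<le> z$2 \<and> z$2 \<le> real_of_int y + 1"
      using closed_segment_real2[OF uv(1)] by (auto simp: e1_def split: if_splits)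
    then show ?thesis using uv(3) i by blast
  qed
  have seg2: "\<exists>k x y. (k, x, y) \<in> \<eta>' \<and> (if k then z$1 = y + 1/2 \<and> x - 1/2 \<le> z$2 \<and> z$2 \<le> x + 1/2
       else y + 1/2 \<le> z$1 \<and> z$1 \<le> y + 3/2 \<and> z$2 = x - 1/2)"
    if "z \<in> (\<Union>(a, b)\<in>{(a, b). {a, b} \<in> lattice_edge ` \<eta>'}. closed_segment (e2 a) (e2 b))" for z
  proof -
    from that obtain u v i where uv: "z \<in> closed_segment (e2 u) (e2 v)" "{u, v} = lattice_edge i" "i \<in> \<eta>'" by auto
    obtain k x y where i: "i = (k, x, y)" by (cases i) auto
    have "u = (x, y) \<and> v = (if k then (x + 1, y) else (x, y + 1)) \<or> v = (x, y) \<and> u = (if k then (x + 1, y) else (x, y + 1))"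
      using uv(2) unfolding i lattice_edge_def by (auto simp: doubleton_eq_iff split: if_splits)
    then have "if k then z$1 = y + 1/2 \<and> x - 1/2 \<le> z$2 \<and> z$2 \<le> x + 1/2
       else y + 1/2 \<le> z$1 \<and> z$1 \<le> y + 3/2 \<and> z$2 = x - 1/2"
      using closed_segment_real2[OF uv(1)] by (auto simp: e2_def split: if_splits)
    then show ?thesis using uv(3) i by blast
  qed
  obtain l r where lr: "fst l = - n" "fst r = n + 1" "conn (lattice_edge ` \<eta>) l r"
    using c1 by (auto simp: crossing_def)
  obtain l' r' where lr': "fst l' = - n" "fst r' = n + 1" "conn (lattice_edge ` \<eta>') l' r'"
    using c2 by (auto simp: crossing_def \<eta>'_def)
  have "l \<noteq> r" "l' \<noteq> r'" using lr lr' assms(1) by auto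
  then obtain f g where f: "path f" "pathstart f = e1 l" "pathfinish f = e1 r"
      "path_image f \<subseteq> (\<Union>(a, b)\<in>{(a, b). {a, b} \<in> lattice_edge ` \<eta>}. closed_segment (e1 a) (e1 b))"
    and g: "path g" "pathstart g = e2 l'" "pathfinish g = e2 r'"
      "path_image g \<subseteq> (\<Union>(a, b)\<in>{(a, b). {a, b} \<in> lattice_edge ` \<eta>'}. closed_segment (e2 a) (e2 b))"
    using conn_polygonal_path[OF lr(3), of e1] conn_polygonal_path[OF lr'(3), of e2] by blast
  have "path_image f \<subseteq> cbox a b"
  proof
    fix z assume "z \<in> path_image f"
    then obtain k x y where kxy: "(k, x, y) \<in> \<eta>" "if k then x \<le> z$1 \<and> z$1 \<le> real_of_int x + 1 \<and> z$2 = y else z$1 = x \<and> y \<le> z$2 \<and> z$2 \<le> real_of_int y + 1"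
      using seg1[of z] f(4) by blast
    then have "(k, x, y) \<in> rect_index n" using assms(2) by blast
    then show "z \<in> cbox a b" using kxy(2)
      by (cases k) (auto simp: rect_index_def mem_box_cart forall_2 a_def b_def)
  qed
  moreover have "path_image g \<subseteq> cbox a b"
  proof
    fix z assume "z \<in> path_image g"
    then obtain k x y where kxy: "(k, x, y) \<in> \<eta>'" "if k then z$1 = y + 1/2 \<and> x - 1/2 \<le> z$2 \<and> z$2 \<le> x + 1/2
       else y + 1/2 \<le> z$1 \<and> z$1 \<le> y + 3/2 \<and> z$2 = x - 1/2"
      using seg2[of z] g(4) by blast
    then have "(k, x, y) \<in> rect_index n" by (simp add: \<eta>'_def)
    then show "z \<in> cbox a b" using kxy(2)
      by (cases k) (auto simp: rect_index_def mem_box_cart forall_2 a_def b_def)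
  qed
  moreover have "pathstart f $ 1 = a $ 1" "pathfinish f $ 1 = b $ 1" "pathstart g $ 2 = a $ 2" "pathfinish g $ 2 = b $ 2"
    using f g lr lr' by (simp_all add: e1_def e2_def a_def b_def)
  ultimately obtain z where z: "z \<in> path_image f" "z \<in> path_image g"
    using fashoda[OF f(1) g(1)] by metis
  obtain k x y where 1: "(k, x, y) \<in> \<eta>" "if k then x \<le> z$1 \<and> z$1 \<le> real_of_int x + 1 \<and> z$2 = y else z$1 = x \<and> y \<le> z$2 \<and> z$2 \<le> real_of_int y + 1"
    using seg1[of z] f(4) z by blast
  obtain k' X Y where 2: "(k', X, Y) \<in> \<eta>'" "if k' then z$1 = Y + 1/2 \<and> X - 1/2 \<le> z$2 \<and> z$2 \<le> X + 1/2
       else Y + 1/2 \<le> z$1 \<and> z$1 \<le> Y + 3/2 \<and> z$2 = X - 1/2"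
    using seg2[of z] g(4) z by blast
  \<comment> \<open>If the two drawn edges are parallel, an integer would equal a half-integer. If
    they are perpendicular, the relevant integers differ by less than 1 and hence agree.\<close>
  have "(k', X, Y) = dual_index (k, x, y)"
  proof (cases k; cases k')
    assume k: k k'
    have "y = X" "x = Y" using 1(2) 2(2) k by (auto intro!: int_eq_of_real)
    then show ?thesis using k by (simp add: dual_index_def)
  next
    assume k: k "\<not> k'"
    then show ?thesis using 1(2) 2(2) int_half(1)[of y X] by simp
  next
    assume k: "\<not> k" k'
    then show ?thesis using 1(2) 2(2) int_half(2)[of x Y] by simp
  next
    assume k: "\<not> k" "\<not> k'"
    have "Y = x - 1" "X = y + 1" using 1(2) 2(2) k by (auto intro!: int_eq_of_real)
    then show ?thesis using k by (simp add: dual_index_def)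
  qed
  then show False using 1(1) 2(1) by (simp add: \<eta>'_def)
qed

lemma lattice_edge_rect_index: "lattice_edge ` rect_index n \<subseteq> edges_in (rect n)"
  by (auto simp: lattice_edge_def rect_index_def edges_in_iff rect_def adjacent_def split: if_splits)

lemma rect_side_edges:
  assumes "{u, v} \<in> edges_in (rect n)" "{u, v} \<notin> lattice_edge ` rect_index n"
  shows "fst u = fst v \<and> (fst u = - n \<or> fst u = n + 1)"
proof (rule ccontr)
  assume neg: "\<not> ?thesis"
  obtain a b c d where uv: "u = (a, b)" "v = (c, d)" by fastforce
  have r: "- n \<le> a" "a \<le> n + 1" "\<bar>b\<bar> \<le> n" "- n \<le> c" "c \<le> n + 1" "\<bar>d\<bar> \<le> n"
    and adj: "adjacent u v"
    using assms(1) by (auto simp: edges_in_iff rect_def uv)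
  from adj consider "c = a + 1" "d = b" | "a = c + 1" "d = b" | "c = a" "d = b + 1" | "c = a" "b = d + 1"
    by (auto simp: adjacent_neighbours uv)
  then have "\<exists>i\<in>rect_index n. {u, v} = lattice_edge i"
  proof cases
    case 1
    then show ?thesis using r by (intro bexI[of _ "(True, a, b)"]) (auto simp: lattice_edge_def rect_index_def uv)
  next
    case 2
    then show ?thesis using r by (intro bexI[of _ "(True, c, b)"]) (auto simp: lattice_edge_def rect_index_def uv)
  next
    case 3
    then show ?thesis using r neg by (intro bexI[of _ "(False, a, b)"]) (auto simp: lattice_edge_def rect_index_def uv)
  next
    case 4
    then show ?thesis using r neg by (intro bexI[of _ "(False, a, d)"]) (auto simp: lattice_edge_def rect_index_def uv)
  qed
  then show False using assms(2) by blast
qed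

text \<open>Vertical edges on the two sides can be dispensed with: after such a step on the left
  side the crossing restarts there, and on the right side it is already complete.\<close>

lemma crossing_inner_edges:
  assumes "crossing n \<omega>" "\<omega> \<subseteq> edges_in (rect n)"
  shows "crossing n (\<omega> \<inter> lattice_edge ` rect_index n)"
proof (rule ccontr)
  let ?\<omega> = "\<omega> \<inter> lattice_edge ` rect_index n"
  assume neg: "\<not> crossing n ?\<omega>"
  obtain l r where lr: "l \<in> rect n" "r \<in> rect n" "fst l = - n" "fst r = n + 1" "conn \<omega> l r"
    using assms(1) unfolding crossing_def by blast
  have "\<exists>l'\<in>rect n. fst l' = - n \<and> conn ?\<omega> l' r" using lr(5)
  proof (induction rule: conn_induct)
    case refl
    then show ?case using lr conn_refl[of ?\<omega> l] by blast
  next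
    case (step y z)
    from step.IH obtain l' where l': "l' \<in> rect n" "fst l' = - n" "conn ?\<omega> l' y" by blast
    have yz: "{y, z} \<in> edges_in (rect n)" using step.hyps assms(2) by blast
    then have rect: "y \<in> rect n" "z \<in> rect n" by (simp_all add: edges_in_iff)
    show ?case
    proof (cases "{y, z} \<in> lattice_edge ` rect_index n")
      case True
      then have "{y, z} \<in> ?\<omega>" using step.hyps by simp
      then have "conn ?\<omega> l' z" by (rule conn_step[OF l'(3)])
      then show ?thesis using l' by blast
    next
      case False
      from rect_side_edges[OF yz this] have "fst y = fst z" "fst y = - n \<or> fst y = n + 1" by auto
      moreover have "fst y \<noteq> n + 1" using neg l' rect unfolding crossing_def by blast
      ultimately show ?thesis using rect conn_refl[of ?\<omega> z] by metis
    qed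
  qed
  then show False using neg lr unfolding crossing_def by blast
qed

text \<open>At density 1/2 both complementation and the dual reindexing preserve the law, so a
  crossing and a dual crossing are equally likely. As they exclude each other, each has probability
  at most 1/2.\<close>

theorem crossing_le_half:
  assumes "0 \<le> n" "0 \<le> p" "p \<le> 1 / 2"
  shows "pr (edges_in (rect n)) (\<lambda>_. p) (crossing n) \<le> 1 / 2"
proof -
  let ?E = "edges_in (rect n)" and ?I = "rect_index n"
  let ?A = "\<lambda>\<eta>. crossing n (lattice_edge ` \<eta>)" and ?A' = "\<lambda>\<eta>. crossing n (lattice_edge ` (rect_index n - dual_index ` \<eta>))"
  have finE: "finite ?E" by (intro finite_edges_in finite_rect)
  have finI: "finite ?I" by (simp add: rect_index_def)
  have mono: "crossing n \<eta>" if "crossing n \<omega>" "\<omega> \<subseteq> \<eta>" for \<omega> \<eta>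
    using that unfolding crossing_def by (meson conn_mono)
  have "pr ?E (\<lambda>_. p) (crossing n) \<le> pr ?E (\<lambda>_. 1/2) (crossing n)"
    using assms finE mono by (intro pr_mono_param) auto
  also have "\<dots> \<le> pr ?E (\<lambda>_. 1/2) (\<lambda>\<omega>. crossing n (\<omega> \<inter> lattice_edge ` ?I))"
    by (intro pr_mono crossing_inner_edges) auto
  also have "\<dots> = pr (lattice_edge ` ?I) (\<lambda>_. 1/2) (crossing n)"
    using finE lattice_edge_rect_index by (intro pr_restrict) auto
  also have "\<dots> = pr ?I (\<lambda>_. 1/2) ?A"
    unfolding pr_def using finI by (intro expect_image inj_on_subset[OF inj_lattice_edge]) auto
  finally have 1: "pr ?E (\<lambda>_. p) (crossing n) \<le> pr ?I (\<lambda>_. 1/2) ?A" .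
  have "pr ?I (\<lambda>_. 1/2) ?A = pr ?I (\<lambda>_. 1/2) (\<lambda>\<eta>. ?A (?I - \<eta>))"
    unfolding pr_def using expect_complement[OF finI, of "\<lambda>_. 1/2"] by simp
  also have "\<dots> = pr (dual_index ` ?I) (\<lambda>_. 1/2) (\<lambda>\<eta>. ?A (?I - \<eta>))"
    by (simp add: dual_index_bij)
  also have "\<dots> = pr ?I (\<lambda>_. 1/2) ?A'"
    unfolding pr_def using finI dual_index_bij by (intro expect_image) auto
  finally have 2: "pr ?I (\<lambda>_. 1/2) ?A = pr ?I (\<lambda>_. 1/2) ?A'" .
  have "pr ?I (\<lambda>_. 1/2) ?A' \<le> pr ?I (\<lambda>_. 1/2) (\<lambda>\<eta>. \<not> ?A \<eta>)"
    using crossing_dual_disjoint[OF assms(1)] by (intro pr_mono) auto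
  also have "\<dots> = 1 - pr ?I (\<lambda>_. 1/2) ?A" using finI by (rule pr_not)
  finally show ?thesis using 1 2 by linarith
qed

section \<open>No percolation below one half\<close>

text \<open>Locality of \<open>A i\<close> is stated for every \<open>D\<close> containing
  \<open>F i\<close>, so that it can be used with a union of the \<open>F i\<close> in the
  induction.\<close>

lemma pr_indep_all:
  fixes k :: nat
  assumes "finite E" "\<And>i j. i < k \<Longrightarrow> j < k \<Longrightarrow> i \<noteq> j \<Longrightarrow> F i \<inter> F j = {}"
    and "\<And>i \<omega> D. i < k \<Longrightarrow> F i \<subseteq> D \<Longrightarrow> A i (\<omega> \<inter> D) \<longleftrightarrow> A i \<omega>"
  shows "pr E p (\<lambda>\<omega>. \<forall>i<k. A i \<omega>) = (\<Prod>i<k. pr E p (A i))"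
  using assms(2,3)
proof (induction k)
  case 0
  show ?case using assms(1) by (simp add: pr_def expect_const)
next
  case (Suc k)
  have "pr E p (\<lambda>\<omega>. \<forall>i<Suc k. A i \<omega>) = pr E p (\<lambda>\<omega>. (\<forall>i<k. A i \<omega>) \<and> A k \<omega>)"
    by (intro pr_cong) (auto simp: less_Suc_eq)
  also have "\<dots> = pr E p (\<lambda>\<omega>. \<forall>i<k. A i \<omega>) * pr E p (A k)"
  proof (rule pr_indep[OF assms(1)])
    have "F i \<inter> F k = {}" if "i < k" for i using Suc.prems(1)[of i k] that by simp
    then show "(\<Union>i<k. F i) \<inter> F k = {}" by blast
    show "(\<forall>i<k. A i \<omega>) \<longleftrightarrow> (\<forall>i<k. A i (\<omega> \<inter> (\<Union>i<k. F i)))" for \<omega>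
    proof -
      have "A i (\<omega> \<inter> (\<Union>i<k. F i)) \<longleftrightarrow> A i \<omega>" if "i < k" for i
        by (rule Suc.prems(2)) (use that in auto)
      then show ?thesis by blast
    qed
    show "A k \<omega> \<longleftrightarrow> A k (\<omega> \<inter> F k)" for \<omega>
      using Suc.prems(2)[of k "F k" \<omega>] by auto
  qed
  also have "pr E p (\<lambda>\<omega>. \<forall>i<k. A i \<omega>) = (\<Prod>i<k. pr E p (A i))"
    using Suc.prems by (intro Suc.IH) auto
  finally show ?case by simp
qed

text \<open>The minus signs turn the decreasing indicators of the complements into increasing
  functions, and they cancel in the product.\<close>

lemma harris_decreasing:
  assumes "finite E" "\<And>e. e \<in> E \<Longrightarrow> 0 \<le> p e \<and> p e \<le> 1"
    and A: "\<And>\<omega> \<eta>. A \<omega> \<Longrightarrow> \<omega> \<subseteq> \<eta> \<Longrightarrow> A \<eta>" and B: "\<And>\<omega> \<eta>. B \<omega> \<Longrightarrow> \<omega> \<subseteq> \<eta> \<Longrightarrow> B \<eta>"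
  shows "(1 - pr E p A) * (1 - pr E p B) \<le> 1 - pr E p (\<lambda>\<omega>. A \<omega> \<or> B \<omega>)"
proof -
  have "expect E p (\<lambda>\<omega>. - of_bool (\<not> A \<omega>)) * expect E p (\<lambda>\<omega>. - of_bool (\<not> B \<omega>))
      \<le> expect E p (\<lambda>\<omega>. - of_bool (\<not> A \<omega>) * - of_bool (\<not> B \<omega>))"
    using assms(1,2) by (intro harris_inequality) (auto dest: A B)
  also have "\<dots> = pr E p (\<lambda>\<omega>. \<not> (A \<omega> \<or> B \<omega>))"
    unfolding pr_def by (intro expect_cong) auto
  also have "\<dots> = 1 - pr E p (\<lambda>\<omega>. A \<omega> \<or> B \<omega>)" by (rule pr_not[OF assms(1)])
  finally show ?thesis
    using pr_not[OF assms(1), of p A] pr_not[OF assms(1), of p B] by (simp add: expect_uminus pr_def)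
qed

lemma pr_arm_ge_theta:
  assumes "finite V" "V \<subseteq> (+) y ` sq n" "y \<in> V" "0 \<le> p" "p \<le> 1"
  shows "theta n p \<le> pr (edges_in V) (\<lambda>_. p) (arm V y)"
proof -
  let ?W = "(+) y ` sq n"
  have "theta n p = pr (edges_in ?W) (\<lambda>_. p) (arm ?W y)"
    by (rule pr_arm_shift[symmetric]) (simp_all add: finite_sq)
  also have "\<dots> \<le> pr (edges_in ?W) (\<lambda>_. p) (arm V y)"
    using assms by (intro pr_mono) (auto intro: arm_subset)
  also have "\<dots> = pr (edges_in V) (\<lambda>_. p) (arm V y)"
    using assms by (intro pr_restrict finite_edges_in edges_in_mono) (auto simp: finite_sq arm_Int)
  finally show ?thesis .
qed

lemma theta_decseq:
  assumes "0 \<le> p" "p \<le> 1" "0 \<le> m" "m \<le> n"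
  shows "theta n p \<le> theta m p"
  using pr_arm_le_theta[OF finite_sq shift_sq_subset[of 0 0 m n], of p] assms
  by (simp add: theta_def)

text \<open>If \<open>theta\<close> stays away from zero, then among many distant points at least one has an arm of
  length \<open>L\<close>, and for \<open>L\<close> large such an arm is unlikely to stop before reaching
  any given larger distance.\<close>
lemma box_escape:
  assumes p: "0 \<le> p" "p \<le> 1" and c: "0 < c" "\<And>n::nat. c \<le> theta (int n) p" and \<delta>: "0 < \<delta>"
  shows "\<exists>m::nat. \<forall>n\<ge>m. 1 - \<delta> \<le> pr (edges_in (sq (int n))) (\<lambda>_. p) (\<lambda>\<omega>. \<exists>v\<in>sq (int m). arm (sq (int n)) v \<omega>)"
proof -
  obtain K where K: "(1 - c) ^ K < \<delta> / 2"
    using real_arch_pow_inv[of "\<delta> / 2" "1 - c"] c(1) \<delta> by auto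
  have dec: "decseq (\<lambda>n. theta (int n) p)"
    using p by (auto simp: decseq_def intro: theta_decseq)
  obtain \<theta> where \<theta>: "(\<lambda>n. theta (int n) p) \<longlonglongrightarrow> \<theta>" "\<And>n. \<theta> \<le> theta (int n) p"
    using decseq_convergent[OF dec, of 0] theta_bounds p by blast
  \<comment> \<open>At most \<open>K\<close> arms of length \<open>L\<close> can be lost, each with
    at most this probability, for a total of at most \<open>\<delta> / 2\<close>. The
    \<open>+ 1\<close> covers \<open>K = 0\<close>.\<close>
  have "\<delta> / (2 * (real K + 1)) > 0" using \<delta> by simp
  then have "eventually (\<lambda>n. theta (int n) p < \<theta> + \<delta> / (2 * (real K + 1))) sequentially"
    by (intro order_tendstoD(2)[OF \<theta>(1)]) simp
  then obtain L where L: "theta (int L) p < \<theta> + \<delta> / (2 * (real K + 1))"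
    by (auto simp: eventually_sequentially)
  \<comment> \<open>With spacing \<open>2 * L + 1\<close> the squares of radius \<open>L\<close>
    around the points \<open>x i\<close> are disjoint, and \<open>sq m\<close> contains all those
    with \<open>i < K\<close>.\<close>
  define m where "m = (2 * L + 1) * K"
  define x :: "nat \<Rightarrow> vertex" where "x i = (int (i * (2 * L + 1)), 0)" for i
  define W where "W i = (+) (x i) ` sq (int L)" for i
  have xm: "i * (2 * L + 1) + 2 * L + 1 \<le> m" if "i < K" for i
  proof -
    have "(i + 1) * (2 * L + 1) \<le> K * (2 * L + 1)" using that by (intro mult_right_mono) auto
    then show ?thesis by (simp add: m_def algebra_simps)
  qed
  have x_sq: "x i \<in> sq (int m - int L)" if "i < K" for i
  proof -
    have "int (i * (2 * L + 1)) \<le> int m - int L" using xm[OF that] by linarith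
    then show ?thesis using xm[OF that] by (simp add: x_def sq_def)
  qed
  have xW: "x i \<in> W i" for i
    using imageI[of 0 "sq (int L)" "(+) (x i)"] by (simp add: W_def)
  have W_disj: "edges_in (W i) \<inter> edges_in (W j) = {}" if "i \<noteq> j" for i j
  proof -
    have "W i \<inter> W j = {}" if "i < j" for i j
    proof -
      have "(i + 1) * (2 * L + 1) \<le> j * (2 * L + 1)" using that by (intro mult_right_mono) auto
      then have "int (i * (2 * L + 1)) + 2 * int L + 1 \<le> int (j * (2 * L + 1))"
        by (simp add: algebra_simps flip: of_nat_mult of_nat_add)
      then show ?thesis by (auto simp: W_def x_def sq_def)
    qed
    then have "W i \<inter> W j = {}" using \<open>i \<noteq> j\<close> by (metis inf_commute linorder_neqE_nat)
    then show ?thesis by (auto simp: edges_in_def edges_def)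
  qed
  show ?thesis
  proof (intro exI[of _ m] allI impI)
    fix n assume n: "m \<le> n"
    let ?V = "sq (int n)"
    let ?P = "pr (edges_in ?V) (\<lambda>_. p)"
    have finV: "finite (edges_in ?V)" by (intro finite_edges_in finite_sq)
    have WV: "W i \<subseteq> ?V" if "i < K" for i
      unfolding W_def using n by (intro shift_sq_subset[OF x_sq[OF that]]) simp
    have PW: "?P (arm (W i) (x i)) = theta (int L) p" if "i < K" for i
      unfolding W_def using WV[OF that] by (intro pr_arm_shift finite_sq) (simp add: W_def)
    have no_arm: "?P (\<lambda>\<omega>. \<forall>i<K. \<not> arm (W i) (x i) \<omega>) \<le> \<delta> / 2"
    proof -
      have "?P (\<lambda>\<omega>. \<forall>i<K. \<not> arm (W i) (x i) \<omega>) = (\<Prod>i<K. ?P (\<lambda>\<omega>. \<not> arm (W i) (x i) \<omega>))"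
        using finV W_disj by (intro pr_indep_all[where F = "\<lambda>i. edges_in (W i)"]) (auto simp: arm_Int)
      also have "\<dots> = (1 - theta (int L) p) ^ K"
        using PW finV by (simp add: pr_not)
      also have "\<dots> \<le> (1 - c) ^ K"
        using c(2)[of L] theta_bounds p by (intro power_mono) auto
      finally show ?thesis using K by linarith
    qed
    have lost: "?P (\<lambda>\<omega>. arm (W i) (x i) \<omega> \<and> \<not> arm ?V (x i) \<omega>) \<le> \<delta> / (2 * (real K + 1))" if i: "i < K" for i
    proof -
      have xV: "x i \<in> ?V" using xW WV[OF i] by auto
      have "?P (arm (W i) (x i)) = ?P (\<lambda>\<omega>. arm (W i) (x i) \<omega> \<and> \<not> arm ?V (x i) \<omega>) + ?P (arm ?V (x i))"
        unfolding pr_def expect_add[symmetric]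
        using arm_subset[OF _ WV[OF i] xW] by (intro expect_cong) auto
      moreover have "\<theta> \<le> ?P (arm ?V (x i))"
      proof -
        \<comment> \<open>The square of radius \<open>2 * n\<close> around \<open>x i\<close>
          contains \<open>?V\<close>, so an arm to its boundary passes through
          \<open>bdry ?V\<close>.\<close>
        have "?V \<subseteq> (+) (x i) ` sq (int (2 * n))"
        proof
          fix v assume v: "v \<in> ?V"
          have "v = x i + (v - x i)" by simp
          moreover have "v - x i \<in> sq (int (2 * n))" using v xV by (auto simp: sq_def)
          ultimately show "v \<in> (+) (x i) ` sq (int (2 * n))" by (rule image_eqI)
        qed
        then have "theta (int (2 * n)) p \<le> ?P (arm ?V (x i))"
          using p xV by (intro pr_arm_ge_theta finite_sq) auto
        then show ?thesis using \<theta>(2)[of "2 * n"] by linarith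
      qed
      ultimately show ?thesis using PW[OF i] L by linarith
    qed
    have "?P (\<lambda>\<omega>. \<not> (\<exists>v\<in>sq (int m). arm ?V v \<omega>))
      \<le> ?P (\<lambda>\<omega>. (\<forall>i<K. \<not> arm (W i) (x i) \<omega>) \<or> (\<exists>i\<in>{..<K}. arm (W i) (x i) \<omega> \<and> \<not> arm ?V (x i) \<omega>))"
    proof (rule pr_mono)
      fix \<omega> assume none: "\<not> (\<exists>v\<in>sq (int m). arm ?V v \<omega>)"
      have "x i \<in> sq (int m)" if "i < K" for i using x_sq[OF that] by (auto simp: sq_def)
      then show "(\<forall>i<K. \<not> arm (W i) (x i) \<omega>) \<or> (\<exists>i\<in>{..<K}. arm (W i) (x i) \<omega> \<and> \<not> arm ?V (x i) \<omega>)"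
        using none by blast
    qed (use p in auto)
    also have "\<dots> \<le> ?P (\<lambda>\<omega>. \<forall>i<K. \<not> arm (W i) (x i) \<omega>)
        + ?P (\<lambda>\<omega>. \<exists>i\<in>{..<K}. arm (W i) (x i) \<omega> \<and> \<not> arm ?V (x i) \<omega>)"
      using p by (intro pr_disj_le) auto
    also have "?P (\<lambda>\<omega>. \<exists>i\<in>{..<K}. arm (W i) (x i) \<omega> \<and> \<not> arm ?V (x i) \<omega>)
        \<le> (\<Sum>i\<in>{..<K}. ?P (\<lambda>\<omega>. arm (W i) (x i) \<omega> \<and> \<not> arm ?V (x i) \<omega>))"
      using p by (intro pr_Ex_le_sum) auto
    also have "\<dots> \<le> (\<Sum>i\<in>{..<K}. \<delta> / (2 * (real K + 1)))"
      using lost by (intro sum_mono) auto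
    also have "\<dots> \<le> \<delta> / 2" using \<delta> by (simp add: field_simps)
    finally have "?P (\<lambda>\<omega>. \<not> (\<exists>v\<in>sq (int m). arm ?V v \<omega>)) \<le> \<delta>" using no_arm by simp
    then show "1 - \<delta> \<le> ?P (\<lambda>\<omega>. \<exists>v\<in>sq (int m). arm ?V v \<omega>)"
      using pr_not[OF finV, of "\<lambda>_. p" "\<lambda>\<omega>. \<exists>v\<in>sq (int m). arm ?V v \<omega>"] by linarith
  qed
qed

section \<open>Reaching the sides of a square\<close>

definition hits :: "int \<Rightarrow> int \<Rightarrow> vertex set \<Rightarrow> edge set \<Rightarrow> bool" where
  "hits m n D \<omega> \<longleftrightarrow> (\<exists>v\<in>sq m. \<exists>d\<in>D. conn (\<omega> \<inter> edges_in (sq n)) v d)"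

lemma hits_mono: "hits m n D \<omega> \<Longrightarrow> \<omega> \<subseteq> \<eta> \<Longrightarrow> hits m n D \<eta>"
  unfolding hits_def by (meson Int_mono conn_mono order_refl)

lemma pr_hits_aut:
  assumes g: "lattice_aut g" "g ` sq m = sq m" "g ` sq n = sq n"
  shows "pr (edges_in (sq n)) (\<lambda>_. p) (hits m n (g ` D)) = pr (edges_in (sq n)) (\<lambda>_. p) (hits m n D)"
proof -
  have inj: "inj g" using g by (auto simp: lattice_aut_def bij_def)
  have "hits m n (g ` D) ((`) g ` \<omega>) \<longleftrightarrow> hits m n D \<omega>" for \<omega>
  proof -
    have "(`) g ` \<omega> \<inter> edges_in (sq n) = (`) g ` (\<omega> \<inter> edges_in (sq n))"
      using inj_image_sets[OF inj, of UNIV] g(3) edges_in_image[OF g(1), of "sq n"] by (simp add: image_Int)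
    moreover have "(\<exists>v\<in>sq m. \<exists>d\<in>g ` D. Q v d) \<longleftrightarrow> (\<exists>v\<in>sq m. \<exists>d\<in>D. Q (g v) (g d))" for Q
      using g(2) by (metis (no_types, lifting) image_iff)
    ultimately show ?thesis by (simp add: hits_def conn_image_iff[OF inj])
  qed
  then show ?thesis
    using pr_lattice_aut[OF g(1) finite_sq, of n p "hits m n (g ` D)"] g(3) by simp
qed

definition side :: "int \<Rightarrow> vertex set" where
  "side n = {v \<in> sq n. fst v = n}"

lemma image_Collect_inverse:
  assumes "\<And>v. g (h v) = v" "\<And>v. h (g v) = v"
  shows "g ` {v. P v} = {v. P (h v)}"
proof (intro set_eqI iffI)
  fix x assume "x \<in> {v. P (h v)}"
  then show "x \<in> g ` {v. P v}" using assms by (intro image_eqI[of _ g "h x"]) auto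
qed (use assms in auto)

lemma sides_of_square:
  fixes n :: int
  defines "S \<equiv> side n"
  shows "bdry (sq n) = (S \<union> (\<lambda>v. (- fst v, snd v)) ` S) \<union> ((\<lambda>v. (snd v, fst v)) ` S \<union> (\<lambda>v. (snd v, - fst v)) ` S)"
proof -
  have 1: "(\<lambda>v. (- fst v, snd v)) ` S = {v \<in> sq n. fst v = - n}"
    unfolding S_def side_def
    by (subst image_Collect_inverse[where h = "\<lambda>v. (- fst v, snd v)"]) (auto simp: sq_def)
  have 2: "(\<lambda>v. (snd v, fst v)) ` S = {v \<in> sq n. snd v = n}"
    unfolding S_def side_def
    by (subst image_Collect_inverse[where h = "\<lambda>v. (snd v, fst v)"]) (auto simp: sq_def)
  have 3: "(\<lambda>v. (snd v, - fst v)) ` S = {v \<in> sq n. snd v = - n}"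
    unfolding S_def side_def
    by (subst image_Collect_inverse[where h = "\<lambda>v. (- snd v, fst v)"]) (auto simp: sq_def)
  show ?thesis unfolding 1 2 3 unfolding bdry_sq S_def side_def by (auto simp: sq_def)
qed

lemma square_symmetries:
  assumes "g \<in> {\<lambda>v. (- fst v, snd v), \<lambda>v. (snd v, fst v), \<lambda>v. (snd v, - fst v)}"
  shows "lattice_aut g" "g ` sq n = sq n"
proof -
  obtain h where h: "\<And>v. g (h v) = v" "\<And>v. h (g v) = v" "\<And>v. g v \<in> sq n \<longleftrightarrow> v \<in> sq n"
  proof (cases "g = (\<lambda>v. (snd v, - fst v))")
    case True
    then show ?thesis by (intro that[of "\<lambda>v. (- snd v, fst v)"]) (auto simp: sq_def)
  next
    case False
    then show ?thesis using assms by (intro that[of g]) (auto simp: sq_def)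
  qed
  have "bij g" using h(1,2) by (metis bijI')
  moreover have "adjacent (g u) (g v) \<longleftrightarrow> adjacent u v" for u v
    using assms by (elim insertE) (auto simp: adjacent_def)
  ultimately show "lattice_aut g" by (simp add: lattice_aut_def)
  show "g ` sq n = sq n"
  proof (intro equalityI subsetI)
    fix v assume "v \<in> sq n"
    then have "h v \<in> sq n" using h(1) h(3)[of "h v"] by simp
    then show "v \<in> g ` sq n" using h(1) by (metis image_eqI)
  qed (use h(3) in auto)
qed

text \<open>By the Harris inequality, escaping through none of the four sides is at least as likely as if the
  sides were independent, and by symmetry they are equally likely to be reached.\<close>
lemma side_escape:
  assumes p: "0 \<le> p" "p \<le> 1" and c: "0 < c" "\<And>n::nat. c \<le> theta (int n) p" and \<delta>: "0 < \<delta>"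
  shows "\<exists>m::nat. \<forall>n\<ge>m. 1 - \<delta> \<le> pr (edges_in (sq (int n))) (\<lambda>_. p) (hits (int m) (int n) (side (int n))) \<and>
    1 - \<delta> \<le> pr (edges_in (sq (int n))) (\<lambda>_. p) (hits (int m) (int n) ((\<lambda>v. (- fst v, snd v)) ` side (int n)))"
proof -
  obtain m :: nat where m: "\<And>n. n \<ge> m \<Longrightarrow> 1 - \<delta> ^ 4 \<le>
      pr (edges_in (sq (int n))) (\<lambda>_. p) (\<lambda>\<omega>. \<exists>v\<in>sq (int m). arm (sq (int n)) v \<omega>)"
    using box_escape[OF p c, of "\<delta> ^ 4"] \<delta> by auto
  show ?thesis
  proof (intro exI[of _ m] allI impI)
    fix n assume n: "m \<le> n"
    let ?V = "sq (int n)" and ?S = "side (int n)"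
    let ?P = "pr (edges_in ?V) (\<lambda>_. p)" and ?H = "hits (int m) (int n)"
    let ?g1 = "\<lambda>v :: vertex. (- fst v, snd v)" and ?g2 = "\<lambda>v :: vertex. (snd v, fst v)"
      and ?g3 = "\<lambda>v :: vertex. (snd v, - fst v)"
    define h where "h = ?P (?H ?S)"
    have finV: "finite (edges_in ?V)" by (intro finite_edges_in finite_sq)
    have h_eq: "?P (?H (?g1 ` ?S)) = h" "?P (?H (?g2 ` ?S)) = h" "?P (?H (?g3 ` ?S)) = h"
      unfolding h_def by (rule pr_hits_aut; rule square_symmetries; simp)+
    have h1: "h \<le> 1" unfolding h_def using p finV by (intro pr_le_1) auto
    have hits_Un: "?H (A \<union> B) \<omega> \<longleftrightarrow> ?H A \<omega> \<or> ?H B \<omega>" for A B \<omega> unfolding hits_def by blast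
    have FKG: "(1 - ?P (?H A)) * (1 - ?P (?H B)) \<le> 1 - ?P (?H (A \<union> B))" for A B
      using harris_decreasing[OF finV, of "\<lambda>_. p" "?H A" "?H B"] hits_mono p by (simp add: hits_Un[abs_def])
    let ?A = "?S \<union> ?g1 ` ?S" and ?B = "?g2 ` ?S \<union> ?g3 ` ?S"
    have A1: "?P (?H ?A) \<le> 1" using p finV by (intro pr_le_1) auto
    \<comment> \<open>Two rounds of the Harris inequality give one factor \<open>1 - h\<close> per
      side; \<open>box_escape\<close> was used with \<open>\<delta> ^ 4\<close> so that the fourth
      root is \<open>\<delta>\<close>.\<close>
    have "(1 - h) ^ 4 = ((1 - h) * (1 - h)) * ((1 - h) * (1 - h))" by (simp add: power4_eq_xxxx)
    also have "\<dots> \<le> (1 - ?P (?H ?A)) * (1 - ?P (?H ?B))"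
      using FKG[of ?S "?g1 ` ?S"] FKG[of "?g2 ` ?S" "?g3 ` ?S"] h_eq h1 A1 unfolding h_def[symmetric] by (intro mult_mono) simp_all
    also have "\<dots> \<le> 1 - ?P (?H (?A \<union> ?B))" by (rule FKG)
    also have "?P (?H (?A \<union> ?B)) = ?P (\<lambda>\<omega>. \<exists>v\<in>sq (int m). arm ?V v \<omega>)"
      unfolding sides_of_square[symmetric] by (simp add: hits_def[abs_def] arm_def)
    also have "1 - \<dots> \<le> \<delta> ^ 4" using m[OF n] by simp
    finally have "1 - h \<le> \<delta>" using \<delta> h1 power_mono_iff[of "1 - h" \<delta> 4] by simp
    then show "1 - \<delta> \<le> ?P (?H ?S) \<and> 1 - \<delta> \<le> ?P (?H (?g1 ` ?S))"
      using h_eq(1) by (simp add: h_def)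
  qed
qed

section \<open>Producing a merging edge by local modification\<close>

lemma conn_sq:
  assumes "v \<in> sq M" shows "conn (edges_in (sq M)) v 0"
proof -
  have horiz: "conn (edges_in (sq M)) (s * int k, b) (0, b)"
    if "int k \<le> M" "\<bar>b\<bar> \<le> M" "s \<in> {1, -1}" for k b s
    using that(1)
  proof (induction k)
    case (Suc k)
    have "{(s * int (Suc k), b), (s * int k, b)} \<in> edges_in (sq M)"
      using Suc.prems that by (auto simp: edges_in_iff sq_def adjacent_def)
    then have "conn (edges_in (sq M)) (s * int (Suc k), b) (s * int k, b)" by (rule conn_edge)
    also have "conn (edges_in (sq M)) (s * int k, b) (0, b)" using Suc by simp
    finally show ?case .
  qed simp
  have vert: "conn (edges_in (sq M)) (0, s * int k) (0, 0)"
    if "int k \<le> M" "s \<in> {1, -1}" for k s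
    using that(1)
  proof (induction k)
    case (Suc k)
    have "{(0, s * int (Suc k)), (0, s * int k)} \<in> edges_in (sq M)"
      using Suc.prems that by (auto simp: edges_in_iff sq_def adjacent_def)
    then have "conn (edges_in (sq M)) (0, s * int (Suc k)) (0, s * int k)" by (rule conn_edge)
    also have "conn (edges_in (sq M)) (0, s * int k) (0, 0)" using Suc by simp
    finally show ?case .
  qed simp
  obtain a b where v: "v = (a, b)" by fastforce
  have ab: "\<bar>a\<bar> \<le> M" "\<bar>b\<bar> \<le> M" using assms by (auto simp: v sq_def)
  have sg: "\<exists>s\<in>{1, -1}. z = s * int (nat \<bar>z\<bar>)" for z :: int by auto
  obtain s where s: "s \<in> {1, -1}" "a = s * int (nat \<bar>a\<bar>)" using sg by blast
  obtain s' where s': "s' \<in> {1, -1}" "b = s' * int (nat \<bar>b\<bar>)" using sg by blast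
  have "conn (edges_in (sq M)) (a, b) (0, b)"
    using horiz[of "nat \<bar>a\<bar>" b s] s ab by (metis int_nat_eq abs_ge_zero)
  also have "conn (edges_in (sq M)) (0, b) (0, 0)"
    using vert[of "nat \<bar>b\<bar>" s'] s' ab by (metis int_nat_eq abs_ge_zero)
  finally show ?thesis by (simp add: v zero_prod_def)
qed

text \<open>A second passage through \<open>e\<close> either repeats the first one or undoes it, so
  at most one passage is ever needed.\<close>

lemma conn_insert:
  assumes "conn (insert e \<omega>) u v"
  shows "conn \<omega> u v \<or> (\<exists>x y. e = {x, y} \<and> conn \<omega> u x \<and> conn \<omega> y v)"
  using assms
proof (induction rule: conn_induct)
  case (step y z)
  show ?case
  proof (cases "{y, z} \<in> \<omega>")
    case True
    then have yz: "conn \<omega> y z" by (rule conn_edge)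
    from step.IH show ?thesis
    proof (elim disjE exE conjE)
      assume "conn \<omega> u y"
      then show ?thesis using yz conn_trans by metis
    next
      fix a b assume "e = {a, b}" "conn \<omega> u a" "conn \<omega> b y"
      then show ?thesis using yz conn_trans by metis
    qed
  next
    case False
    then have e: "e = {y, z}" using step.hyps by simp
    from step.IH show ?thesis
    proof (elim disjE exE conjE)
      assume "conn \<omega> u y"
      then show ?thesis using e conn_refl by metis
    next
      fix a b assume ab: "e = {a, b}" "conn \<omega> u a" "conn \<omega> b y"
      then consider "a = y" "b = z" | "a = z" "b = y" using e by (auto simp: doubleton_eq_iff)
      then show ?thesis
      proof cases
        case 1
        then show ?thesis using ab e conn_refl by metis
      next
        case 2
        then show ?thesis using ab by simp
      qed
    qed
  qed
qed simp

text \<open>Opening edges inside the box one at a time until \<open>v\<close> and \<open>v'\<close> become connected, the last edge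
  opened merges two boundary clusters.\<close>
lemma merging_surgery:
  assumes "\<omega> \<subseteq> edges_in R" "sq M \<subseteq> R" "v \<in> sq M" "v' \<in> sq M"
    and "arm R v \<omega>" "arm R v' \<omega>" "\<not> conn \<omega> v v'"
  shows "\<exists>\<eta>\<subseteq>edges_in (sq M). \<exists>e\<in>edges_in (sq M). merging R e (\<omega> - edges_in (sq M) \<union> \<eta>)"
proof -
  let ?F = "edges_in (sq M)"
  let ?Q = "\<lambda>\<eta>. \<eta> \<subseteq> ?F \<and> conn (\<omega> \<union> \<eta>) v v'"
  have finF: "finite ?F" by (intro finite_edges_in finite_sq)
  have "conn ?F v v'"
    using conn_sq[OF assms(3)] conn_sym[OF conn_sq[OF assms(4)]] by (rule conn_trans)
  then have "conn (\<omega> \<union> ?F) v v'" by (rule conn_mono) auto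
  then have "?Q ?F" by simp
  \<comment> \<open>In a set of openings of minimal size, every edge can serve as the last one
    opened.\<close>
  then obtain \<eta> where \<eta>: "?Q \<eta>" and min: "\<And>\<eta>'. ?Q \<eta>' \<Longrightarrow> card \<eta> \<le> card \<eta>'"
    using ex_has_least_nat[of ?Q ?F card] by blast
  have fin\<eta>: "finite \<eta>" using \<eta> finF finite_subset by auto
  have "\<eta> \<noteq> {}" using \<eta> assms(7) by auto
  then obtain e where e: "e \<in> \<eta>" by blast
  have "\<not> ?Q (\<eta> - {e})"
  proof
    assume "?Q (\<eta> - {e})"
    then have "card \<eta> \<le> card (\<eta> - {e})" by (rule min)
    then show False using card_Diff1_less[OF fin\<eta> e] by simp
  qed
  then have sep: "\<not> conn (\<omega> \<union> (\<eta> - {e})) v v'" using \<eta> by blast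
  have e\<omega>: "e \<notin> \<omega>"
  proof
    assume "e \<in> \<omega>"
    then have "\<omega> \<union> (\<eta> - {e}) = \<omega> \<union> \<eta>" by auto
    then show False using sep \<eta> by simp
  qed
  let ?\<omega> = "\<omega> \<union> (\<eta> - {e})"
  have "insert e ?\<omega> = \<omega> \<union> \<eta>" using e by auto
  then have "conn (insert e ?\<omega>) v v'" using \<eta> by simp
  then obtain x y where xy: "e = {x, y}" "conn ?\<omega> v x" "conn ?\<omega> y v'"
    using conn_insert sep by metis
  have R: "?\<omega> \<inter> edges_in R = ?\<omega>" using assms(1) \<eta> edges_in_mono[OF assms(2)] by auto
  have armv: "arm R v ?\<omega>" "arm R v' ?\<omega>" using assms(5,6) by (auto intro: arm_mono)
  have ax: "arm R x ?\<omega>"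
    using armv(1) conn_trans[OF conn_sym[OF xy(2)]] unfolding arm_def R by blast
  have ay: "arm R y ?\<omega>"
    using armv(2) conn_trans[OF xy(3)] unfolding arm_def R by blast
  have nxy: "\<not> conn ?\<omega> x y"
    using conn_trans[OF conn_trans[OF xy(2)] xy(3)] sep by blast
  \<comment> \<open>\<open>pr_surgery\<close> erases the whole box, so the edges of \<omega> inside
    it have to be restored along with \<eta>.\<close>
  let ?\<eta>' = "(\<omega> \<inter> ?F) \<union> \<eta>"
  have "\<omega> - ?F \<union> ?\<eta>' - {e} = ?\<omega>" using e\<omega> by auto
  then have "merging R e (\<omega> - ?F \<union> ?\<eta>')"
    unfolding merging_def using xy(1) ax ay nxy R by (intro exI[of _ x] exI[of _ y]) simp
  moreover have "?\<eta>' \<subseteq> ?F" "e \<in> ?F" using \<eta> e by auto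
  ultimately show ?thesis by blast
qed

text \<open>The left side is reached from \<open>sq m\<close> within \<open>sq n\<close>, the right
  side from the shifted \<open>sq m\<close> within the shifted \<open>sq n\<close>; each fails with
  probability at most 1/8, and a crossing has probability at most 1/2. With probability at least 1/4
  both sides are thus reached, necessarily by different clusters.\<close>

lemma merging_in_box:
  assumes p: "0 < p" "p \<le> 1 / 2" and c: "0 < c" "\<And>n::nat. c \<le> theta (int n) p"
  shows "\<exists>c>0. \<exists>M. \<forall>n\<ge>M. c \<le> (\<Sum>e\<in>edges_in (sq (int M)). pr (edges_in (rect (int n))) (\<lambda>_. p) (merging (rect (int n)) e))"
proof -
  have p01: "0 \<le> p" "p \<le> 1" using p by auto
  obtain m :: nat where m: "\<And>n. n \<ge> m \<Longrightarrow>
     1 - 1 / 8 \<le> pr (edges_in (sq (int n))) (\<lambda>_. p) (hits (int m) (int n) (side (int n))) \<and>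
     1 - 1 / 8 \<le> pr (edges_in (sq (int n))) (\<lambda>_. p) (hits (int m) (int n) ((\<lambda>v. (- fst v, snd v)) ` side (int n)))"
    using side_escape[OF p01 c, of "1 / 8"] by auto
  \<comment> \<open>Room for \<open>sq m\<close> shifted by \<open>(1, 0)\<close>.\<close>
  let ?M = "m + 1"
  let ?F = "edges_in (sq (int ?M))"
  have "p ^ card ?F * (1 / 4) \<le> (\<Sum>e\<in>?F. pr (edges_in (rect (int n))) (\<lambda>_. p) (merging (rect (int n)) e))"
    if n: "?M \<le> n" for n
  proof -
    let ?R = "rect (int n)" and ?V = "sq (int n)" and ?g = "(+) (1, 0) :: vertex \<Rightarrow> vertex"
    let ?P = "pr (edges_in ?R) (\<lambda>_. p)" and ?r = "\<lambda>v :: vertex. (- fst v, snd v)"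
    have finR: "finite (edges_in ?R)" by (intro finite_edges_in finite_rect)
    have VR: "?V \<subseteq> ?R" "?g ` ?V \<subseteq> ?R" by (auto simp: sq_def rect_def)
    have MR: "sq (int ?M) \<subseteq> ?R" using n by (auto simp: sq_def rect_def)
    define A where "A = hits (int m) (int n) (?r ` side (int n))"
    define B where "B \<omega> \<longleftrightarrow> (\<exists>v\<in>sq (int m). \<exists>d\<in>side (int n). conn (\<omega> \<inter> edges_in (?g ` ?V)) (?g v) (?g d))" for \<omega>
    have PA: "1 - 1 / 8 \<le> ?P A"
    proof -
      have "?P A = pr (edges_in ?V) (\<lambda>_. p) A"
        using finR VR by (intro pr_restrict edges_in_mono) (auto simp: A_def hits_def Int_assoc)
      then show ?thesis using m[of n] n by (simp add: A_def)
    qed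
    have PB: "1 - 1 / 8 \<le> ?P B"
    proof -
      have "?P B = pr (edges_in (?g ` ?V)) (\<lambda>_. p) B"
        using finR VR by (intro pr_restrict edges_in_mono) (auto simp: B_def Int_assoc)
      also have "\<dots> = pr (edges_in ?V) (\<lambda>_. p) (\<lambda>\<omega>. B ((`) ?g ` \<omega>))"
        by (rule pr_lattice_aut[OF lattice_aut_shift finite_sq])
      also have "\<dots> = pr (edges_in ?V) (\<lambda>_. p) (hits (int m) (int n) (side (int n)))"
      proof (rule pr_cong)
        fix \<omega> :: "edge set"
        have inj: "inj ?g" by simp
        have "(`) ?g ` \<omega> \<inter> edges_in (?g ` ?V) = (`) ?g ` (\<omega> \<inter> edges_in ?V)"
          using inj_image_sets[OF inj, of UNIV] edges_in_image[OF lattice_aut_shift, of "(1, 0)" ?V] by (simp add: image_Int)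
        then show "B ((`) ?g ` \<omega>) \<longleftrightarrow> hits (int m) (int n) (side (int n)) \<omega>"
          by (simp add: B_def hits_def conn_image_iff[OF inj])
      qed
      finally show ?thesis using m[of n] n by simp
    qed
    have PC: "?P (crossing (int n)) \<le> 1 / 2" using p by (intro crossing_le_half) auto
    let ?D = "\<lambda>\<omega>. A \<omega> \<and> B \<omega> \<and> \<not> crossing (int n) \<omega>"
    have "?P (\<lambda>\<omega>. \<not> ?D \<omega>) \<le> ?P (\<lambda>\<omega>. \<not> A \<omega> \<or> (\<not> B \<omega> \<or> crossing (int n) \<omega>))"
      using p01 by (intro pr_mono) auto
    also have "\<dots> \<le> ?P (\<lambda>\<omega>. \<not> A \<omega>) + ?P (\<lambda>\<omega>. \<not> B \<omega> \<or> crossing (int n) \<omega>)"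
      using p01 by (intro pr_disj_le) auto
    also have "?P (\<lambda>\<omega>. \<not> B \<omega> \<or> crossing (int n) \<omega>) \<le> ?P (\<lambda>\<omega>. \<not> B \<omega>) + ?P (crossing (int n))"
      using p01 by (intro pr_disj_le) auto
    finally have PD: "1 / 4 \<le> ?P ?D" using PA PB PC pr_not[OF finR, of "\<lambda>_. p" ?D]
      pr_not[OF finR, of "\<lambda>_. p" A] pr_not[OF finR, of "\<lambda>_. p" B] by linarith
    \<comment> \<open>For \<open>p \<le> 1 / 2\<close> either state of an edge has probability at
      least \<open>p\<close>, which is the constant of the surgery.\<close>
    have "p ^ card ?F * ?P ?D \<le> ?P (\<lambda>\<omega>. \<exists>e\<in>?F. merging ?R e \<omega>)"
    proof (rule pr_surgery[OF finR])
      show "?F \<subseteq> edges_in ?R" using MR by (rule edges_in_mono)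
      fix \<omega> assume \<omega>: "\<omega> \<subseteq> edges_in ?R" and D: "?D \<omega>"
      obtain v d where vd: "v \<in> sq (int m)" "d \<in> ?r ` side (int n)" "conn (\<omega> \<inter> edges_in ?V) v d"
        using D unfolding A_def hits_def by blast
      obtain w d' where wd: "w \<in> sq (int m)" "d' \<in> side (int n)" "conn (\<omega> \<inter> edges_in (?g ` ?V)) (?g w) (?g d')"
        using D unfolding B_def by blast
      have d: "d \<in> ?R" "fst d = - int n" and d': "?g d' \<in> ?R" "fst (?g d') = int n + 1"
        using vd(2) wd(2) by (auto simp: side_def sq_def rect_def)
      have bd: "d \<in> bdry ?R" "?g d' \<in> bdry ?R"
      proof -
        have "(fst d - 1, snd d) \<notin> ?R" "adjacent d (fst d - 1, snd d)"
          using d by (auto simp: rect_def adjacent_def)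
        then show "d \<in> bdry ?R" using d(1) unfolding bdry_def by blast
        have "(fst (?g d') + 1, snd (?g d')) \<notin> ?R" "adjacent (?g d') (fst (?g d') + 1, snd (?g d'))"
          using d'(2) by (auto simp: rect_def adjacent_def)
        then show "?g d' \<in> bdry ?R" using d'(1) unfolding bdry_def by blast
      qed
      have c1: "conn \<omega> v d" using vd(3) by (rule conn_mono) auto
      have c2: "conn \<omega> (?g w) (?g d')" using wd(3) by (rule conn_mono) auto
      have \<omega>R: "\<omega> \<inter> edges_in ?R = \<omega>" using \<omega> by auto
      show "\<exists>\<eta>\<subseteq>?F. \<exists>e\<in>?F. merging ?R e (\<omega> - ?F \<union> \<eta>)"
      proof (rule merging_surgery[OF \<omega> MR])
        show "v \<in> sq (int ?M)" "?g w \<in> sq (int ?M)" using vd(1) wd(1) by (auto simp: sq_def)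
        show "arm ?R v \<omega>" unfolding arm_def \<omega>R using c1 bd by blast
        show "arm ?R (?g w) \<omega>" unfolding arm_def \<omega>R using c2 bd by blast
        show "\<not> conn \<omega> v (?g w)"
        proof
          assume vw: "conn \<omega> v (?g w)"
          have "conn \<omega> d (?g d')" using conn_trans[OF conn_trans[OF conn_sym[OF c1] vw] c2] .
          then show False using D d d' unfolding crossing_def by blast
        qed
      qed
    qed (use p in auto)
    also have "\<dots> \<le> (\<Sum>e\<in>?F. ?P (merging ?R e))"
      using p01 by (intro pr_Ex_le_sum finite_edges_in finite_sq) auto
    finally have "p ^ card ?F * ?P ?D \<le> (\<Sum>e\<in>?F. ?P (merging ?R e))" .
    moreover have "p ^ card ?F * (1 / 4) \<le> p ^ card ?F * ?P ?D"
      using PD p by (intro mult_left_mono) auto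
    ultimately show ?thesis by linarith
  qed
  then show ?thesis using p
    by (intro exI[of _ "p ^ card ?F * (1 / 4)"] conjI exI[of _ ?M]) auto
qed

theorem exists_phi_less_one:
  assumes "0 \<le> p" "p < 1 / 2"
  shows "\<exists>S. finite S \<and> 0 \<in> S \<and> phi p S < 1"
proof (rule ccontr)
  assume "\<not> ?thesis"
  then have phi: "1 \<le> phi p S" if "finite S" "0 \<in> S" for S using that by force
  \<comment> \<open>This density comes from an integral and cannot be chosen; any value above
    \<open>p\<close> is usable, since arms are bounded below at all of them.\<close>
  obtain q where q: "p < q" "q \<le> 1 / 2"
    and nq: "\<not> (\<exists>c>0. \<exists>k0. \<forall>k\<ge>k0. c * real k ^ 2 \<le> merging_count (sq (int k)) q)"
    using merging_count_not_quadratic[of p "1 / 2"] assms by auto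
  have "1 - exp (p - q) \<le> theta (int n) q" for n
    unfolding theta_def using assms q phi by (intro arm_lower_bound finite_sq) auto
  moreover have "0 < 1 - exp (p - q)" using q by simp
  ultimately obtain c M where c: "c > 0"
    and M: "\<And>n. n \<ge> M \<Longrightarrow> c \<le> (\<Sum>e\<in>edges_in (sq (int M)). pr (edges_in (rect (int n))) (\<lambda>_. q) (merging (rect (int n)) e))"
    using merging_in_box[of q "1 - exp (p - q)"] assms q by auto
  have "\<exists>c>0. \<exists>k0. \<forall>k\<ge>k0. c * real k ^ 2 \<le> merging_count (sq (int k)) q"
  proof (rule merging_count_quadratic[OF _ _ c])
    fix n assume "n \<ge> M"
    moreover have "sq (int n) \<subseteq> rect (int n)" by (auto simp: sq_def rect_def)
    ultimately show "finite (rect (int n)) \<and> sq (int n) \<subseteq> rect (int n) \<and>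
      c \<le> (\<Sum>e\<in>edges_in (sq (int M)). pr (edges_in (rect (int n))) (\<lambda>_. q) (merging (rect (int n)) e))"
      using M finite_rect by blast
  qed (use assms q in auto)
  then show False using nq by blast
qed

section \<open>Poisson percolation\<close>

text \<open>The factor \<open>k + 1\<close> stands for the number of points on the middle circle,
  whose radius will be comparable to \<open>k\<close>. Between multiples of \<open>L\<close> the
  monotonicity of \<open>theta\<close> fills in.\<close>

lemma theta_times_limit:
  assumes "0 \<le> p" "p < 1 / 2"
  shows "(\<lambda>k. (real k + 1) * theta (int k) p) \<longlonglongrightarrow> 0"
proof -
  obtain S where S: "finite S" "0 \<in> S" "phi p S < 1"
    using exists_phi_less_one[OF assms] by blast
  obtain L where L: "0 < L" "\<And>k. theta (int k * L) p \<le> phi p S ^ k"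
    using subcritical_decay[OF S] assms by auto
  define q where "q = phi p S"
  have q: "0 \<le> q" "q < 1"
    using S(3) L(2)[of 1] theta_bounds(1)[of p "int 1 * L"] assms by (auto simp: q_def)
  define l where "l = nat L"
  have l: "0 < l" "L = int l" using L(1) by (auto simp: l_def)
  have bound: "(real k + 1) * theta (int k) p \<le> real l * (real (k div l) * q ^ (k div l) + q ^ (k div l))" for k
  proof -
    have "k div l * l \<le> k" by (rule div_times_less_eq_dividend)
    then have "theta (int k) p \<le> theta (int (k div l) * L) p"
      using assms l by (intro theta_decseq) (auto simp flip: of_nat_mult of_nat_div simp del: zdiv_int)
    also have "\<dots> \<le> q ^ (k div l)" unfolding q_def by (rule L(2))
    finally have 1: "theta (int k) p \<le> q ^ (k div l)" .
    have "k < l * (k div l + 1)"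
      using l(1) by (metis Suc_eq_plus1 dividend_less_times_div mult_Suc_right)
    then have "k + 1 \<le> l * (k div l + 1)" by simp
    then have "real (k + 1) \<le> real (l * (k div l + 1))" by (rule of_nat_mono)
    then have 2: "real k + 1 \<le> real l * (real (k div l) + 1)" by (simp add: algebra_simps)
    have "(real k + 1) * theta (int k) p \<le> real l * (real (k div l) + 1) * q ^ (k div l)"
      using 1 2 assms theta_bounds(1)[of p "int k"] by (intro mult_mono) auto
    then show ?thesis by (simp add: algebra_simps)
  qed
  have "(\<lambda>m. real l * (real m * q ^ m + q ^ m)) \<longlonglongrightarrow> real l * (0 + 0)"
    using q by (intro tendsto_intros powser_times_n_limit_0 LIMSEQ_realpow_zero) auto
  then have "(\<lambda>k. real l * (real (k div l) * q ^ (k div l) + q ^ (k div l))) \<longlonglongrightarrow> real l * (0 + 0)"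
    by (rule filterlim_compose[OF _ filterlim_at_top_div_const_nat[OF l(1)]])
  then have lim: "(\<lambda>k. real l * (real (k div l) * q ^ (k div l) + q ^ (k div l))) \<longlonglongrightarrow> 0" by simp
  show ?thesis
  proof (rule tendsto_sandwich[OF _ _ tendsto_const lim])
    show "eventually (\<lambda>k. 0 \<le> (real k + 1) * theta (int k) p) sequentially"
      using assms theta_bounds(1) by (intro always_eventually allI mult_nonneg_nonneg) auto
    show "eventually (\<lambda>k. (real k + 1) * theta (int k) p \<le> real l * (real (k div l) * q ^ (k div l) + q ^ (k div l))) sequentially"
      using bound by (intro always_eventually allI)
  qed
qed

text \<open>The event splits into the cylinders \<open>C \<eta>\<close>, one for each possible set
  of successful coordinates, and their probabilities are the weights of the finite model.\<close>

lemma measure_PiM_finite_event: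
  assumes M: "\<And>i. prob_space (M i)" and E: "finite E" "E \<subseteq> I"
    and X: "\<And>i. i \<in> E \<Longrightarrow> X i \<in> sets (M i)" and q: "\<And>i. i \<in> E \<Longrightarrow> q i = measure (M i) (X i)"
  shows "measure (PiM I M) {x \<in> space (PiM I M). A {i \<in> E. x i \<in> X i}} = pr E q A"
    and "{x \<in> space (PiM I M). A {i \<in> E. x i \<in> X i}} \<in> sets (PiM I M)"
proof -
  interpret product_prob_space M I by (rule product_prob_spaceI) (rule M)
  define Y where "Y \<eta> i = (if i \<in> \<eta> then X i else space (M i) - X i)" for \<eta> i
  define C where "C \<eta> = {x \<in> space (PiM I M). \<forall>i\<in>E. x i \<in> Y \<eta> i}" for \<eta>
  have C_eq: "C \<eta> = {x \<in> space (PiM I M). {i \<in> E. x i \<in> X i} = \<eta>}" if "\<eta> \<subseteq> E" for \<eta>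
  proof -
    have "x i \<in> space (M i)" if "x \<in> space (PiM I M)" "i \<in> E" for x i
      using that E by (auto simp: space_PiM PiE_iff)
    then show ?thesis using that by (auto simp: C_def Y_def split: if_splits)
  qed
  have Y: "Y \<eta> i \<in> sets (M i)" if "i \<in> E" for \<eta> i using X[OF that] by (auto simp: Y_def)
  have C_sets: "C \<eta> \<in> sets (PiM I M)" for \<eta>
  proof -
    have "C \<eta> = prod_emb I M E (Pi\<^sub>E E (Y \<eta>))"
      using E by (auto simp: C_def prod_emb_def space_PiM Pi_iff)
    then show ?thesis using E Y by simp
  qed
  have PC: "measure (PiM I M) (C \<eta>) = config_weight E q \<eta>" for \<eta>
  proof -
    have "emeasure (PiM I M) (C \<eta>) = (\<Prod>i\<in>E. emeasure (M i) (Y \<eta> i))"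
      unfolding C_def using E Y by (intro emeasure_PiM_Collect) auto
    then have "measure (PiM I M) (C \<eta>) = (\<Prod>i\<in>E. measure (M i) (Y \<eta> i))"
      by (simp add: emeasure_eq_measure M.emeasure_eq_measure prod_ennreal measure_nonneg prod_nonneg)
    also have "\<dots> = config_weight E q \<eta>"
      unfolding config_weight_def using X q by (intro prod.cong) (auto simp: Y_def M.prob_compl)
    finally show ?thesis .
  qed
  have U: "{x \<in> space (PiM I M). A {i \<in> E. x i \<in> X i}} = (\<Union>\<eta>\<in>{\<eta>\<in>Pow E. A \<eta>}. C \<eta>)"
    using C_eq by auto
  then show "{x \<in> space (PiM I M). A {i \<in> E. x i \<in> X i}} \<in> sets (PiM I M)"
    using E(1) C_sets by (simp only: U) (intro sets.finite_UN, auto)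
  have "disjoint_family_on C {\<eta>\<in>Pow E. A \<eta>}"
    using C_eq by (auto simp: disjoint_family_on_def)
  then have "measure (PiM I M) (\<Union>\<eta>\<in>{\<eta>\<in>Pow E. A \<eta>}. C \<eta>) = (\<Sum>\<eta>\<in>{\<eta>\<in>Pow E. A \<eta>}. measure (PiM I M) (C \<eta>))"
    using E C_sets by (intro finite_measure_finite_Union) auto
  also have "\<dots> = (\<Sum>\<eta>\<in>Pow E. if A \<eta> then config_weight E q \<eta> else 0)"
    unfolding PC using E by (intro sum.inter_filter) simp
  also have "\<dots> = (\<Sum>\<eta>\<in>Pow E. config_weight E q \<eta> * of_bool (A \<eta>))"
    by (intro sum.cong) auto
  finally show "measure (PiM I M) {x \<in> space (PiM I M). A {i \<in> E. x i \<in> X i}} = pr E q A"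
    by (simp add: U pr_def expect_def)
qed

section \<open>The law of the exponential clocks\<close>

lemma edge_midnorm_eq:
  assumes "adjacent u v" shows "edge_midnorm {u, v} = linf (midpoint_uv u v)"
  unfolding edge_midnorm_def
proof (rule the_equality)
  fix r assume "\<exists>u' v'. {u, v} = {u', v'} \<and> adjacent u' v' \<and> r = linf (midpoint_uv u' v')"
  then obtain u' v' where "{u, v} = {u', v'}" "r = linf (midpoint_uv u' v')" by blast
  then show "r = linf (midpoint_uv u v)"
    by (auto simp: doubleton_eq_iff midpoint_uv_def add.commute)
qed (use assms in blast)

text \<open>No edge is centred at the origin: a zero midpoint means \<open>v = - u\<close>, and then
  the distance between the ends is even. This matters because \<open>0 powr (- \<alpha>) = 0\<close>
  would not define an exponential law.\<close>

lemma rate_pos: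
  assumes "e \<in> edges" shows "0 < rate \<alpha> e"
proof -
  obtain u v where uv: "e = {u, v}" "adjacent u v" using assms by (auto simp: edges_def)
  have "fst u + fst v \<noteq> 0 \<or> snd u + snd v \<noteq> 0"
  proof (rule ccontr)
    assume "\<not> ?thesis"
    then have "fst v = - fst u" "snd v = - snd u" by auto
    then have "even (\<bar>fst u - fst v\<bar> + \<bar>snd u - snd v\<bar>)" by simp
    then show False using uv(2) unfolding adjacent_def by (metis odd_one)
  qed
  then have "real_of_int (fst u + fst v) \<noteq> 0 \<or> real_of_int (snd u + snd v) \<noteq> 0"
    by (simp only: of_int_eq_0_iff)
  then have "0 < linf (midpoint_uv u v)"
    by (auto simp: linf_def midpoint_uv_def less_max_iff_disj)
  then show ?thesis by (simp add: rate_def uv edge_midnorm_eq)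
qed

text \<open>The default rate 1 makes the family a probability measure at every index, as the product
  argument demands, without changing the product over \<open>edges\<close>.\<close>

definition clock :: "real \<Rightarrow> edge \<Rightarrow> real measure" where
  "clock \<alpha> e = density lborel (exponential_density (if e \<in> edges then rate \<alpha> e else 1))"

lemma prob_space_clock: "prob_space (clock \<alpha> e)"
  unfolding clock_def by (rule prob_space_exponential_density) (simp add: rate_pos)

lemma poisson_perc_eq: "poisson_perc \<alpha> = PiM edges (clock \<alpha>)"
  unfolding poisson_perc_def by (intro PiM_cong) (auto simp: clock_def)

lemma prob_space_poisson_perc: "prob_space (poisson_perc \<alpha>)"
  unfolding poisson_perc_eq by (intro prob_space_PiM prob_space_clock)

lemma measure_clock:
  assumes "e \<in> edges" "0 \<le> t"
  shows "measure (clock \<alpha> e) {..t} = 1 - exp (- t * rate \<alpha> e)"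
  using assms rate_pos[OF assms(1), of \<alpha>] emeasure_erlang_density[of "rate \<alpha> e" 0 t]
  by (simp add: clock_def measure_def erlang_CDF_0 mult.commute)

lemma poisson_perc_event:
  assumes "finite E" "E \<subseteq> edges" "0 \<le> t"
  shows "measure (poisson_perc \<alpha>) {\<omega> \<in> space (poisson_perc \<alpha>). A {e \<in> E. \<omega> e \<le> t}} =
      pr E (\<lambda>e. 1 - exp (- t * rate \<alpha> e)) A"
    and "{\<omega> \<in> space (poisson_perc \<alpha>). A {e \<in> E. \<omega> e \<le> t}} \<in> sets (poisson_perc \<alpha>)"
proof -
  have X: "{..t} \<in> sets (clock \<alpha> e)" for e by (simp add: clock_def)
  have q: "1 - exp (- t * rate \<alpha> e) = measure (clock \<alpha> e) {..t}" if "e \<in> E" for e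
    using measure_clock[of e t \<alpha>] assms that by auto
  show "measure (poisson_perc \<alpha>) {\<omega> \<in> space (poisson_perc \<alpha>). A {e \<in> E. \<omega> e \<le> t}} =
      pr E (\<lambda>e. 1 - exp (- t * rate \<alpha> e)) A"
    using measure_PiM_finite_event(1)[OF prob_space_clock assms(1,2) X q, where A = A]
    by (simp add: poisson_perc_eq)
  show "{\<omega> \<in> space (poisson_perc \<alpha>). A {e \<in> E. \<omega> e \<le> t}} \<in> sets (poisson_perc \<alpha>)"
    using measure_PiM_finite_event(2)[OF prob_space_clock assms(1,2) X q, where A = A]
    by (simp add: poisson_perc_eq)
qed

lemma cluster0_eq: "cluster0 \<omega> t = {v. conn {e \<in> edges. \<omega> e \<le> t} 0 v}"
  by (simp add: cluster0_def open_rel_def conn_def edges_iff zero_prod_def)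

text \<open>Being reachable is a countable union over path lengths and, recursively, over
  intermediate vertices, of events that concern single edges.\<close>

lemma cluster0_event: "{\<omega> \<in> space (poisson_perc \<alpha>). cluster0 \<omega> t \<subseteq> B} \<in> sets (poisson_perc \<alpha>)"
proof -
  let ?P = "poisson_perc \<alpha>"
  have edge: "Measurable.pred ?P (\<lambda>\<omega>. (u, v) \<in> open_rel \<omega> t)" for u v
  proof (cases "adjacent u v")
    case True
    then have e: "{u, v} \<in> edges" by (simp add: edges_iff)
    have "(\<lambda>\<omega>. \<omega> {u, v}) \<in> measurable ?P (clock \<alpha> {u, v})"
      unfolding poisson_perc_eq using e by (rule measurable_component_singleton)
    then have [measurable]: "(\<lambda>\<omega>. \<omega> {u, v}) \<in> borel_measurable ?P"
      by (simp add: clock_def cong: measurable_cong_sets)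
    show ?thesis using True by (simp add: open_rel_def)
  qed (simp add: open_rel_def)
  have path: "Measurable.pred ?P (\<lambda>\<omega>. (u, v) \<in> open_rel \<omega> t ^^ n)" for u v n
  proof (induction n arbitrary: v)
    case (Suc n)
    note [measurable] = Suc edge
    have "Measurable.pred ?P (\<lambda>\<omega>. \<exists>w. (u, w) \<in> open_rel \<omega> t ^^ n \<and> (w, v) \<in> open_rel \<omega> t)"
      by measurable
    then show ?case by (simp add: relcomp_unfold)
  qed simp
  note [measurable] = path
  have "Measurable.pred ?P (\<lambda>\<omega>. \<forall>v. v \<in> B \<or> \<not> (\<exists>n. ((0, 0), v) \<in> open_rel \<omega> t ^^ n))"
    by measurable
  moreover have "cluster0 \<omega> t \<subseteq> B \<longleftrightarrow> (\<forall>v. v \<in> B \<or> \<not> (\<exists>n. ((0, 0), v) \<in> open_rel \<omega> t ^^ n))" for \<omega>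
    unfolding cluster0_def rtrancl_is_UN_relpow by blast
  ultimately show ?thesis by (simp add: pred_def)
qed

text \<open>Here \<open>a\<close> and \<open>b\<close> are coordinates of the two ends of an edge
  near a vertex with coordinate \<open>d\<close>, so \<open>a + b\<close> is twice the coordinate of
  the midpoint.\<close>

lemma abs_sum_far:
  fixes a b d j k :: int
  assumes "\<bar>d\<bar> = j" "\<bar>a - d\<bar> \<le> k" "\<bar>b - d\<bar> \<le> k"
  shows "2 * (j - k) \<le> \<bar>a + b\<bar>"
  using assms by (smt (verit))

text \<open>A cluster reaching beyond \<open>j + k\<close> has an arm of length \<open>k\<close> at some vertex of norm \<open>j\<close>, and
  this arm lives where the edges have density at most \<open>p\<close>.\<close>
lemma cluster0_escape_prob:
  assumes t: "0 \<le> t" and jk: "0 \<le> k" "k \<le> j" "real_of_int (j + k) \<le> r" and p: "0 \<le> p" "p \<le> 1"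
    and dens: "\<And>e. e \<in> edges \<Longrightarrow> real_of_int (j - k) \<le> edge_midnorm e \<Longrightarrow> 1 - exp (- t * rate \<alpha> e) \<le> p"
  shows "1 - 4 * (2 * real_of_int j + 1) * theta k p \<le>
    measure (poisson_perc \<alpha>) {\<omega> \<in> space (poisson_perc \<alpha>). cluster0 \<omega> t \<subseteq> box r}"
proof -
  interpret prob_space "poisson_perc \<alpha>" by (rule prob_space_poisson_perc)
  let ?P = "poisson_perc \<alpha>"
  let ?V = "\<lambda>d :: vertex. (+) d ` sq k"
  let ?J = "bdry (sq j)"
  define bad where "bad d = {\<omega> \<in> space ?P. arm (?V d) d {e \<in> edges_in (?V d). \<omega> e \<le> t}}" for d
  have finV: "finite (edges_in (?V d))" for d by (intro finite_edges_in finite_imageI finite_sq)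
  have subE: "edges_in V \<subseteq> edges" for V by (auto simp: edges_in_def)
  have finJ: "finite ?J" using finite_sq bdry_subset finite_subset by blast
  have bad_sets: "bad d \<in> sets ?P" for d
    unfolding bad_def by (rule poisson_perc_event(2)[OF finV subE t])
  have bad_prob: "measure ?P (bad d) \<le> theta k p" if d: "d \<in> ?J" for d
  proof -
    have far: "real_of_int (j - k) \<le> edge_midnorm e" if e: "e \<in> edges_in (?V d)" for e
    proof -
      obtain u v where uv: "e = {u, v}" "adjacent u v" using e by (auto simp: edges_in_def edges_def)
      have "u \<in> ?V d" "v \<in> ?V d" using e uv by (auto simp: edges_in_def)
      then have near: "\<bar>fst u - fst d\<bar> \<le> k" "\<bar>snd u - snd d\<bar> \<le> k" "\<bar>fst v - fst d\<bar> \<le> k" "\<bar>snd v - snd d\<bar> \<le> k"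
        by (auto simp: sq_def)
      have "\<bar>fst d\<bar> = j \<or> \<bar>snd d\<bar> = j" using d by (simp add: bdry_sq)
      then have "2 * (j - k) \<le> \<bar>fst u + fst v\<bar> \<or> 2 * (j - k) \<le> \<bar>snd u + snd v\<bar>"
        using near abs_sum_far by blast
      then have "real_of_int (2 * (j - k)) \<le> real_of_int \<bar>fst u + fst v\<bar> \<or>
          real_of_int (2 * (j - k)) \<le> real_of_int \<bar>snd u + snd v\<bar>"
        by (simp only: of_int_le_iff)
      then show ?thesis
        by (auto simp: uv edge_midnorm_eq linf_def midpoint_uv_def le_max_iff_disj)
    qed
    have "measure ?P (bad d) = pr (edges_in (?V d)) (\<lambda>e. 1 - exp (- t * rate \<alpha> e)) (arm (?V d) d)"
      unfolding bad_def by (rule poisson_perc_event(1)[OF finV subE t])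
    \<comment> \<open>Monotonicity replaces the varying densities of this small box by a constant
      one, which makes the box a translate of \<open>sq k\<close>.\<close>
    also have "\<dots> \<le> pr (edges_in (?V d)) (\<lambda>_. p) (arm (?V d) d)"
    proof (rule pr_mono_param[OF finV])
      fix e assume e: "e \<in> edges_in (?V d)"
      then have "e \<in> edges" using subE by blast
      moreover have "0 \<le> t * rate \<alpha> e" using t rate_pos[OF calculation, of \<alpha>] by simp
      ultimately show "0 \<le> 1 - exp (- t * rate \<alpha> e) \<and> 1 - exp (- t * rate \<alpha> e) \<le> p \<and> p \<le> 1"
        using dens far[OF e] p by simp
    qed (rule arm_mono)
    also have "\<dots> = theta k p"
      by (rule pr_arm_shift) (simp_all add: finite_sq)
    finally show ?thesis .
  qed
  let ?G = "{\<omega> \<in> space ?P. cluster0 \<omega> t \<subseteq> box r}"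
  have sub: "space ?P - ?G \<subseteq> (\<Union>d\<in>?J. bad d)"
  proof
    fix \<omega> assume \<omega>: "\<omega> \<in> space ?P - ?G"
    let ?O = "{e \<in> edges. \<omega> e \<le> t}"
    obtain z where z: "conn ?O 0 z" "z \<notin> box r" using \<omega> by (auto simp: cluster0_eq)
    have zn: "z \<notin> sq (j + k)"
    proof
      assume "z \<in> sq (j + k)"
      then have "real_of_int \<bar>fst z\<bar> \<le> real_of_int (j + k)" "real_of_int \<bar>snd z\<bar> \<le> real_of_int (j + k)"
        by (simp_all only: of_int_le_iff) (simp_all add: sq_def)
      then have "z \<in> box r" using jk(3) by (simp add: box_def linf_def)
      then show False using z(2) by simp
    qed
    then have "z \<notin> sq j" using jk(1) by (auto simp: sq_def)
    \<comment> \<open>The path to \<open>z\<close> meets the circle of radius \<open>j\<close> at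
      some \<open>d\<close>, and from there it still has to leave \<open>d + sq k\<close>, a subset
      of \<open>sq (j + k)\<close>.\<close>
    then have "arm (sq j) 0 ?O" using conn_exit[OF z(1), of "sq j"] jk by auto
    then obtain d where d: "d \<in> ?J" "conn (?O \<inter> edges_in (sq j)) 0 d" by (auto simp: arm_def)
    have "conn ?O 0 d" using d(2) by (rule conn_mono) auto
    then have dz: "conn ?O d z" using conn_trans[OF conn_sym z(1)] by blast
    have dV: "d \<in> ?V d" using imageI[of 0 "sq k" "(+) d"] jk by simp
    have "d \<in> sq j" using d(1) bdry_subset by blast
    then have "?V d \<subseteq> sq (j + k)" by (rule shift_sq_subset) simp
    then have "z \<notin> ?V d" using zn by blast
    then have "arm (?V d) d ?O" using conn_exit[OF dz _ dV] by auto
    then have "arm (?V d) d (?O \<inter> edges_in (?V d))" by (simp add: arm_Int)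
    moreover have "?O \<inter> edges_in (?V d) = {e \<in> edges_in (?V d). \<omega> e \<le> t}" using subE by auto
    ultimately have "\<omega> \<in> bad d" using \<omega> by (simp add: bad_def)
    then show "\<omega> \<in> (\<Union>d\<in>?J. bad d)" using d(1) by blast
  qed
  have "measure ?P (space ?P - ?G) \<le> measure ?P (\<Union>d\<in>?J. bad d)"
    using sub bad_sets finJ by (intro finite_measure_mono) auto
  also have "\<dots> \<le> (\<Sum>d\<in>?J. measure ?P (bad d))"
    using bad_sets finJ by (intro finite_measure_subadditive_finite) auto
  also have "\<dots> \<le> (\<Sum>d\<in>?J. theta k p)" using bad_prob by (rule sum_mono)
  also have "\<dots> = real (card ?J) * theta k p" by simp
  also have "\<dots> \<le> 4 * (2 * real_of_int j + 1) * theta k p"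
  proof (rule mult_right_mono)
    have "card ?J \<le> 4 * nat (2 * j + 1)" using jk by (intro card_bdry_sq) simp
    then have "real (card ?J) \<le> real (4 * nat (2 * j + 1))" by (rule of_nat_mono)
    then show "real (card ?J) \<le> 4 * (2 * real_of_int j + 1)" using jk by simp
  qed (use theta_bounds p in simp)
  finally show ?thesis using prob_compl[OF cluster0_event] by simp
qed

text \<open>At norm \<open>n_rad \<alpha> p t\<close> the density equals \<open>p\<close> exactly,
  and the rate decreases with the norm.\<close>

lemma n_rad_density:
  assumes "0 < \<alpha>" "0 < p" "p < 1" "0 < t" and far: "n_rad \<alpha> p t \<le> edge_midnorm e"
  shows "1 - exp (- t * rate \<alpha> e) \<le> p"
proof -
  let ?l = "- ln (1 - p)"
  have l: "0 < ?l" using assms by simp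
  have pos: "0 < n_rad \<alpha> p t" using l assms by (simp add: n_rad_def c_const_def)
  have "edge_midnorm e powr (- \<alpha>) \<le> n_rad \<alpha> p t powr (- \<alpha>)"
    using far pos assms by (intro powr_mono2') auto
  also have "n_rad \<alpha> p t powr (- \<alpha>) = ?l * t powr (- 1)"
    using l assms by (simp add: n_rad_def c_const_def powr_mult powr_powr)
  finally have "t * rate \<alpha> e \<le> t * (?l * t powr (- 1))"
    unfolding rate_def using assms by (intro mult_left_mono) auto
  also have "\<dots> = ?l" using assms by (simp add: powr_minus powr_one field_simps)
  finally have "exp (ln (1 - p)) \<le> exp (- t * rate \<alpha> e)" by simp
  then show ?thesis using assms by simp
qed

theorem theorem1:
  fixes \<alpha> \<epsilon> :: real
  assumes "\<alpha> > 0" and "0 < \<epsilon>" and "\<epsilon> < 1 / 2"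
  shows "((\<lambda>t. measure (poisson_perc \<alpha>)
            {\<omega> \<in> space (poisson_perc \<alpha>). cluster0 \<omega> t \<subseteq> box (n_rad \<alpha> (p_c - \<epsilon>) t)})
          \<longlongrightarrow> 1) at_top"
proof -
  define p q where "p = p_c - \<epsilon>" and "q = p_c - \<epsilon> / 2"
  have pq: "0 < p" "p < q" "q < 1 / 2" using assms by (auto simp: p_def q_def p_c_def)
  define c1 c2 where "c1 = c_const q \<alpha>" and "c2 = c_const p \<alpha>"
  have c: "0 < c1" "c1 < c2"
  proof -
    have "0 < - ln (1 - p)" "- ln (1 - p) < - ln (1 - q)" using pq by auto
    then show "0 < c1" "c1 < c2" unfolding c1_def c2_def c_const_def
      using assms by (auto intro!: powr_less_mono2_neg)
  qed
  define s where "s t = t powr (1 / \<alpha>)" for t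
  \<comment> \<open>About half the width \<open>(c2 - c1) * s t\<close> of the annulus; the
    \<open>- 1\<close> absorbs the rounding of the outer radius in \<open>j\<close> below.\<close>
  define k where "k t = nat \<lfloor>((c2 - c1) * s t - 1) / 2\<rfloor>" for t
  have s_lim: "filterlim s at_top at_top"
    unfolding filterlim_at_top
  proof
    fix Z
    show "eventually (\<lambda>t. Z \<le> s t) at_top"
      unfolding eventually_at_top_linorder
    proof (intro exI allI impI)
      fix t assume t: "max 1 Z powr \<alpha> \<le> t"
      have "Z \<le> (max 1 Z powr \<alpha>) powr (1 / \<alpha>)" using assms by (simp add: powr_powr)
      also have "\<dots> \<le> s t" unfolding s_def using t assms by (intro powr_mono2) auto
      finally show "Z \<le> s t" .
    qed
  qed
  have k_lim: "filterlim k at_top at_top"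
  proof -
    have "filterlim (\<lambda>x. - 1 / 2 + (c2 - c1) / 2 * x) at_top at_top"
      using c by (intro filterlim_tendsto_add_at_top[OF tendsto_const] filterlim_tendsto_pos_mult_at_top[OF tendsto_const]) (auto simp: filterlim_ident)
    then have "filterlim (\<lambda>t. - 1 / 2 + (c2 - c1) / 2 * s t) at_top at_top"
      using s_lim by (rule filterlim_compose)
    moreover have "(\<lambda>t. - 1 / 2 + (c2 - c1) / 2 * s t) = (\<lambda>t. ((c2 - c1) * s t - 1) / 2)"
      by (simp add: fun_eq_iff field_simps)
    ultimately have "filterlim (\<lambda>t. ((c2 - c1) * s t - 1) / 2) at_top at_top" by metis
    then show ?thesis unfolding k_def
      by (intro filterlim_compose[OF filterlim_nat_sequentially] filterlim_compose[OF filterlim_floor_sequentially])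
  qed
  \<comment> \<open>Bounds \<open>4 * (2 * j + 1)\<close> by \<open>C * (k t + 1)\<close>, using
    \<open>j \<le> c2 * s t\<close> and \<open>s t \<le> 3 * (k t + 1) / (c2 - c1)\<close>.\<close>
  define C where "C = 4 * (6 * c2 / (c2 - c1) + 1)"
  let ?f = "\<lambda>t. measure (poisson_perc \<alpha>) {\<omega> \<in> space (poisson_perc \<alpha>). cluster0 \<omega> t \<subseteq> box (n_rad \<alpha> p t)}"
  have lower: "1 - C * ((real (k t) + 1) * theta (int (k t)) q) \<le> ?f t"
    if t: "1 \<le> t" and st: "1 \<le> (c2 - c1) * s t" for t
  proof -
    have r: "n_rad \<alpha> p t = c2 * s t" "n_rad \<alpha> q t = c1 * s t"
      by (simp_all add: n_rad_def c1_def c2_def s_def)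
    have s0: "0 < s t" using t by (simp add: s_def)
    have kf: "int (k t) = \<lfloor>((c2 - c1) * s t - 1) / 2\<rfloor>" unfolding k_def using st by simp
    have k1: "2 * real (k t) \<le> (c2 - c1) * s t - 1" and k2: "(c2 - c1) * s t < 2 * real (k t) + 3"
      using floor_correct[of "((c2 - c1) * s t - 1) / 2"] unfolding kf[symmetric] by auto
    \<comment> \<open>Then \<open>j + k t\<close> is the integer part of the outer radius of the
      annulus, and \<open>j - k t\<close> is at least the inner radius.\<close>
    define j where "j = \<lfloor>c2 * s t\<rfloor> - int (k t)"
    have fl: "real_of_int \<lfloor>c2 * s t\<rfloor> \<le> c2 * s t" "c2 * s t - 1 < real_of_int \<lfloor>c2 * s t\<rfloor>" by linarith+
    have jk: "c1 * s t \<le> real_of_int (j - int (k t))"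
      using fl(2) k1 by (simp add: j_def algebra_simps)
    have "0 < c1 * s t" using c s0 by simp
    then have "int (k t) \<le> j" using jk by linarith
    have "1 - 4 * (2 * real_of_int j + 1) * theta (int (k t)) q \<le> ?f t"
    proof (rule cluster0_escape_prob)
      show "real_of_int (j + int (k t)) \<le> n_rad \<alpha> p t" using fl(1) by (simp add: j_def r)
      fix e assume "real_of_int (j - int (k t)) \<le> edge_midnorm e"
      then have "n_rad \<alpha> q t \<le> edge_midnorm e" using jk r by linarith
      then show "1 - exp (- t * rate \<alpha> e) \<le> q" using assms pq t by (intro n_rad_density) auto
    qed (use t pq \<open>int (k t) \<le> j\<close> in auto)
    moreover have "4 * (2 * real_of_int j + 1) * theta (int (k t)) q \<le> C * (real (k t) + 1) * theta (int (k t)) q"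
    proof (rule mult_right_mono)
      have "s t \<le> (2 * real (k t) + 3) / (c2 - c1)" using k2 c by (simp add: field_simps)
      also have "\<dots> \<le> 3 * (real (k t) + 1) / (c2 - c1)" using c by (intro divide_right_mono) auto
      finally have "c2 * s t \<le> c2 * (3 * (real (k t) + 1) / (c2 - c1))" using c by (intro mult_left_mono) auto
      moreover have "real_of_int j \<le> c2 * s t" using fl(1) unfolding j_def of_int_diff of_int_of_nat_eq by linarith
      ultimately have "real_of_int j \<le> c2 * (3 * (real (k t) + 1) / (c2 - c1))" by linarith
      then have "4 * (2 * real_of_int j + 1) \<le> 4 * (2 * (c2 * (3 * (real (k t) + 1) / (c2 - c1))) + (real (k t) + 1))"
        by simp
      also have "\<dots> = C * (real (k t) + 1)" by (simp add: C_def algebra_simps)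
      finally show "4 * (2 * real_of_int j + 1) \<le> C * (real (k t) + 1)" .
    qed (use theta_bounds pq in simp)
    ultimately show ?thesis by (simp add: mult.assoc)
  qed
  have lim: "((\<lambda>t. 1 - C * ((real (k t) + 1) * theta (int (k t)) q)) \<longlongrightarrow> 1 - C * 0) at_top"
    using pq by (intro tendsto_diff tendsto_mult tendsto_const filterlim_compose[OF theta_times_limit k_lim]) auto
  have "(?f \<longlongrightarrow> 1) at_top"
  proof (rule tendsto_sandwich[OF _ _ _ tendsto_const])
    show "((\<lambda>t. 1 - C * ((real (k t) + 1) * theta (int (k t)) q)) \<longlongrightarrow> 1) at_top" using lim by simp
    have "eventually (\<lambda>t. 1 / (c2 - c1) \<le> s t) at_top" using s_lim by (auto simp: filterlim_at_top)
    then show "eventually (\<lambda>t. 1 - C * ((real (k t) + 1) * theta (int (k t)) q) \<le> ?f t) at_top"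
      using eventually_ge_at_top[of 1]
      by eventually_elim (use lower c in \<open>simp add: field_simps\<close>)
    show "eventually (\<lambda>t. ?f t \<le> 1) at_top"
      using prob_space.prob_le_1[OF prob_space_poisson_perc] by (intro always_eventually allI)
  qed
  then show ?thesis by (simp add: p_def)
qed

end
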